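(* Let $T>0$ and let $C:[0,T]\rightrightarrows\mathbb{R}^n$ be a multivalued mapping that is Lipschitz with respect to the Hausdorff distance, is definable in some o-minimal structure (i.e. its graph is a definable set), and has nonempty compact values $C(t)$, $t\in[0,T]$. Let $d:\mathbb{R}^{n+1}\to\mathbb{R}^n$ be continuous and let $x_0\in C(0)$. Then the perturbed sweeping process $$\dot x(t)\in d(x(t),t)-N_{C(t)}(x(t)),\qquad x(0)=x_0,\qquad x(t)\in C(t),$$ where $N_{C(t)}(x(t))$ denotes the cone of limiting normals to $C(t)$ at $x(t)$, has a solution on $[0,T]$.
   Context: Solution: an absolutely continuous function $x:[0,T]\to\mathbb{R}^n$ with $x(0)=x_0$, $x(t)\in C(t)$ for all $t\in[0,T]$, and satisfying the differential inclusion for almost every $t\in[0,T]$. O-minimal structure (expanding the real field $\mathbb{R}$): a collection $\mathcal{S}=(\mathcal{S}^n)_{n\in\mathbb{N}}$, where each $\mathcal{S}^n$ is a set of subsets of $\mathbb{R}^n$, such that: (1) all algebraic subsets of $\mathbb{R}^n$ (common zero sets of finitely many polynomials) are in $\mathcal{S}^n$; (2) $\mathcal{S}^n$ is a Boolean subalgebra of the power set of $\mathbb{R}^n$; (3) if $A\in\mathcal{S}^m$ and $B\in\mathcal{S}^n$ then $A\times B\in\mathcal{S}^{m+n}$; (4) if $p:\mathbb{R}^{n+1}\to\mathbb{R}^n$ is the projection on the first $n$ coordinates and $A\in\mathcal{S}^{n+1}$, then $p(A)\in\mathcal{S}^n$; (5) the elements of $\mathcal{S}^1$ are precisely the finite unions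 of points and intervals. Elements of $\mathcal{S}^n$ are called definable subsets of $\mathbb{R}^n$. A multivalued map is definable if its graph is a definable set. Normal cones: for a closed set $A\subset\mathbb{R}^n$ and $x\in A$, a vector $\zeta\in\mathbb{R}^n$ is a proximal normal to $A$ at $x$ if there is a real $s>0$ such that the metric projection of $x+s\zeta$ on $A$ coincides with $x$; the cone of all proximal normals is $\widehat N_A(x)$. The cone of limiting normals $N_A(x)$ is obtained by closing the graph of $x\mapsto\widehat N_A(x)$: $\zeta\in N_A(x)$ iff there are $x_k\in A$, $x_k\to x$, and $\zeta_k\in\widehat N_A(x_k)$ with $\zeta_k\to\zeta$. *)

theory Defs
  imports "HOL-Analysis.Analysis"
begin

section \<open>O-minimal structures\<close>

text \<open>
  An o-minimal structure involves all spaces \<open>\<real>\<^sup>n\<close> at once, so its members are sets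
  of real lists; \<open>\<real>\<^sup>n\<close> is the set of lists of length \<open>n\<close>, and \<open>n = 0\<close> is allowed.
\<close>

definition Rn :: "nat \<Rightarrow> real list set" where
  "Rn n = {xs. length xs = n}"

text \<open>A monomial is given by its exponent function, of which only the values below \<open>n\<close> matter.\<close>

definition polynomial_on_Rn :: "nat \<Rightarrow> (real list \<Rightarrow> real) \<Rightarrow> bool" where
  "polynomial_on_Rn n p \<longleftrightarrow>
     (\<exists>M c. finite (M :: (nat \<Rightarrow> nat) set) \<and>
        (\<forall>xs\<in>Rn n. p xs = (\<Sum>m\<in>M. c m * (\<Prod>i<n. (xs ! i) ^ m i))))"

definition algebraic_subset :: "nat \<Rightarrow> real list set \<Rightarrow> bool" where
  "algebraic_subset n A \<longleftrightarrow>
     (\<exists>P. finite P \<and> (\<forall>p\<in>P. polynomial_on_Rn n p) \<and> A = {xs\<in>Rn n. \<forall>p\<in>P. p xs = 0})"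

locale o_minimal_structure =
  fixes S :: "nat \<Rightarrow> real list set set"
  assumes algebraic: "\<And>n A. algebraic_subset n A \<Longrightarrow> A \<in> S n"
    and boolean: "\<And>n. algebra (Rn n) (S n)"
    and product: "\<And>m n A B. A \<in> S m \<Longrightarrow> B \<in> S n \<Longrightarrow> {xs @ ys | xs ys. xs \<in> A \<and> ys \<in> B} \<in> S (m + n)"
    and projection: "\<And>n A. A \<in> S (n + 1) \<Longrightarrow> take n ` A \<in> S n"
    and dim_one: "\<And>A. A \<in> S 1 \<longleftrightarrow>
      (\<exists>F. finite F \<and> (\<forall>I\<in>F. (\<exists>a. I = {a}) \<or> is_interval (I :: real set)) \<and> A = (\<lambda>x. [x]) ` (\<Union>F))"

text \<open>
  The graph of \<open>F : D \<rightrightarrows> \<real>\<^sup>n\<close> is a subset of \<open>\<real> \<times> \<real>\<^sup>n\<close>, read as a set of lists through an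
  enumeration \<open>e\<close> of the coordinates. Which enumeration is used is immaterial, since the
  members of an o-minimal structure are stable under permutations of coordinates.
\<close>

definition coords :: "(nat \<Rightarrow> 'n) \<Rightarrow> real ^ 'n \<Rightarrow> real list" where
  "coords e y = map (\<lambda>i. y $ e i) [0..<CARD('n)]"

definition definable_multimap ::
  "(nat \<Rightarrow> real list set set) \<Rightarrow> real set \<Rightarrow> (real \<Rightarrow> (real ^ 'n) set) \<Rightarrow> bool" where
  "definable_multimap S D F \<longleftrightarrow>
     (\<exists>e. bij_betw e {..<CARD('n)} UNIV \<and>
        {t # coords e y | t y. t \<in> D \<and> y \<in> F t} \<in> S (1 + CARD('n)))"


section \<open>Hausdorff distance and absolute continuity\<close>

text \<open>Meaningful for nonempty bounded sets, on which the suprema are finite.\<close>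

definition hausdorff_dist :: "'a::metric_space set \<Rightarrow> 'a set \<Rightarrow> real" where
  "hausdorff_dist A B = max (SUP a\<in>A. infdist a B) (SUP b\<in>B. infdist b A)"

definition hausdorff_lipschitz_on :: "real set \<Rightarrow> (real \<Rightarrow> 'a::metric_space set) \<Rightarrow> bool" where
  "hausdorff_lipschitz_on D F \<longleftrightarrow>
     (\<exists>L\<ge>0. \<forall>s\<in>D. \<forall>t\<in>D. hausdorff_dist (F s) (F t) \<le> L * \<bar>s - t\<bar>)"

text \<open>
  Not to be confused with \<open>absolutely_continuous\<close> of the library, which relates two measures.
\<close>

definition abs_continuous_on :: "real \<Rightarrow> real \<Rightarrow> (real \<Rightarrow> 'a::metric_space) \<Rightarrow> bool" where
  "abs_continuous_on u v f \<longleftrightarrow>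
     (\<forall>\<epsilon>>0. \<exists>\<delta>>0. \<forall>m a b.
        (\<forall>k<m. u \<le> a k \<and> a k \<le> b k \<and> b k \<le> v) \<longrightarrow>
        disjoint_family_on (\<lambda>k. {a k<..<b k}) {..<m} \<longrightarrow>
        (\<Sum>k<m. b k - a k) < \<delta> \<longrightarrow>
        (\<Sum>k<(m::nat). dist (f (a k)) (f (b k))) < \<epsilon>)"


section \<open>Normal cones\<close>

definition metric_projection :: "'a::metric_space set \<Rightarrow> 'a \<Rightarrow> 'a set" where
  "metric_projection A y = {a\<in>A. \<forall>b\<in>A. dist y a \<le> dist y b}"

definition proximal_normals :: "'a::euclidean_space set \<Rightarrow> 'a \<Rightarrow> 'a set" where
  "proximal_normals A x = {\<zeta>. \<exists>s>0. metric_projection A (x + s *\<^sub>R \<zeta>) = {x}}"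

definition limiting_normals :: "'a::euclidean_space set \<Rightarrow> 'a \<Rightarrow> 'a set" where
  "limiting_normals A x =
     {\<zeta>. \<exists>X Z. (\<forall>k::nat. X k \<in> A \<and> Z k \<in> proximal_normals A (X k)) \<and>
        X \<longlonglongrightarrow> x \<and> Z \<longlonglongrightarrow> \<zeta>}"


section \<open>Solutions of the perturbed sweeping process\<close>

definition sweeping_solution ::
  "real \<Rightarrow> (real \<Rightarrow> 'a::euclidean_space set) \<Rightarrow> ('a \<times> real \<Rightarrow> 'a) \<Rightarrow> 'a \<Rightarrow> (real \<Rightarrow> 'a) \<Rightarrow> bool" where
  "sweeping_solution T C d x0 x \<longleftrightarrow>
     abs_continuous_on 0 T x \<and>
     x 0 = x0 \<and>
     (\<forall>t\<in>{0..T}. x t \<in> C t) \<and>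
     (AE t in lebesgue_on {0..T}.
        \<exists>v. (x has_vector_derivative v) (at t within {0..T}) \<and>
            v \<in> {d (x t, t) - \<zeta> | \<zeta>. \<zeta> \<in> limiting_normals (C t) (x t)})"

end

theory Submission
  imports Defs
begin

text \<open>
  The catching-up scheme produces a Lipschitz limit \<open>x\<close>, and the only difficulty is that its
  velocities converge weakly while limiting normal cones are not convex. Definability supplies the
  missing tangency: outside a countable set of times, if \<open>x\<close> has derivative \<open>v\<close> at \<open>t\<close>, then
  \<open>dist (y + h v, C (s + h)) = o(h)\<close> uniformly as \<open>(s, y)\<close> tends to \<open>(t, x t)\<close> in the graph of
  \<open>C\<close>. Hence near \<open>t\<close> the normal parts of the discrete velocities have norm at most
  \<open>norm (d (x t, t) - v) + o(1)\<close>, while on short intervals they average to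
  \<open>d (x t, t) - v + o(1)\<close>; so some of them converge to \<open>d (x t, t) - v\<close>. They are proximal normals
  at nearby times, and outside another countable set of times the closure of a definable set can be
  taken in the fiber over \<open>t\<close> itself, which yields a limiting normal to \<open>C t\<close>.

  No stratification is needed for the tangency: all uses of o-minimality concern definable subsets
  of the line (one-sided germs and countable frontiers).
\<close>

section \<open>Polynomial functions in coordinates\<close>

text \<open>The trajectory \<open>x\<close> need not be definable, so it cannot enter a definable
  formula. Only its tangent line at a single time does, and a line is polynomial. For the same
  reason the derivative is replaced by a fixed parameter \<open>w\<close>: failure of tangency is
  tested for countably many pairs of a vector \<open>w\<close> from a dense set and a rational
  \<epsilon>, which is enough because every derivative is within \<epsilon> / 2 of some
  \<open>w\<close>. Tangency has to be uniform over points of the graph near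
  \<open>(t, x t)\<close>, since the nodes of the scheme lie near \<open>x\<close> but not on it,
  and at neighbouring times. The norm bound then comes from minimality: the next node is no farther
  from the predicted point than the point of \<open>C (s + h)\<close> that tangency supplies. The
  averaging at \<open>t\<close> compares the scheme with the limit only at \<open>t\<close> and at
  one later time, so a pointwise cluster point of the discrete trajectories suffices, and the number
  of grid cells may depend on \<open>t\<close>.\<close>

lemma polynomial_on_Rn_cong:
  assumes "polynomial_on_Rn n p" "\<And>xs. xs \<in> Rn n \<Longrightarrow> q xs = p xs"
  shows "polynomial_on_Rn n q"
proof -
  from assms(1) obtain M c where "finite (M :: (nat \<Rightarrow> nat) set)"
    "\<And>xs. xs \<in> Rn n \<Longrightarrow> p xs = (\<Sum>m\<in>M. c m * (\<Prod>i<n. (xs ! i) ^ m i))"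
    unfolding polynomial_on_Rn_def by blast
  then show ?thesis
    unfolding polynomial_on_Rn_def using assms(2) by (intro exI[of _ M] exI[of _ c]) auto
qed

lemma polynomial_on_Rn_const: "polynomial_on_Rn n (\<lambda>_. k)"
  unfolding polynomial_on_Rn_def by (intro exI[of _ "{\<lambda>_. 0}"] exI[of _ "\<lambda>_. k"]) simp

lemma polynomial_on_Rn_nth:
  assumes "i < n"
  shows "polynomial_on_Rn n (\<lambda>xs. xs ! i)"
proof -
  have "(\<Prod>j<n. (xs ! j) ^ (if j = i then 1 else 0)) = xs ! i" for xs :: "real list"
  proof -
    have "(\<Prod>j<n. (xs ! j) ^ (if j = i then 1 else 0)) = (\<Prod>j<n. if j = i then xs ! j else 1)"
      by (rule prod.cong) auto
    then show ?thesis
      using assms by simp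
  qed
  then show ?thesis
    unfolding polynomial_on_Rn_def
    by (intro exI[of _ "{\<lambda>j. if j = i then 1 else 0}"] exI[of _ "\<lambda>_. 1"]) simp
qed

lemma polynomial_on_Rn_add:
  assumes "polynomial_on_Rn n p" "polynomial_on_Rn n q"
  shows "polynomial_on_Rn n (\<lambda>xs. p xs + q xs)"
proof -
  obtain M c where M: "finite (M :: (nat \<Rightarrow> nat) set)"
    and p: "\<And>xs. xs \<in> Rn n \<Longrightarrow> p xs = (\<Sum>m\<in>M. c m * (\<Prod>i<n. (xs ! i) ^ m i))"
    using assms(1) unfolding polynomial_on_Rn_def by blast
  obtain N d where N: "finite (N :: (nat \<Rightarrow> nat) set)"
    and q: "\<And>xs. xs \<in> Rn n \<Longrightarrow> q xs = (\<Sum>m\<in>N. d m * (\<Prod>i<n. (xs ! i) ^ m i))"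
    using assms(2) unfolding polynomial_on_Rn_def by blast
  define e where "e m = (if m \<in> M then c m else 0) + (if m \<in> N then d m else 0)" for m
  have "p xs + q xs = (\<Sum>m\<in>M \<union> N. e m * (\<Prod>i<n. (xs ! i) ^ m i))" if "xs \<in> Rn n" for xs
  proof -
    have "(\<Sum>m\<in>M. c m * (\<Prod>i<n. (xs ! i) ^ m i)) =
        (\<Sum>m\<in>M \<union> N. (if m \<in> M then c m else 0) * (\<Prod>i<n. (xs ! i) ^ m i))"
      using M N by (intro sum.mono_neutral_cong_left) auto
    moreover have "(\<Sum>m\<in>N. d m * (\<Prod>i<n. (xs ! i) ^ m i)) =
        (\<Sum>m\<in>M \<union> N. (if m \<in> N then d m else 0) * (\<Prod>i<n. (xs ! i) ^ m i))"
      using M N by (intro sum.mono_neutral_cong_left) auto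
    ultimately show ?thesis
      by (simp add: p[OF that] q[OF that] e_def distrib_right sum.distrib)
  qed
  then show ?thesis
    unfolding polynomial_on_Rn_def using M N by (intro exI[of _ "M \<union> N"] exI[of _ e]) auto
qed

lemma polynomial_on_Rn_sum:
  assumes "finite I" "\<And>i. i \<in> I \<Longrightarrow> polynomial_on_Rn n (p i)"
  shows "polynomial_on_Rn n (\<lambda>xs. \<Sum>i\<in>I. p i xs)"
  using assms by (induction I rule: finite_induct)
    (auto simp: polynomial_on_Rn_const intro: polynomial_on_Rn_add)

lemma polynomial_on_Rn_mult_monomial:
  assumes "polynomial_on_Rn n p"
  shows "polynomial_on_Rn n (\<lambda>xs. k * (\<Prod>i<n. (xs ! i) ^ l i) * p xs)"
proof -
  obtain M c where M: "finite (M :: (nat \<Rightarrow> nat) set)"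
    and p: "\<And>xs. xs \<in> Rn n \<Longrightarrow> p xs = (\<Sum>m\<in>M. c m * (\<Prod>i<n. (xs ! i) ^ m i))"
    using assms unfolding polynomial_on_Rn_def by blast
  define sh where "sh m = (\<lambda>i. m i + l i)" for m :: "nat \<Rightarrow> nat"
  \<comment> \<open>Truncated subtraction inverts the shift \<open>sh\<close> on its image, and only
    exponents in that image are summed.\<close>
  define d where "d m = k * c (\<lambda>i. m i - l i)" for m
  have inj: "inj_on sh M"
    by (auto simp: sh_def inj_on_def fun_eq_iff)
  have d: "d (sh m) = k * c m" for m
    by (simp add: d_def sh_def)
  have "k * (\<Prod>i<n. (xs ! i) ^ l i) * p xs = (\<Sum>m\<in>sh ` M. d m * (\<Prod>i<n. (xs ! i) ^ m i))"
    if "xs \<in> Rn n" for xs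
    by (simp add: p[OF that] sum.reindex[OF inj] o_def d sum_distrib_left)
       (simp add: sh_def power_add prod.distrib mult_ac)
  then show ?thesis
    unfolding polynomial_on_Rn_def using M by (intro exI[of _ "sh ` M"] exI[of _ d]) auto
qed

lemma polynomial_on_Rn_mult:
  assumes "polynomial_on_Rn n p" "polynomial_on_Rn n q"
  shows "polynomial_on_Rn n (\<lambda>xs. p xs * q xs)"
proof -
  obtain M c where M: "finite (M :: (nat \<Rightarrow> nat) set)"
    and p: "\<And>xs. xs \<in> Rn n \<Longrightarrow> p xs = (\<Sum>m\<in>M. c m * (\<Prod>i<n. (xs ! i) ^ m i))"
    using assms(1) unfolding polynomial_on_Rn_def by blast
  have "polynomial_on_Rn n (\<lambda>xs. \<Sum>m\<in>M. c m * (\<Prod>i<n. (xs ! i) ^ m i) * q xs)"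
    by (intro polynomial_on_Rn_sum M polynomial_on_Rn_mult_monomial assms(2))
  then show ?thesis
    by (rule polynomial_on_Rn_cong) (simp add: p sum_distrib_right)
qed

section \<open>Linear combinations with list coordinates\<close>

lemma sum_lessThan_add:
  fixes f :: "nat \<Rightarrow> 'a::comm_monoid_add"
  shows "(\<Sum>i<m + n. f i) = (\<Sum>i<m. f i) + (\<Sum>i<n. f (m + i))"
  by (induction n) (simp_all add: add.assoc)

text \<open>Entries of \<open>xs\<close> past the end of \<open>bs\<close> are ignored. A longer
  list, with further coordinates appended, can therefore be read without first cutting it.\<close>

definition of_coords :: "'a::real_vector list \<Rightarrow> real list \<Rightarrow> 'a" where
  "of_coords bs xs = (\<Sum>i<length bs. xs ! i *\<^sub>R bs ! i)"

lemma of_coords_append: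
  assumes "length xs = length bs"
  shows "of_coords (bs @ cs) (xs @ ys) = of_coords bs xs + of_coords cs ys"
proof -
  have "of_coords (bs @ cs) (xs @ ys) =
      (\<Sum>i<length bs. (xs @ ys) ! i *\<^sub>R (bs @ cs) ! i)
      + (\<Sum>i<length cs. (xs @ ys) ! (length bs + i) *\<^sub>R (bs @ cs) ! (length bs + i))"
    unfolding of_coords_def length_append by (rule sum_lessThan_add)
  then show ?thesis
    using assms by (simp add: of_coords_def nth_append)
qed

lemma of_coords_Basis:
  fixes x :: "'a::euclidean_space"
  assumes "distinct bs" "set bs = Basis"
  shows "of_coords bs (map (\<lambda>b. x \<bullet> b) bs) = x"
proof -
  have "of_coords bs (map (\<lambda>b. x \<bullet> b) bs) = (\<Sum>i<length bs. (x \<bullet> bs ! i) *\<^sub>R bs ! i)"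
    by (simp add: of_coords_def)
  also have "\<dots> = (\<Sum>b\<leftarrow>bs. (x \<bullet> b) *\<^sub>R b)"
    by (simp add: sum_list_sum_nth atLeast0LessThan)
  also have "\<dots> = (\<Sum>b\<in>Basis. (x \<bullet> b) *\<^sub>R b)"
    using assms by (simp add: sum_list_distinct_conv_sum_set)
  finally show ?thesis
    by (simp add: euclidean_representation)
qed

lemma of_coords_map:
  assumes "linear f"
  shows "of_coords (map f bs) xs = f (of_coords bs xs)"
  using assms by (simp add: of_coords_def linear_sum linear_scale)

lemma polynomial_on_Rn_of_coords:
  assumes "real_polynomial_function f" "length bs \<le> n"
  shows "polynomial_on_Rn n (\<lambda>xs. f (of_coords bs xs))"
  using assms(1)
proof (induction f rule: real_polynomial_function.induct)
  case (linear f)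
  have "polynomial_on_Rn n (\<lambda>xs. \<Sum>i<length bs. xs ! i * f (bs ! i))"
    using assms(2)
    by (intro polynomial_on_Rn_sum polynomial_on_Rn_mult polynomial_on_Rn_const polynomial_on_Rn_nth) auto
  moreover have "linear f"
    using linear by (simp add: bounded_linear.linear)
  ultimately show ?case
    by (simp add: of_coords_def linear_sum linear_scale)
next
  case (const c)
  show ?case by (rule polynomial_on_Rn_const)
next
  case (add f g)
  then show ?case by (intro polynomial_on_Rn_add)
next
  case (mult f g)
  then show ?case by (intro polynomial_on_Rn_mult)
qed

section \<open>Vector-valued polynomial maps\<close>

lemma polynomial_function_linear_compose:
  assumes "polynomial_function f" "bounded_linear h"
  shows "polynomial_function (\<lambda>x. h (f x))"
  using assms unfolding polynomial_function_def by (auto simp: o_def intro: bounded_linear_compose)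

lemma polynomial_function_Pair:
  assumes "polynomial_function f" "polynomial_function g"
  shows "polynomial_function (\<lambda>x. (f x, g x))"
proof -
  have "bounded_linear (\<lambda>a::'b. (a, 0::'c))" "bounded_linear (\<lambda>b::'c. (0::'b, b))"
    by (auto intro: bounded_linear_Pair bounded_linear_ident bounded_linear_zero)
  then have "polynomial_function (\<lambda>x. (f x, 0::'c) + (0::'b, g x))"
    using assms by (intro polynomial_function_add) (auto dest: polynomial_function_linear_compose)
  then show ?thesis by simp
qed

lemma polynomial_function_fst: "polynomial_function f \<Longrightarrow> polynomial_function (\<lambda>x. fst (f x))"
  by (rule polynomial_function_linear_compose[OF _ bounded_linear_fst])

lemma polynomial_function_snd: "polynomial_function f \<Longrightarrow> polynomial_function (\<lambda>x. snd (f x))"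
  by (rule polynomial_function_linear_compose[OF _ bounded_linear_snd])

lemma polynomial_function_times:
  fixes f g :: "'a::real_normed_vector \<Rightarrow> real"
  shows "polynomial_function f \<Longrightarrow> polynomial_function g \<Longrightarrow> polynomial_function (\<lambda>x. f x * g x)"
  using polynomial_function_mult[of f g] by simp

lemma polynomial_function_power:
  fixes f :: "'a::real_normed_vector \<Rightarrow> real"
  shows "polynomial_function f \<Longrightarrow> polynomial_function (\<lambda>x. f x ^ n)"
  by (simp add: real_polynomial_function_power flip: real_polynomial_function_eq)

lemma polynomial_function_inner_left:
  "polynomial_function f \<Longrightarrow> polynomial_function (\<lambda>x. f x \<bullet> b)"
  by (rule polynomial_function_linear_compose[OF _ bounded_linear_inner_left])

lemma polynomial_function_inner:
  fixes f g :: "'a::real_normed_vector \<Rightarrow> 'b::euclidean_space"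
  assumes "polynomial_function f" "polynomial_function g"
  shows "polynomial_function (\<lambda>x. f x \<bullet> g x)"
proof -
  have "polynomial_function (\<lambda>x. \<Sum>b\<in>Basis. (f x \<bullet> b) * (g x \<bullet> b))"
    using assms by (intro polynomial_function_sum polynomial_function_times polynomial_function_inner_left) auto
  then show ?thesis
    by (simp flip: euclidean_inner)
qed

lemmas polynomial_function_intros =
  polynomial_function_id polynomial_function_const polynomial_function_fst polynomial_function_snd
  polynomial_function_Pair polynomial_function_add polynomial_function_diff polynomial_function_minus
  polynomial_function_mult polynomial_function_times polynomial_function_power
  polynomial_function_inner_left polynomial_function_inner

section \<open>Definable predicates on Euclidean spaces\<close>

context o_minimal_structure
begin

section \<open>Polynomial preimages of members of the structure\<close>

lemma S_sub: "A \<in> S n \<Longrightarrow> xs \<in> A \<Longrightarrow> length xs = n"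
  using boolean[of n] unfolding algebra_iff_Un Rn_def by blast

lemma S_Int: "A \<in> S n \<Longrightarrow> B \<in> S n \<Longrightarrow> A \<inter> B \<in> S n"
  using boolean[of n] unfolding algebra_iff_Int by blast

lemma S_Compl: "A \<in> S n \<Longrightarrow> Rn n - A \<in> S n"
  using boolean[of n] unfolding algebra_iff_Int by blast

lemma Rn_in_S: "Rn n \<in> S n"
  using algebra.top[OF boolean[of n]] by simp

lemma S_take: "A \<in> S (n + k) \<Longrightarrow> take n ` A \<in> S n"
proof (induction k arbitrary: A)
  case 0
  moreover have "take n ` A = A"
    using S_sub[OF 0] by force
  ultimately show ?case by simp
next
  case (Suc k)
  have "take (n + k) ` A \<in> S (n + k)"
    using projection[of A "n + k"] Suc.prems by simp
  from Suc.IH[OF this] show ?case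
    by (simp add: image_image min_def)
qed

text \<open>The graph trick: append to \<open>xs\<close> a block of new coordinates ranging over
  \<open>A\<close>, force the new coordinates to equal the polynomial values by an algebraic set,
  and project the block away.\<close>

lemma S_preimage_polynomial:
  assumes fs: "\<forall>f\<in>set fs. real_polynomial_function f" and A: "A \<in> S (length fs)"
  shows "{xs \<in> Rn (length bs). map (\<lambda>f. f (of_coords bs xs)) fs \<in> A} \<in> S (length bs)"
proof -
  let ?n = "length bs" and ?m = "length fs"
  define pol where "pol i zs = zs ! (?n + i) + (-1) * (fs ! i) (of_coords bs zs)" for i zs
  define B where "B = {xs @ ys | xs ys. xs \<in> Rn ?n \<and> ys \<in> A} \<inter> {zs \<in> Rn (?n + ?m). \<forall>p\<in>pol ` {..<?m}. p zs = 0}"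
  have "polynomial_on_Rn (?n + ?m) (pol i)" if "i < ?m" for i
    unfolding pol_def using fs that
    by (intro polynomial_on_Rn_add polynomial_on_Rn_mult polynomial_on_Rn_const
        polynomial_on_Rn_of_coords polynomial_on_Rn_nth) auto
  then have "algebraic_subset (?n + ?m) {zs \<in> Rn (?n + ?m). \<forall>p\<in>pol ` {..<?m}. p zs = 0}"
    unfolding algebraic_subset_def by (intro exI[of _ "pol ` {..<?m}"]) auto
  then have "B \<in> S (?n + ?m)"
    unfolding B_def by (intro S_Int product Rn_in_S A algebraic)
  then have "take ?n ` B \<in> S ?n"
    by (rule S_take)
  moreover have coords: "of_coords bs (xs @ ys) = of_coords bs xs" if "length xs = ?n" for xs ys
    using of_coords_append[OF that, of "[]" ys] by (simp add: of_coords_def)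
  have "take ?n ` B = {xs \<in> Rn ?n. map (\<lambda>f. f (of_coords bs xs)) fs \<in> A}"
  proof (intro set_eqI iffI)
    fix xs assume "xs \<in> take ?n ` B"
    then obtain ys where xs: "length xs = ?n" and ys: "ys \<in> A"
      and 0: "\<And>i. i < ?m \<Longrightarrow> pol i (xs @ ys) = 0"
      by (auto simp: B_def Rn_def)
    have "ys = map (\<lambda>f. f (of_coords bs xs)) fs"
    proof (rule nth_equalityI)
      show "length ys = length (map (\<lambda>f. f (of_coords bs xs)) fs)"
        using S_sub[OF A ys] by simp
      fix i assume "i < length ys"
      then have "i < ?m"
        using S_sub[OF A ys] by simp
      with 0[OF this] show "ys ! i = map (\<lambda>f. f (of_coords bs xs)) fs ! i"
        using xs by (simp add: pol_def coords nth_append)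
    qed
    with xs ys show "xs \<in> {xs \<in> Rn ?n. map (\<lambda>f. f (of_coords bs xs)) fs \<in> A}"
      by (simp add: Rn_def)
  next
    fix xs assume xs: "xs \<in> {xs \<in> Rn ?n. map (\<lambda>f. f (of_coords bs xs)) fs \<in> A}"
    define ys where "ys = map (\<lambda>f. f (of_coords bs xs)) fs"
    have "xs @ ys \<in> B"
      unfolding B_def using xs by (auto simp: Rn_def ys_def pol_def coords nth_append)
    then show "xs \<in> take ?n ` B"
      using xs by (intro image_eqI[of _ _ "xs @ ys"]) (auto simp: Rn_def)
  qed
  ultimately show ?thesis
    by simp
qed

text \<open>
  Definability over an arbitrary Euclidean space is expressed through finitely many polynomial
  functionals. With this choice, closure under polynomial substitution is immediate and only the
  quantifiers use the projection axiom.
\<close>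

definition definable :: "('a::euclidean_space \<Rightarrow> bool) \<Rightarrow> bool" where
  "definable P \<longleftrightarrow> (\<exists>fs A. (\<forall>f\<in>set fs. real_polynomial_function f) \<and> A \<in> S (length fs) \<and>
     (\<forall>x. P x \<longleftrightarrow> map (\<lambda>f. f x) fs \<in> A))"

lemma definableI:
  assumes "\<And>f. f \<in> set fs \<Longrightarrow> real_polynomial_function f" "A \<in> S (length fs)"
    "\<And>x. P x \<longleftrightarrow> map (\<lambda>f. f x) fs \<in> A"
  shows "definable P"
  unfolding definable_def using assms by blast

lemma definableE:
  assumes "definable P"
  obtains fs A where "\<forall>f\<in>set fs. real_polynomial_function f" "A \<in> S (length fs)"
    "\<And>x. P x \<longleftrightarrow> map (\<lambda>f. f x) fs \<in> A"
  using assms unfolding definable_def by blast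

lemma definable_imp_S:
  assumes "definable P"
  shows "{xs \<in> Rn (length bs). P (of_coords bs xs)} \<in> S (length bs)"
  using assms by (rule definableE) (simp add: S_preimage_polynomial)

section \<open>Connectives, substitution and quantifiers\<close>

lemma definable_not: "definable P \<Longrightarrow> definable (\<lambda>x. \<not> P x)"
  apply (erule definableE)
  subgoal for fs A
    by (rule definableI[of fs "Rn (length fs) - A"]) (simp_all add: S_Compl, simp add: Rn_def)
  done

lemma definable_conj:
  assumes "definable P" "definable Q"
  shows "definable (\<lambda>x. P x \<and> Q x)"
proof -
  obtain fs A where 1: "\<forall>f\<in>set fs. real_polynomial_function f" "A \<in> S (length fs)"
    "\<And>x. P x \<longleftrightarrow> map (\<lambda>f. f x) fs \<in> A"
    using definableE[OF assms(1)] by blast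
  obtain gs B where 2: "\<forall>f\<in>set gs. real_polynomial_function f" "B \<in> S (length gs)"
    "\<And>x. Q x \<longleftrightarrow> map (\<lambda>f. f x) gs \<in> B"
    using definableE[OF assms(2)] by blast
  show ?thesis
  proof (rule definableI[of "fs @ gs"])
    show "{xs @ ys | xs ys. xs \<in> A \<and> ys \<in> B} \<in> S (length (fs @ gs))"
      using product[OF 1(2) 2(2)] by simp
    show "P x \<and> Q x \<longleftrightarrow> map (\<lambda>f. f x) (fs @ gs) \<in> {xs @ ys | xs ys. xs \<in> A \<and> ys \<in> B}" for x
      using S_sub[OF 1(2)] by (auto simp: 1(3) 2(3))
  qed (use 1(1) 2(1) in auto)
qed

lemma definable_disj: "definable P \<Longrightarrow> definable Q \<Longrightarrow> definable (\<lambda>x. P x \<or> Q x)"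
  using definable_not[OF definable_conj[OF definable_not definable_not]] by simp

lemma definable_imp: "definable P \<Longrightarrow> definable Q \<Longrightarrow> definable (\<lambda>x. P x \<longrightarrow> Q x)"
  unfolding imp_conv_disj by (intro definable_disj definable_not)

lemma definable_compose:
  assumes "definable P" "polynomial_function g"
  shows "definable (\<lambda>x. P (g x))"
  using assms(1)
proof (rule definableE)
  fix fs A
  assume 1: "\<forall>f\<in>set fs. real_polynomial_function f" "A \<in> S (length fs)"
    "\<And>x. P x \<longleftrightarrow> map (\<lambda>f. f x) fs \<in> A"
  show ?thesis
  proof (rule definableI[of "map (\<lambda>f. f \<circ> g) fs"])
    show "real_polynomial_function f" if "f \<in> set (map (\<lambda>f. f \<circ> g) fs)" for f
      using that 1(1) assms(2) by (auto intro: real_polynomial_function_compose)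
  qed (use 1 in \<open>auto simp: o_def\<close>)
qed

text \<open>Once a pair is written with the coordinates of \<open>x\<close> first, quantifying over
  \<open>y\<close> is the projection that drops the last block.\<close>

lemma definable_ex:
  fixes P :: "'a::euclidean_space \<Rightarrow> 'b::euclidean_space \<Rightarrow> bool"
  assumes "definable (\<lambda>z. P (fst z) (snd z))"
  shows "definable (\<lambda>x. \<exists>y. P x y)"
proof -
  obtain as :: "'a list" where as: "distinct as" "set as = Basis"
    using finite_distinct_list[OF finite_Basis] by blast
  obtain bs :: "'b list" where bs: "distinct bs" "set bs = Basis"
    using finite_distinct_list[OF finite_Basis] by blast
  \<comment> \<open>A basis of the product space, ordered so that the block to be projected away
    comes last.\<close>
  define cs where "cs = map (\<lambda>a. (a, 0::'b)) as @ map (\<lambda>b. (0::'a, b)) bs"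
  have len: "length cs = length as + length bs"
    by (simp add: cs_def)
  have lin: "linear (\<lambda>a. (a, 0::'b))" "linear (\<lambda>b. (0::'a, b))"
    by (auto intro!: linearI)
  have cs: "of_coords cs (xs @ ys) = (of_coords as xs, of_coords bs ys)"
    if "length xs = length as" for xs ys
    using that unfolding cs_def by (simp add: of_coords_append of_coords_map[OF lin(1)] of_coords_map[OF lin(2)])
  define E where "E = {zs \<in> Rn (length cs). P (fst (of_coords cs zs)) (snd (of_coords cs zs))}"
  have "E \<in> S (length as + length bs)"
    using definable_imp_S[OF assms, of cs] by (simp add: E_def len)
  then have S: "take (length as) ` E \<in> S (length as)"
    by (rule S_take)
  show ?thesis
  proof (rule definableI[of "map (\<lambda>b x. x \<bullet> b) as"])
    show "real_polynomial_function f" if "f \<in> set (map (\<lambda>b x. x \<bullet> b) as)" for f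
      using that by (auto intro!: bounded_linear_inner_left)
    show "take (length as) ` E \<in> S (length (map (\<lambda>b x. x \<bullet> b) as))"
      using S by simp
    fix x
    let ?xs = "map (\<lambda>b. x \<bullet> b) as"
    have xs: "of_coords as ?xs = x"
      by (rule of_coords_Basis[OF as])
    have "(\<exists>y. P x y) \<longleftrightarrow> ?xs \<in> take (length as) ` E"
    proof
      assume "\<exists>y. P x y"
      then obtain y where y: "P x y" by blast
      let ?ys = "map (\<lambda>b. y \<bullet> b) bs"
      have "of_coords bs ?ys = y"
        by (rule of_coords_Basis[OF bs])
      then have "?xs @ ?ys \<in> E"
        using y xs by (simp add: E_def Rn_def len cs)
      then show "?xs \<in> take (length as) ` E"
        by (intro image_eqI[of _ _ "?xs @ ?ys"]) auto
    next
      assume "?xs \<in> take (length as) ` E"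
      then obtain zs where zs: "zs \<in> E" "?xs = take (length as) zs" by blast
      then have "zs = ?xs @ drop (length as) zs"
        by simp
      then have "of_coords cs zs = (x, of_coords bs (drop (length as) zs))"
        using cs[of ?xs "drop (length as) zs"] xs by simp
      then show "\<exists>y. P x y"
        using zs(1) by (auto simp: E_def)
    qed
    then show "(\<exists>y. P x y) \<longleftrightarrow> map (\<lambda>f. f x) (map (\<lambda>b x. x \<bullet> b) as) \<in> take (length as) ` E"
      by (simp add: o_def)
  qed
qed

lemma definable_all:
  fixes P :: "'a::euclidean_space \<Rightarrow> 'b::euclidean_space \<Rightarrow> bool"
  assumes "definable (\<lambda>z. P (fst z) (snd z))"
  shows "definable (\<lambda>x. \<forall>y. P x y)"
  using definable_not[OF definable_ex[of "\<lambda>x y. \<not> P x y", OF definable_not[OF assms]]] by simp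

section \<open>Definable order relations, equations and norms\<close>

lemma definable_interval:
  assumes "polynomial_function f" "is_interval I"
  shows "definable (\<lambda>x. f x \<in> (I :: real set))"
proof (rule definableI[of "[f]" "(\<lambda>x. [x]) ` I"])
  have "(\<lambda>x. [x]) ` I \<in> S 1"
    unfolding dim_one using assms(2) by (intro exI[of _ "{I}"]) auto
  then show "(\<lambda>x. [x]) ` I \<in> S (length [f])"
    by simp
qed (use assms(1) in \<open>auto simp: real_polynomial_function_eq\<close>)

lemma definable_less:
  fixes f g :: "'a::euclidean_space \<Rightarrow> real"
  shows "polynomial_function f \<Longrightarrow> polynomial_function g \<Longrightarrow> definable (\<lambda>x. f x < g x)"
  using definable_interval[of "\<lambda>x. g x - f x" "{0<..}"] by (simp add: polynomial_function_diff is_interval_oi)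

lemma definable_le:
  fixes f g :: "'a::euclidean_space \<Rightarrow> real"
  shows "polynomial_function f \<Longrightarrow> polynomial_function g \<Longrightarrow> definable (\<lambda>x. f x \<le> g x)"
  using definable_interval[of "\<lambda>x. g x - f x" "{0..}"] by (simp add: polynomial_function_diff is_interval_ci)

lemma definable_eq:
  fixes f g :: "'a::euclidean_space \<Rightarrow> 'b::euclidean_space"
  assumes "polynomial_function f" "polynomial_function g"
  shows "definable (\<lambda>x. f x = g x)"
proof -
  have "definable (\<lambda>x. (f x - g x) \<bullet> (f x - g x) \<le> 0)"
    by (intro definable_le polynomial_function_intros assms)
  moreover have "u \<bullet> u \<le> 0 \<longleftrightarrow> u = 0" for u :: 'b
    using inner_gt_zero_iff[of u] by (simp flip: not_less)
  ultimately show ?thesis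
    by simp
qed

lemma definable_const: "definable (\<lambda>_. b)"
  using definable_eq[of "\<lambda>_. 0::real" "\<lambda>_. if b then 0 else 1"] by (cases b) auto

lemma definable_ball:
  assumes "finite I" "\<And>i. i \<in> I \<Longrightarrow> definable (P i)"
  shows "definable (\<lambda>x. \<forall>i\<in>I. P i x)"
  using assms
proof (induction I rule: finite_induct)
  case empty
  then show ?case by (simp add: definable_const)
next
  case (insert i I)
  then show ?case by (simp add: definable_conj)
qed

text \<open>The norm is not polynomial but its square is; the sign condition on the right side makes
  squaring reversible.\<close>

lemma definable_norm_less:
  fixes f :: "'a::euclidean_space \<Rightarrow> 'b::euclidean_space"
  assumes "polynomial_function f" "polynomial_function g"
  shows "definable (\<lambda>x. norm (f x) < g x)"
proof -
  have "definable (\<lambda>x. 0 < g x \<and> f x \<bullet> f x < g x ^ 2)"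
    by (intro definable_conj definable_less polynomial_function_intros assms)
  moreover have "norm (f x) < g x \<longleftrightarrow> 0 < g x \<and> f x \<bullet> f x < g x ^ 2" for x
    by (rule norm_lt_square)
  ultimately show ?thesis by simp
qed

lemmas definable_logic = definable_conj definable_disj definable_imp definable_not
  definable_ex definable_all definable_const
  definable_less definable_le definable_eq definable_norm_less

text \<open>Tameness enters only here: one-sided germs and countable frontiers are both read off
  this decomposition. Points are absorbed as degenerate intervals.\<close>

lemma definable_real_cases:
  assumes "definable (P :: real \<Rightarrow> bool)"
  shows "\<exists>F. finite F \<and> (\<forall>I\<in>F. is_interval I) \<and> {x. P x} = \<Union>F"
proof -
  have "{xs \<in> Rn 1. P (of_coords [1] xs)} \<in> S 1"
    using definable_imp_S[OF assms, of "[1]"] by simp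
  from iffD1[OF dim_one this]
  obtain F where F: "finite F" "\<forall>I\<in>F. (\<exists>a. I = {a}) \<or> is_interval (I::real set)"
    and eq: "{xs \<in> Rn 1. P (of_coords [1] xs)} = (\<lambda>x. [x]) ` \<Union>F"
    by (elim exE conjE)
  have "P x \<longleftrightarrow> x \<in> \<Union>F" for x
  proof -
    have "P x \<longleftrightarrow> [x] \<in> {xs \<in> Rn 1. P (of_coords [1] xs)}"
      by (simp add: Rn_def of_coords_def)
    also have "\<dots> \<longleftrightarrow> x \<in> \<Union>F"
      unfolding eq by auto
    finally show ?thesis .
  qed
  then have "{x. P x} = \<Union>F"
    by blast
  moreover have "is_interval I" if "I \<in> F" for I
    using bspec[OF F(2) that]
  proof
    assume "\<exists>a. I = {a}"
    then obtain a where "I = {a}" ..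
    then show ?thesis
      using is_interval_cc[of a a] by simp
  qed
  ultimately show ?thesis
    using F(1) by blast
qed

end

section \<open>Germs of definable functions of one variable\<close>

text \<open>A frontier point cannot lie strictly between two points of \<open>I\<close>, so it
  bounds \<open>I\<close> on one side and, lying in the closure, is the corresponding infimum or
  supremum. If \<open>I\<close> is unbounded on the other side, the meaningless value there merely
  enlarges the right side.\<close>

lemma frontier_real_interval:
  assumes "is_interval (I :: real set)"
  shows "frontier I \<subseteq> {Inf I, Sup I}"
proof
  fix t assume t: "t \<in> frontier I"
  then have cl: "t \<in> closure I" and ni: "t \<notin> interior I"
    by (auto simp: frontier_def)
  have ne: "I \<noteq> {}"
    using cl by auto
  have "\<not> (\<exists>a\<in>I. \<exists>b\<in>I. a < t \<and> t < b)"
  proof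
    assume "\<exists>a\<in>I. \<exists>b\<in>I. a < t \<and> t < b"
    then obtain a b where ab: "a \<in> I" "b \<in> I" "a < t" "t < b" by blast
    have "{a<..<b} \<subseteq> I"
      using mem_is_interval_1_I[OF assms ab(1) ab(2)] by (auto simp: less_imp_le)
    then show False
      using ni ab interior_maximal[of "{a<..<b}" I] by auto
  qed
  then consider "\<And>x. x \<in> I \<Longrightarrow> t \<le> x" | "\<And>x. x \<in> I \<Longrightarrow> x \<le> t"
    by (meson not_le)
  then show "t \<in> {Inf I, Sup I}"
  proof cases
    case 1
    then have "closure I \<subseteq> {Inf I..}"
      by (intro closure_minimal) (auto intro!: cInf_lower bdd_belowI)
    with cl cInf_greatest[OF ne 1] show ?thesis
      by auto
  next
    case 2
    then have "closure I \<subseteq> {..Sup I}"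
      by (intro closure_minimal) (auto intro!: cSup_upper bdd_aboveI)
    with cl cSup_least[OF ne 2] show ?thesis
      by auto
  qed
qed

text \<open>Choose a rational in the gap to the right of each such point. The gap of the smaller of
  two points ends no later than the larger point, so the chosen rationals are distinct.\<close>

lemma countable_right_isolated:
  fixes X :: "real set"
  shows "countable {t \<in> X. \<exists>e>0. X \<inter> {t<..<t + e} = {}}" (is "countable ?Y")
proof -
  have "\<forall>t\<in>?Y. \<exists>q. q \<in> \<rat> \<and> t < q \<and> X \<inter> {t<..<q} = {}"
  proof
    fix t assume "t \<in> ?Y"
    obtain e where e: "e > 0" "X \<inter> {t<..<t + e} = {}"
      using \<open>t \<in> ?Y\<close> by auto
    obtain q where "q \<in> \<rat>" "t < q" "q < t + e"
      using Rats_dense_in_real[of t "t + e"] e(1) by auto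
    then show "\<exists>q. q \<in> \<rat> \<and> t < q \<and> X \<inter> {t<..<q} = {}"
      using e(2) by (intro exI[of _ q] conjI) (auto simp: disjoint_iff)
  qed
  from bchoice[OF this] obtain q
    where q: "\<And>t. t \<in> ?Y \<Longrightarrow> q t \<in> \<rat> \<and> t < q t \<and> X \<inter> {t<..<q t} = {}"
    by auto
  have "inj_on q ?Y"
  proof (rule linorder_inj_onI)
    fix s t assume "s < t" "s \<in> ?Y" "t \<in> ?Y"
    then show "q s \<noteq> q t"
      using q[of s] q[of t] by auto
  qed auto
  moreover have "q ` ?Y \<subseteq> \<rat>"
    by (rule image_subsetI) (use q in \<open>rule conjunct1\<close>)
  ultimately show ?thesis
    using countable_image_inj_on[OF countable_subset[OF _ countable_rat]] by auto
qed

text \<open>Isolate each such point by an interval with rational endpoints. Two points sharing an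
  interval would each see the other with sign \<open>r\<close>, so that \<open>r = - r\<close>. The
  parameter treats minima (\<open>r = 1\<close>) and maxima (\<open>r = -1\<close>) at once.\<close>

lemma countable_strict_local_extrema:
  fixes g :: "real \<Rightarrow> real"
  assumes "r \<noteq> 0"
  shows "countable {t. \<exists>e>0. \<forall>u. u \<noteq> t \<and> \<bar>u - t\<bar> < e \<longrightarrow> sgn (g u - g t) = r}" (is "countable ?Y")
proof -
  have "\<forall>t\<in>?Y. \<exists>pq. pq \<in> \<rat> \<times> \<rat> \<and> fst pq < t \<and> t < snd pq \<and>
      (\<forall>u. u \<noteq> t \<and> fst pq < u \<and> u < snd pq \<longrightarrow> sgn (g u - g t) = r)"
  proof
    fix t assume "t \<in> ?Y"
    obtain e where e: "e > 0" "\<And>u. u \<noteq> t \<Longrightarrow> \<bar>u - t\<bar> < e \<Longrightarrow> sgn (g u - g t) = r"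
      using \<open>t \<in> ?Y\<close> by auto
    obtain p where "p \<in> \<rat>" "t - e < p" "p < t"
      using Rats_dense_in_real[of "t - e" t] e(1) by auto
    moreover obtain q where "q \<in> \<rat>" "t < q" "q < t + e"
      using Rats_dense_in_real[of t "t + e"] e(1) by auto
    ultimately show "\<exists>pq. pq \<in> \<rat> \<times> \<rat> \<and> fst pq < t \<and> t < snd pq \<and>
      (\<forall>u. u \<noteq> t \<and> fst pq < u \<and> u < snd pq \<longrightarrow> sgn (g u - g t) = r)"
      by (intro exI[of _ "(p, q)"]) (auto intro!: e(2))
  qed
  from bchoice[OF this] obtain pq where pq: "\<And>t. t \<in> ?Y \<Longrightarrow> pq t \<in> \<rat> \<times> \<rat> \<and> fst (pq t) < t \<and> t < snd (pq t) \<and>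
      (\<forall>u. u \<noteq> t \<and> fst (pq t) < u \<and> u < snd (pq t) \<longrightarrow> sgn (g u - g t) = r)"
    by auto
  have "inj_on pq ?Y"
  proof (rule inj_onI, rule ccontr)
    fix s t assume st: "s \<in> ?Y" "t \<in> ?Y" "pq s = pq t" "s \<noteq> t"
    then have "sgn (g t - g s) = r" "sgn (g s - g t) = r"
      using pq[of s] pq[of t] by auto
    then have "r = - r"
      by (metis minus_diff_eq sgn_minus)
    with assms show False by simp
  qed
  moreover have "pq ` ?Y \<subseteq> \<rat> \<times> \<rat>"
    by (rule image_subsetI) (use pq in \<open>rule conjunct1\<close>)
  moreover have "countable (\<rat> \<times> \<rat> :: (real \<times> real) set)"
    by (intro countable_SIGMA countable_rat)
  ultimately show ?thesis
    using countable_image_inj_on[OF countable_subset] by auto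
qed

text \<open>Let \<open>c\<close> be the supremum of the \<open>u\<close> in \<open>{x..y}\<close>
  with \<open>f x \<le> f u\<close>. The left condition at \<open>c\<close> gives
  \<open>f x \<le> f c\<close>, which continuity would otherwise have to provide, and the right
  condition excludes \<open>c < y\<close>.\<close>

lemma locally_mono_imp_le:
  fixes f :: "real \<Rightarrow> real"
  assumes "x < y"
    and right: "\<And>t. x \<le> t \<Longrightarrow> t < y \<Longrightarrow> \<forall>\<^sub>F u in at_right t. f t \<le> f u"
    and left: "\<And>t. x < t \<Longrightarrow> t \<le> y \<Longrightarrow> \<forall>\<^sub>F u in at_left t. f u \<le> f t"
  shows "f x \<le> f y"
proof -
  define A where "A = {u \<in> {x..y}. f x \<le> f u}"
  define c where "c = Sup A"
  have x: "x \<in> A" using assms(1) by (simp add: A_def)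
  have bdd: "bdd_above A" by (auto simp: A_def intro!: bdd_aboveI[of _ y])
  have cx: "x \<le> c" unfolding c_def using x bdd by (rule cSup_upper)
  have cy: "c \<le> y" unfolding c_def using x by (intro cSup_least) (auto simp: A_def)
  have cA: "c \<in> A"
  proof (cases "c = x")
    case True
    then show ?thesis using x by simp
  next
    case False
    then have "\<forall>\<^sub>F u in at_left c. f u \<le> f c"
      using left cx cy by simp
    then obtain b where b: "b < c" "\<And>u. b < u \<Longrightarrow> u < c \<Longrightarrow> f u \<le> f c"
      unfolding eventually_at_left_field by blast
    obtain u where u: "u \<in> A" "b < u"
      using less_cSupD[of A b] x b(1) unfolding c_def by blast
    then have "u \<le> c" unfolding c_def using bdd by (intro cSup_upper)
    then have "f u \<le> f c"
      using b(2)[of u] u(2) by (cases "u = c") auto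
    then show ?thesis
      using u(1) cx cy by (simp add: A_def)
  qed
  have "c = y"
  proof (rule ccontr)
    assume "c \<noteq> y"
    then have "c < y" using cy by simp
    then have "\<forall>\<^sub>F u in at_right c. f c \<le> f u"
      using right cx by simp
    then obtain b where b: "c < b" "\<And>u. c < u \<Longrightarrow> u < b \<Longrightarrow> f c \<le> f u"
      unfolding eventually_at_right_field by blast
    obtain u where u: "c < u" "u < min b y"
      using dense[of c "min b y"] b(1) \<open>c < y\<close> by auto
    then have "f c \<le> f u"
      using b(2)[of u] by simp
    then have "u \<in> A"
      using cA u cx by (simp add: A_def)
    then have "u \<le> c"
      unfolding c_def using bdd by (intro cSup_upper)
    with u show False by simp
  qed
  with cA show ?thesis by (simp add: A_def)
qed

text \<open>The left difference is oriented so that monotonicity amounts to \<open>r = l\<close>.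
  Opposite nonzero signs would make every point of an interval a strict local extremum, against
  countability. If one sign is 0, then \<open>g\<close> is constant on one side of a point, and at
  points inside that stretch the other sign must be 0 too.\<close>

lemma constant_germ_signs_imp_monotone:
  fixes g :: "real \<Rightarrow> real"
  assumes "a < c"
    and right: "\<And>t. a < t \<Longrightarrow> t < c \<Longrightarrow> \<forall>\<^sub>F u in at_right t. sgn (g u - g t) = r"
    and left: "\<And>t. a < t \<Longrightarrow> t < c \<Longrightarrow> \<forall>\<^sub>F u in at_left t. sgn (g t - g u) = l"
  shows "\<exists>s\<in>{1, -1}. mono_on {a<..<c} (\<lambda>t. s * g t)"
proof -
  define t where "t = (a + c) / 2"
  have t: "a < t" "t < c" using assms(1) by (auto simp: t_def)
  have rl: "r = l"
  proof (rule ccontr)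
    assume "r \<noteq> l"
    have r_cases: "r \<in> {-1, 0, 1}"
      using eventually_happens'[OF _ right[OF t]] by (auto simp: sgn_if split: if_splits)
    have l_cases: "l \<in> {-1, 0, 1}"
      using eventually_happens'[OF _ left[OF t]] by (auto simp: sgn_if split: if_splits)
    have "r \<noteq> 0"
    proof
      assume "r = 0"
      obtain b where b: "t < b" "\<And>u. t < u \<Longrightarrow> u < b \<Longrightarrow> g u = g t"
        using right[OF t] \<open>r = 0\<close> unfolding eventually_at_right_field by (auto simp: sgn_eq_0_iff)
      obtain m where m: "t < m" "m < min b c"
        using dense[of t "min b c"] b(1) t by auto
      have "\<forall>\<^sub>F u in at_left m. t < u \<and> u < m"
        using m(1) by (auto simp: eventually_at_left_field)
      then have "\<forall>\<^sub>F u in at_left m. sgn (g m - g u) = 0"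
        by eventually_elim (use b(2) m in auto)
      moreover have "\<forall>\<^sub>F u in at_left m. sgn (g m - g u) = l"
        using left[of m] m t by auto
      ultimately have "\<forall>\<^sub>F u in at_left m. l = 0"
        by eventually_elim simp
      then show False
        using \<open>r \<noteq> l\<close> \<open>r = 0\<close> by simp
    qed
    have "l \<noteq> 0"
    proof
      assume "l = 0"
      obtain b where b: "b < t" "\<And>u. b < u \<Longrightarrow> u < t \<Longrightarrow> g u = g t"
        using left[OF t] \<open>l = 0\<close> unfolding eventually_at_left_field by (auto simp: sgn_eq_0_iff)
      obtain m where m: "max a b < m" "m < t"
        using dense[of "max a b" t] b(1) t by auto
      have "\<forall>\<^sub>F u in at_right m. m < u \<and> u < t"
        using m(2) by (auto simp: eventually_at_right_field)
      then have "\<forall>\<^sub>F u in at_right m. sgn (g u - g m) = 0"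
        by eventually_elim (use b(2) m in auto)
      moreover have "\<forall>\<^sub>F u in at_right m. sgn (g u - g m) = r"
        using right[of m] m t by auto
      ultimately have "\<forall>\<^sub>F u in at_right m. r = 0"
        by eventually_elim simp
      then show False
        using \<open>r \<noteq> 0\<close> by simp
    qed
    then have l: "l = - r"
      using \<open>r \<noteq> l\<close> \<open>r \<noteq> 0\<close> r_cases l_cases by auto
    have "{a<..<c} \<subseteq> {t. \<exists>e>0. \<forall>u. u \<noteq> t \<and> \<bar>u - t\<bar> < e \<longrightarrow> sgn (g u - g t) = r}"
    proof (clarify)
      fix t assume "t \<in> {a<..<c}"
      then have t: "a < t" "t < c" by auto
      obtain b where b: "t < b" "\<And>u. t < u \<Longrightarrow> u < b \<Longrightarrow> sgn (g u - g t) = r"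
        using right[OF t] unfolding eventually_at_right_field by blast
      obtain b' where b': "b' < t" "\<And>u. b' < u \<Longrightarrow> u < t \<Longrightarrow> sgn (g t - g u) = l"
        using left[OF t] unfolding eventually_at_left_field by blast
      show "\<exists>e>0. \<forall>u. u \<noteq> t \<and> \<bar>u - t\<bar> < e \<longrightarrow> sgn (g u - g t) = r"
      proof (intro exI[of _ "min (b - t) (t - b')"] conjI allI impI)
        fix u assume u: "u \<noteq> t \<and> \<bar>u - t\<bar> < min (b - t) (t - b')"
        show "sgn (g u - g t) = r"
        proof (cases "t < u")
          case True
          then show ?thesis using b(2)[of u] u by auto
        next
          case False
          then have "sgn (g t - g u) = - r" using b'(2)[of u] u l by auto
          then show ?thesis by (metis minus_diff_eq minus_minus sgn_minus)
        qed
      qed (use b(1) b'(1) in auto)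
    qed
    then have "countable {a<..<c}"
      using countable_strict_local_extrema[OF \<open>r \<noteq> 0\<close>] by (rule countable_subset)
    then show False
      using uncountable_open_interval[of a c] assms(1) by blast
  qed
  \<comment> \<open>For \<open>r = 0\<close> the function is locally constant and either orientation
    would do.\<close>
  define s :: real where "s = (if r = -1 then -1 else 1)"
  have s: "0 \<le> s * y" if "sgn y = r" for y
    using that by (auto simp: s_def sgn_if split: if_splits)
  have "mono_on {a<..<c} (\<lambda>t. s * g t)"
  proof (rule mono_onI)
    fix x y assume xy: "x \<in> {a<..<c}" "y \<in> {a<..<c}" "x \<le> y"
    show "s * g x \<le> s * g y"
    proof (cases "x = y")
      case False
      show ?thesis
      proof (rule locally_mono_imp_le[of x y "\<lambda>t. s * g t"])
        show "x < y" using False xy by simp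
        show "\<forall>\<^sub>F u in at_right t. s * g t \<le> s * g u" if "x \<le> t" "t < y" for t
        proof -
          have "\<forall>\<^sub>F u in at_right t. sgn (g u - g t) = r"
            using right[of t] that xy by auto
          then show ?thesis
            by eventually_elim (use s in \<open>force simp: right_diff_distrib\<close>)
        qed
        show "\<forall>\<^sub>F u in at_left t. s * g u \<le> s * g t" if "x < t" "t \<le> y" for t
        proof -
          have "\<forall>\<^sub>F u in at_left t. sgn (g t - g u) = r"
            using left[of t] that xy rl by auto
          then show ?thesis
            by eventually_elim (use s in \<open>force simp: right_diff_distrib\<close>)
        qed
      qed
    qed simp
  qed
  moreover have "s \<in> {1, -1}" by (simp add: s_def)
  ultimately show ?thesis by blast
qed

context o_minimal_structure
begin

section \<open>Germs and frontiers of definable subsets of the line\<close>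

text \<open>If one of the finitely many intervals accumulates at \<open>a\<close> from the right,
  convexity makes it fill a right neighbourhood of \<open>a\<close>. Otherwise all of them leave a
  common neighbourhood.\<close>

lemma definable_at_right:
  fixes P :: "real \<Rightarrow> bool"
  assumes "definable P"
  shows "(\<forall>\<^sub>F t in at_right a. P t) \<or> (\<forall>\<^sub>F t in at_right a. \<not> P t)"
proof -
  obtain F where F: "finite F" "\<And>I. I \<in> F \<Longrightarrow> is_interval I" and P: "{x. P x} = \<Union>F"
    using definable_real_cases[OF assms] by auto
  show ?thesis
  proof (cases "\<exists>I\<in>F. \<exists>\<^sub>F t in at_right a. t \<in> I")
    case True
    then obtain I where I: "I \<in> F" "\<exists>\<^sub>F t in at_right a. t \<in> I" by blast
    have near: "\<exists>t\<in>I. a < t \<and> t < b" if "a < b" for b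
    proof -
      have "\<forall>\<^sub>F t in at_right a. a < t \<and> t < b"
        using that by (auto simp: eventually_at_right_field)
      from frequently_ex[OF frequently_eventually_conj[OF I(2) this]] show ?thesis
        by blast
    qed
    obtain t0 where t0: "t0 \<in> I" "a < t0"
      using near[of "a + 1"] by auto
    have "P s" if "a < s" "s < t0" for s
    proof -
      obtain t where "t \<in> I" "a < t" "t < s"
        using near \<open>a < s\<close> by blast
      then have "s \<in> I"
        using mem_is_interval_1_I[OF F(2)[OF I(1)], of t t0 s] t0(1) that(2) by simp
      then show ?thesis using P I(1) by blast
    qed
    then show ?thesis
      using t0(2) unfolding eventually_at_right_field by blast
  next
    case False
    then have "\<forall>I\<in>F. \<forall>\<^sub>F t in at_right a. t \<notin> I"
      by (simp add: not_frequently)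
    then have "\<forall>\<^sub>F t in at_right a. \<forall>I\<in>F. t \<notin> I"
      using F(1) by (simp add: eventually_ball_finite_distrib)
    then have "\<forall>\<^sub>F t in at_right a. \<not> P t"
      by eventually_elim (use P in blast)
    then show ?thesis ..
  qed
qed

lemma definable_at_left:
  fixes P :: "real \<Rightarrow> bool"
  assumes "definable P"
  shows "(\<forall>\<^sub>F t in at_left a. P t) \<or> (\<forall>\<^sub>F t in at_left a. \<not> P t)"
proof -
  have "definable (\<lambda>t. P (- t))"
    by (intro definable_compose[OF assms] polynomial_function_intros)
  from definable_at_right[OF this, of "- a"] show ?thesis
    by (simp add: at_left_minus[of a] eventually_filtermap)
qed

lemma countable_frontier_definable:
  assumes "definable (P :: real \<Rightarrow> bool)"
  shows "countable (frontier {t. P t})"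
proof -
  obtain F where F: "finite F" "\<And>I. I \<in> F \<Longrightarrow> is_interval I" and P: "{x. P x} = \<Union>F"
    using definable_real_cases[OF assms] by auto
  have "frontier {t. P t} \<subseteq> (\<Union>I\<in>F. frontier I)"
    unfolding P using F(1) by (rule frontier_Union_subset)
  also have "\<dots> \<subseteq> (\<Union>I\<in>F. {Inf I, Sup I})"
    using F(2) frontier_real_interval by blast
  finally show ?thesis
    by (rule countable_subset) (use F(1) in \<open>auto intro!: countable_finite\<close>)
qed

text \<open>
  The exceptional times lie in the frontiers of the definable sets of times at which the fiber
  meets one of countably many balls.
\<close>

lemma countable_closure_fiber_defect:
  fixes P :: "real \<times> 'b::euclidean_space \<Rightarrow> bool"
  assumes "definable P"
  shows "countable {t. \<exists>p. (t, p) \<in> closure {z. P z} \<and> p \<notin> closure {q. P (t, q)}}"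
proof -
  obtain D :: "'b set" where D: "countable D" "\<And>X. open X \<Longrightarrow> X \<noteq> {} \<Longrightarrow> \<exists>d\<in>D. d \<in> X"
    using countable_dense_exists by blast
  define U where "U d q = {s. \<exists>y. P (s, y) \<and> norm (y - d) < q}" for d :: 'b and q :: real
  have "definable (\<lambda>s. \<exists>y. P (s, y) \<and> norm (y - d) < q)" for d q
    by (intro definable_logic definable_compose[OF assms] polynomial_function_intros)
  then have "countable (frontier (U d q))" for d q
    unfolding U_def by (rule countable_frontier_definable)
  then have "countable (\<Union>d\<in>D. \<Union>q\<in>\<rat>. frontier (U d q))"
    using D(1) countable_rat by blast
  then show ?thesis
  proof (rule countable_subset[rotated], clarify)
    fix t p assume cl: "(t, p) \<in> closure {z. P z}" and p: "p \<notin> closure {q. P (t, q)}"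
    then obtain r where r: "r > 0" "\<And>y. P (t, y) \<Longrightarrow> r \<le> dist y p"
      unfolding closure_approachable by (auto simp: not_less)
    obtain d where d: "d \<in> D" "dist p d < r / 4"
      using D(2)[of "ball p (r / 4)"] r(1) by auto
    obtain q where q: "q \<in> \<rat>" "r / 4 < q" "q < r / 2"
      using Rats_dense_in_real[of "r / 4" "r / 2"] r(1) by auto
    have "t \<notin> U d q"
    proof
      assume "t \<in> U d q"
      then obtain y where y: "P (t, y)" "dist y d < q"
        by (auto simp: U_def dist_norm)
      have "dist y p \<le> dist y d + dist p d"
        by (rule dist_triangle2)
      with y(2) d(2) q r(2)[OF y(1)] r(1) show False by linarith
    qed
    moreover have "t \<in> closure (U d q)"
      unfolding closure_approachable
    proof (intro allI impI)
      fix e :: real assume "e > 0"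
      then have "min e (q - dist p d) > 0"
        using d(2) q(2) by simp
      then obtain s y where sy: "P (s, y)" "dist (s, y) (t, p) < min e (q - dist p d)"
        using cl unfolding closure_approachable by fastforce
      have "dist s t \<le> dist (s, y) (t, p)" "dist y p \<le> dist (s, y) (t, p)"
        using dist_fst_le[of "(s, y)" "(t, p)"] dist_snd_le[of "(s, y)" "(t, p)"] by auto
      moreover have "dist y d \<le> dist y p + dist p d"
        by (rule dist_triangle)
      ultimately show "\<exists>s\<in>U d q. dist s t < e"
        using sy by (intro bexI[of _ s]) (auto simp: U_def dist_norm[symmetric])
    qed
    ultimately have "t \<in> frontier (U d q)"
      using interior_subset[of "U d q"] by (auto simp: frontier_def)
    then show "t \<in> (\<Union>d\<in>D. \<Union>q\<in>\<rat>. frontier (U d q))"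
      using d(1) q(1) by blast
  qed
qed

text \<open>A local form of the monotonicity theorem. The signs of the right and left germs of
  \<open>g\<close> at \<open>t\<close> are definable conditions on \<open>t\<close>, so near
  \<open>a\<close> each of them is constant, and \<open>constant_germ_signs_imp_monotone\<close>
  applies.\<close>

lemma definable_function_monotone_at_right:
  fixes g :: "real \<Rightarrow> real"
  assumes "a < b" and g: "definable (\<lambda>z. a < fst z \<and> fst z < b \<and> snd z = g (fst z))"
  shows "\<exists>c>a. c \<le> b \<and> (\<exists>s\<in>{1, -1}. mono_on {a<..<c} (\<lambda>t. s * g t))"
proof -
  define Gr where "Gr t y \<longleftrightarrow> a < t \<and> t < b \<and> y = g t" for t y
  have Gr: "definable (\<lambda>x. Gr (f x) (h x))" if "polynomial_function f" "polynomial_function h"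
    for f h :: "'c::euclidean_space \<Rightarrow> real"
    using definable_compose[OF g polynomial_function_Pair[OF that]] by (simp add: Gr_def)
  have sgn: "definable (\<lambda>x. sgn (f x) = r)" if "polynomial_function f"
    for f :: "'c::euclidean_space \<Rightarrow> real" and r
    using definable_interval[OF that, of "{y. sgn y = r}"]
    by (simp add: is_interval_1 sgn_if split: if_splits)
  define R where "R r t \<longleftrightarrow> a < t \<and> t < b \<and> (\<forall>\<^sub>F u in at_right t. sgn (g u - g t) = r)" for r t
  define L where "L r t \<longleftrightarrow> a < t \<and> t < b \<and> (\<forall>\<^sub>F u in at_left t. sgn (g t - g u) = r)" for r t
  have "definable (R r)" for r
  proof -
    \<comment> \<open>A filter is not a first-order notion, so the germ is spelled out with a bound
      \<open>e\<close>. Values of \<open>g\<close> enter through points of its graph, because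
      \<open>g\<close> cannot be used as a term in a definable formula.\<close>
    have "R r = (\<lambda>t. a < t \<and> t < b \<and> (\<exists>e. t < e \<and>
        (\<forall>u y y'. t < u \<and> u < e \<and> Gr t y \<and> Gr u y' \<longrightarrow> sgn (y' - y) = r)))"
    proof
      fix t
      show "R r t \<longleftrightarrow> a < t \<and> t < b \<and> (\<exists>e. t < e \<and>
        (\<forall>u y y'. t < u \<and> u < e \<and> Gr t y \<and> Gr u y' \<longrightarrow> sgn (y' - y) = r))"
      proof (cases "a < t \<and> t < b")
        case True
        have "(\<exists>e>t. \<forall>u>t. u < e \<longrightarrow> sgn (g u - g t) = r) \<longleftrightarrow> (\<exists>e. t < e \<and>
          (\<forall>u y y'. t < u \<and> u < e \<and> Gr t y \<and> Gr u y' \<longrightarrow> sgn (y' - y) = r))" (is "?l \<longleftrightarrow> ?r")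
        proof
          assume ?l
          then obtain e where "e > t" "\<forall>u>t. u < e \<longrightarrow> sgn (g u - g t) = r" by blast
          then show ?r
            by (intro exI[of _ e]) (auto simp: Gr_def)
        next
          assume ?r
          then obtain e where "e > t"
            "\<And>u y y'. t < u \<Longrightarrow> u < e \<Longrightarrow> Gr t y \<Longrightarrow> Gr u y' \<Longrightarrow> sgn (y' - y) = r" by blast
          then show ?l
            using True by (intro exI[of _ "min e b"]) (auto simp: Gr_def)
        qed
        with True show ?thesis
          by (simp add: R_def eventually_at_right_field)
      qed (auto simp: R_def)
    qed
    then show ?thesis
      by (simp only:) (intro definable_logic Gr sgn polynomial_function_intros)
  qed
  moreover have "definable (L r)" for r
  proof -
    have "L r = (\<lambda>t. a < t \<and> t < b \<and> (\<exists>e. e < t \<and>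
        (\<forall>u y y'. e < u \<and> u < t \<and> Gr t y \<and> Gr u y' \<longrightarrow> sgn (y - y') = r)))"
    proof
      fix t
      show "L r t \<longleftrightarrow> a < t \<and> t < b \<and> (\<exists>e. e < t \<and>
        (\<forall>u y y'. e < u \<and> u < t \<and> Gr t y \<and> Gr u y' \<longrightarrow> sgn (y - y') = r))"
      proof (cases "a < t \<and> t < b")
        case True
        have "(\<exists>e<t. \<forall>u>e. u < t \<longrightarrow> sgn (g t - g u) = r) \<longleftrightarrow> (\<exists>e. e < t \<and>
          (\<forall>u y y'. e < u \<and> u < t \<and> Gr t y \<and> Gr u y' \<longrightarrow> sgn (y - y') = r))" (is "?l \<longleftrightarrow> ?r")
        proof
          assume ?l
          then obtain e where "e < t" "\<forall>u>e. u < t \<longrightarrow> sgn (g t - g u) = r" by blast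
          then show ?r
            by (intro exI[of _ e]) (auto simp: Gr_def)
        next
          assume ?r
          then obtain e where "e < t"
            "\<And>u y y'. e < u \<Longrightarrow> u < t \<Longrightarrow> Gr t y \<Longrightarrow> Gr u y' \<Longrightarrow> sgn (y - y') = r" by blast
          then show ?l
            using True by (intro exI[of _ "max e a"]) (auto simp: Gr_def)
        qed
        with True show ?thesis
          by (simp add: L_def eventually_at_left_field)
      qed (auto simp: L_def)
    qed
    then show ?thesis
      by (simp only:) (intro definable_logic Gr sgn polynomial_function_intros)
  qed
  moreover have "\<exists>r\<in>{-1, 0, 1}. R r t" "\<exists>r\<in>{-1, 0, 1}. L r t" if t: "a < t" "t < b" for t
  proof -
    \<comment> \<open>With \<open>t\<close> fixed, \<open>g t\<close> is a constant parameter and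
      the sign condition depends on \<open>u\<close> alone.\<close>
    have d: "definable (\<lambda>u. \<exists>y. Gr u y \<and> sgn (y - g t) = r)" "definable (\<lambda>u. \<exists>y. Gr u y \<and> sgn (g t - y) = r)" for r
      by (intro definable_logic Gr sgn polynomial_function_intros)+
    have nr: "\<forall>\<^sub>F u in at_right t. a < u \<and> u < b"
      using t by (auto simp: eventually_at_right_field)
    have nl: "\<forall>\<^sub>F u in at_left t. a < u \<and> u < b"
      using t by (auto simp: eventually_at_left_field)
    show "\<exists>r\<in>{-1, 0, 1}. R r t"
    proof (rule ccontr)
      assume *: "\<not> (\<exists>r\<in>{-1, 0, 1}. R r t)"
      have "\<forall>\<^sub>F u in at_right t. sgn (g u - g t) \<noteq> r" if "r \<in> {-1, 0, 1}" for r
      proof -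
        have "(\<forall>\<^sub>F u in at_right t. sgn (g u - g t) = r) \<or> (\<forall>\<^sub>F u in at_right t. sgn (g u - g t) \<noteq> r)"
          using definable_at_right[OF d(1)[of r], of t]
        proof
          assume "\<forall>\<^sub>F u in at_right t. \<exists>y. Gr u y \<and> sgn (y - g t) = r"
          then have "\<forall>\<^sub>F u in at_right t. sgn (g u - g t) = r"
            by eventually_elim (auto simp: Gr_def)
          then show ?thesis ..
        next
          assume "\<forall>\<^sub>F u in at_right t. \<not> (\<exists>y. Gr u y \<and> sgn (y - g t) = r)"
          with nr have "\<forall>\<^sub>F u in at_right t. sgn (g u - g t) \<noteq> r"
            by eventually_elim (auto simp: Gr_def)
          then show ?thesis ..
        qed
        then show ?thesis
          using * that t by (auto simp: R_def)
      qed
      then have "\<forall>\<^sub>F u in at_right t. \<forall>r\<in>{-1, 0, 1}. sgn (g u - g t) \<noteq> r"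
        by (simp add: eventually_conj_iff)
      then have "\<forall>\<^sub>F u in at_right t. False"
        by eventually_elim (auto simp: sgn_if split: if_splits)
      then show False by simp
    qed
    show "\<exists>r\<in>{-1, 0, 1}. L r t"
    proof (rule ccontr)
      assume *: "\<not> (\<exists>r\<in>{-1, 0, 1}. L r t)"
      have "\<forall>\<^sub>F u in at_left t. sgn (g t - g u) \<noteq> r" if "r \<in> {-1, 0, 1}" for r
      proof -
        have "(\<forall>\<^sub>F u in at_left t. sgn (g t - g u) = r) \<or> (\<forall>\<^sub>F u in at_left t. sgn (g t - g u) \<noteq> r)"
          using definable_at_left[OF d(2)[of r], of t]
        proof
          assume "\<forall>\<^sub>F u in at_left t. \<exists>y. Gr u y \<and> sgn (g t - y) = r"
          then have "\<forall>\<^sub>F u in at_left t. sgn (g t - g u) = r"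
            by eventually_elim (auto simp: Gr_def)
          then show ?thesis ..
        next
          assume "\<forall>\<^sub>F u in at_left t. \<not> (\<exists>y. Gr u y \<and> sgn (g t - y) = r)"
          with nl have "\<forall>\<^sub>F u in at_left t. sgn (g t - g u) \<noteq> r"
            by eventually_elim (auto simp: Gr_def)
          then show ?thesis ..
        qed
        then show ?thesis
          using * that t by (auto simp: L_def)
      qed
      then have "\<forall>\<^sub>F u in at_left t. \<forall>r\<in>{-1, 0, 1}. sgn (g t - g u) \<noteq> r"
        by (simp add: eventually_conj_iff)
      then have "\<forall>\<^sub>F u in at_left t. False"
        by eventually_elim (auto simp: sgn_if split: if_splits)
      then show False by simp
    qed
  qed
  \<comment> \<open>A pigeonhole principle for germs: each of the three predicates eventually holds
    or eventually fails to the right of \<open>a\<close>, and they cannot all fail.\<close>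
  ultimately have RL: "\<exists>r. \<forall>\<^sub>F t in at_right a. P r t"
    if P: "\<And>r. definable (P r)" "\<And>t. a < t \<Longrightarrow> t < b \<Longrightarrow> \<exists>r\<in>{-1, 0, 1::real}. P r t"
    for P :: "real \<Rightarrow> real \<Rightarrow> bool"
  proof (rule_tac ccontr)
    assume "\<nexists>r. \<forall>\<^sub>F t in at_right a. P r t"
    then have "\<forall>\<^sub>F t in at_right a. \<not> P r t" for r
      using definable_at_right[OF P(1)] by blast
    then have "\<forall>\<^sub>F t in at_right a. \<forall>r\<in>{-1, 0, 1}. \<not> P r t"
      by (simp add: eventually_conj_iff)
    moreover have "\<forall>\<^sub>F t in at_right a. a < t \<and> t < b"
      using assms(1) by (auto simp: eventually_at_right_field)
    ultimately have "\<forall>\<^sub>F t in at_right a. False"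
      by eventually_elim (use P(2) in blast)
    then show False by simp
  qed
  obtain r where "\<forall>\<^sub>F t in at_right a. R r t"
    using RL[of R] \<open>\<And>r. definable (R r)\<close> \<open>\<And>t. a < t \<Longrightarrow> t < b \<Longrightarrow> \<exists>r\<in>{-1, 0, 1}. R r t\<close> by blast
  moreover obtain l where "\<forall>\<^sub>F t in at_right a. L l t"
    using RL[of L] \<open>\<And>r. definable (L r)\<close> \<open>\<And>t. a < t \<Longrightarrow> t < b \<Longrightarrow> \<exists>r\<in>{-1, 0, 1}. L r t\<close> by blast
  ultimately have "\<forall>\<^sub>F t in at_right a. R r t \<and> L l t"
    by (rule eventually_conj)
  then obtain c where c: "a < c" "\<And>t. a < t \<Longrightarrow> t < c \<Longrightarrow> R r t \<and> L l t"
    unfolding eventually_at_right_field by blast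
  have "\<exists>s\<in>{1, -1}. mono_on {a<..<min b c} (\<lambda>t. s * g t)"
    using assms(1) c by (intro constant_germ_signs_imp_monotone[where r = r and l = l]) (auto simp: R_def L_def)
  then show ?thesis
    using assms(1) c(1) by (intro exI[of _ "min b c"]) auto
qed

end

section \<open>Lipschitz functions of one real variable are differentiable almost everywhere\<close>

lemma bounded_Ioo_real: "bounded {a<..<b::real}"
  by (rule bounded_subset[OF bounded_closed_interval[of a b]]) auto

text \<open>Replacing the closed balls of the Vitali theorem by open ones loses only countably many
  spheres, a null set. The open union can then host a second, nested cover.\<close>

lemma vitali_interval_cover:
  fixes E U :: "real set" and Q :: "real \<times> real \<Rightarrow> bool"
  assumes "open U" "E \<subseteq> U"
    and fine: "\<And>t \<delta>. t \<in> E \<Longrightarrow> \<delta> > 0 \<Longrightarrow> \<exists>c r. 0 < r \<and> r < \<delta> \<and> t \<in> cball c r \<and> Q (c, r)"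
  obtains D where "countable D" "\<And>i. i \<in> D \<Longrightarrow> 0 < snd i \<and> Q i \<and> cball (fst i) (snd i) \<subseteq> U"
    "disjoint_family_on (\<lambda>i. cball (fst i) (snd i)) D"
    "negligible (E - (\<Union>i\<in>D. ball (fst i) (snd i)))"
proof -
  define K where "K = {i. 0 < snd i \<and> Q i \<and> cball (fst i) (snd i) \<subseteq> U}"
  have cover: "\<exists>i. i \<in> K \<and> t \<in> cball (fst i) (snd i) \<and> snd i < \<delta>" if t: "t \<in> E" and "\<delta> > 0" for t \<delta>
  proof -
    obtain e where e: "e > 0" "ball t e \<subseteq> U"
      using assms(1,2) t by (meson openE subsetD)
    have "min \<delta> (e / 2) > 0"
      using e(1) \<open>\<delta> > 0\<close> by simp
    from fine[OF t this] obtain c r where cr: "0 < r" "r < \<delta>" "r < e / 2" "t \<in> cball c r" "Q (c, r)"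
      by auto
    have "cball c r \<subseteq> ball t e"
    proof
      fix u assume "u \<in> cball c r"
      then have "dist t u \<le> r + r"
        using cr(4) dist_triangle[of t u c] by (simp add: dist_commute)
      with cr(3) show "u \<in> ball t e" by simp
    qed
    with e(2) cr show ?thesis
      by (intro exI[of _ "(c, r)"]) (auto simp: K_def)
  qed
  have pos: "0 < snd i" if "i \<in> K" for i
    using that by (simp add: K_def)
  obtain D where D: "countable D" "D \<subseteq> K"
    "pairwise (\<lambda>i j. disjnt (cball (fst i) (snd i)) (cball (fst j) (snd j))) D"
    "negligible (E - (\<Union>i\<in>D. cball (fst i) (snd i)))"
    by (rule Vitali_covering_theorem_cballs[OF pos cover])
  have "negligible (\<Union>i\<in>D. sphere (fst i) (snd i))"
    using D(1) by (intro negligible_countable_Union) (auto intro: negligible_sphere)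
  with D(4) have "negligible ((E - (\<Union>i\<in>D. cball (fst i) (snd i))) \<union> (\<Union>i\<in>D. sphere (fst i) (snd i)))"
    by (rule negligible_Un)
  then have "negligible (E - (\<Union>i\<in>D. ball (fst i) (snd i)))"
    by (rule negligible_subset) (force simp: less_le)
  moreover have "disjoint_family_on (\<lambda>i. cball (fst i) (snd i)) D"
    using D(3) by (auto simp: disjoint_family_on_def pairwise_def disjnt_def)
  moreover have "0 < snd i \<and> Q i \<and> cball (fst i) (snd i) \<subseteq> U" if "i \<in> D" for i
    using D(2) that by (auto simp: K_def)
  ultimately show ?thesis
    using that[OF D(1)] by blast
qed

text \<open>
  With \<open>\<nu>\<close> the Stieltjes measure of \<open>g\<close> and \<open>m\<close> the outer measure of \<open>E\<close>, two nested Vitali covers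
  give \<open>q * m \<le> \<nu> W \<le> \<nu> V \<le> p * m\<close> up to an arbitrarily small error.
\<close>

lemma negligible_distinct_slopes:
  fixes g :: "real \<Rightarrow> real"
  assumes mono: "\<And>x y. x \<le> y \<Longrightarrow> g x \<le> g y" and cont: "continuous_on UNIV g"
    and "0 \<le> p" "p < q"
    and E: "E \<subseteq> {A<..<B}"
    and lo: "\<And>t \<delta>. t \<in> E \<Longrightarrow> \<delta> > 0 \<Longrightarrow>
      \<exists>c r. 0 < r \<and> r < \<delta> \<and> t \<in> cball c r \<and> g (c + r) - g (c - r) \<le> p * (2 * r)"
    and hi: "\<And>t \<delta>. t \<in> E \<Longrightarrow> \<delta> > 0 \<Longrightarrow>
      \<exists>c r. 0 < r \<and> r < \<delta> \<and> t \<in> cball c r \<and> q * (2 * r) \<le> g (c + r) - g (c - r)"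
  shows "negligible E"
proof -
  define \<nu> where "\<nu> = interval_measure g"
  have \<nu>: "emeasure \<nu> (cball c r) = ennreal (g (c + r) - g (c - r))" if "0 < r" for c r
    unfolding \<nu>_def cball_eq_atLeastAtMost using that
    by (intro emeasure_interval_measure_Icc mono cont) auto
  have sets_\<nu> [simp]: "sets \<nu> = sets borel"
    by (simp add: \<nu>_def)
  have lb: "emeasure lborel (cball c r) = ennreal (2 * r)" if "0 < r" for c r :: real
    using that by (simp add: cball_eq_atLeastAtMost)
  \<comment> \<open>Staying inside \<open>{A<..<B}\<close> keeps \<open>m\<close> finite, so that
    the final comparison of multiples of \<open>m\<close> can force it to be 0.\<close>
  define Us where "Us = {U. open U \<and> E \<subseteq> U \<and> U \<subseteq> {A<..<B}}"
  define m where "m = (INF U\<in>Us. emeasure lborel U)"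
  have "ennreal q * m \<le> ennreal p * emeasure lborel U" if U: "U \<in> Us" for U
  proof -
    have U': "open U" "E \<subseteq> U" "U \<subseteq> {A<..<B}"
      using U by (auto simp: Us_def)
    obtain D where D: "countable D"
      "\<And>i. i \<in> D \<Longrightarrow> 0 < snd i \<and> g (fst i + snd i) - g (fst i - snd i) \<le> p * (2 * snd i) \<and> cball (fst i) (snd i) \<subseteq> U"
      "disjoint_family_on (\<lambda>i. cball (fst i) (snd i)) D"
      "negligible (E - (\<Union>i\<in>D. ball (fst i) (snd i)))"
      by (rule vitali_interval_cover[OF U'(1,2), of "\<lambda>i. g (fst i + snd i) - g (fst i - snd i) \<le> p * (2 * snd i)"])
        (use lo in \<open>simp_all only: fst_conv snd_conv\<close>)
    \<comment> \<open>The open \<open>V\<close> receives the second cover; the closed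
      \<open>V'\<close> is the disjoint union over which both measures are summed.\<close>
    define V where "V = (\<Union>i\<in>D. ball (fst i) (snd i))"
    define V' where "V' = (\<Union>i\<in>D. cball (fst i) (snd i))"
    have V: "open V" "V \<subseteq> V'" "V' \<subseteq> U"
      using D(2) by (auto simp: V_def V'_def)
    have V'_borel: "V' \<in> sets borel"
      unfolding V'_def using D(1) by (intro sets.countable_UN') auto
    obtain F where F: "countable F"
      "\<And>i. i \<in> F \<Longrightarrow> 0 < snd i \<and> q * (2 * snd i) \<le> g (fst i + snd i) - g (fst i - snd i) \<and> cball (fst i) (snd i) \<subseteq> V"
      "disjoint_family_on (\<lambda>i. cball (fst i) (snd i)) F"
      "negligible (E \<inter> V - (\<Union>i\<in>F. ball (fst i) (snd i)))"
      by (rule vitali_interval_cover[OF V(1) Int_lower2, of E "\<lambda>i. q * (2 * snd i) \<le> g (fst i + snd i) - g (fst i - snd i)"])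
        (use hi in \<open>simp_all only: fst_conv snd_conv Int_iff\<close>)
    define W where "W = (\<Union>i\<in>F. cball (fst i) (snd i))"
    have W: "W \<subseteq> V"
      using F(2) by (auto simp: W_def)
    have W_borel: "W \<in> sets borel"
      unfolding W_def using F(1) by (intro sets.countable_UN') auto
    have "negligible ((E - V) \<union> (E \<inter> V - (\<Union>i\<in>F. ball (fst i) (snd i))))"
      using D(4) F(4) unfolding V_def by (rule negligible_Un)
    then have neg: "negligible (E - W)"
      by (rule negligible_subset) (auto simp: W_def)
    \<comment> \<open>\<open>E\<close> need not be measurable, and \<open>W\<close> covers it only
      up to a null set. Adding that null set to \<open>W\<close> and enlarging to an open set gives
      a competitor in the infimum at cost \<open>e\<close>.\<close>
    have m_le: "m \<le> emeasure lborel W"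
    proof (rule ennreal_le_epsilon)
      fix e :: real assume "e > 0"
      have W_leb: "W \<in> sets lebesgue"
        using W_borel by simp
      have N: "E - W \<in> null_sets lebesgue"
        using neg by (simp add: negligible_iff_null_sets)
      have S: "W \<union> (E - W) \<in> sets lebesgue"
        using W_leb null_setsD2[OF N] by (rule sets.Un)
      obtain O' where O': "open O'" "W \<union> (E - W) \<subseteq> O'" "O' - (W \<union> (E - W)) \<in> lmeasurable"
        "emeasure lebesgue (O' - (W \<union> (E - W))) < ennreal e"
        using sets_lebesgue_outer_open[OF S \<open>e > 0\<close>] .
      have "emeasure lebesgue O' \<le> emeasure lebesgue (W \<union> (E - W)) + emeasure lebesgue (O' - (W \<union> (E - W)))"
        using emeasure_subadditive[OF S fmeasurableD[OF O'(3)]] Un_absorb1[OF O'(2)] by (simp only: Un_Diff_cancel)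
      also have "emeasure lebesgue (W \<union> (E - W)) = emeasure lebesgue W"
        using W_leb N by (rule emeasure_Un_null_set)
      finally have "emeasure lebesgue O' \<le> emeasure lebesgue W + ennreal e"
        using O'(4) by (meson add_left_mono less_imp_le order_trans)
      then have "emeasure lborel O' \<le> emeasure lborel W + ennreal e"
        using O'(1) W_borel by simp
      moreover have "O' \<inter> {A<..<B} \<in> Us"
        using O'(1,2) E by (auto simp: Us_def)
      then have "m \<le> emeasure lborel (O' \<inter> {A<..<B})"
        unfolding m_def by (rule INF_lower)
      moreover have "emeasure lborel (O' \<inter> {A<..<B}) \<le> emeasure lborel O'"
        using O'(1) by (intro emeasure_mono) auto
      ultimately show "m \<le> emeasure lborel W + ennreal e"
        by (meson order_trans)
    qed
    have "ennreal q * emeasure lborel W = ennreal q * (\<integral>\<^sup>+i. emeasure lborel (cball (fst i) (snd i)) \<partial>count_space F)"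
      unfolding W_def using F by (subst emeasure_UN_countable) auto
    also have "\<dots> = (\<integral>\<^sup>+i. ennreal q * emeasure lborel (cball (fst i) (snd i)) \<partial>count_space F)"
      by (subst nn_integral_cmult) auto
    also have "\<dots> \<le> (\<integral>\<^sup>+i. emeasure \<nu> (cball (fst i) (snd i)) \<partial>count_space F)"
    proof (intro nn_integral_mono)
      fix i assume "i \<in> space (count_space F)"
      then have i: "0 < snd i" "q * (2 * snd i) \<le> g (fst i + snd i) - g (fst i - snd i)"
        using F(2) by auto
      then show "ennreal q * emeasure lborel (cball (fst i) (snd i)) \<le> emeasure \<nu> (cball (fst i) (snd i))"
        using assms(3,4) by (simp only: lb[OF i(1)] \<nu>[OF i(1)]) (simp add: ennreal_mult[symmetric] ennreal_leI)
    qed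
    also have "\<dots> = emeasure \<nu> W"
      unfolding W_def using F by (subst emeasure_UN_countable) auto
    also have "\<dots> \<le> emeasure \<nu> V'"
      using W V V'_borel by (intro emeasure_mono) auto
    also have "\<dots> = (\<integral>\<^sup>+i. emeasure \<nu> (cball (fst i) (snd i)) \<partial>count_space D)"
      unfolding V'_def using D by (subst emeasure_UN_countable) auto
    also have "\<dots> \<le> (\<integral>\<^sup>+i. ennreal p * emeasure lborel (cball (fst i) (snd i)) \<partial>count_space D)"
    proof (intro nn_integral_mono)
      fix i assume "i \<in> space (count_space D)"
      then have i: "0 < snd i" "g (fst i + snd i) - g (fst i - snd i) \<le> p * (2 * snd i)"
        using D(2) by auto
      then show "emeasure \<nu> (cball (fst i) (snd i)) \<le> ennreal p * emeasure lborel (cball (fst i) (snd i))"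
        using assms(3,4) by (simp only: lb[OF i(1)] \<nu>[OF i(1)]) (simp add: ennreal_mult[symmetric] ennreal_leI)
    qed
    also have "\<dots> = ennreal p * (\<integral>\<^sup>+i. emeasure lborel (cball (fst i) (snd i)) \<partial>count_space D)"
      by (subst nn_integral_cmult) auto
    also have "\<dots> = ennreal p * emeasure lborel V'"
      unfolding V'_def using D by (subst emeasure_UN_countable) auto
    also have "\<dots> \<le> ennreal p * emeasure lborel U"
      using V U' by (intro mult_left_mono emeasure_mono) auto
    finally have "ennreal q * emeasure lborel W \<le> ennreal p * emeasure lborel U" .
    moreover have "ennreal q * m \<le> ennreal q * emeasure lborel W"
      by (intro mult_left_mono m_le) auto
    ultimately show ?thesis by (rule order_trans[rotated])
  qed
  have Us: "{A<..<B} \<in> Us"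
    using E by (auto simp: Us_def)
  then have "m \<le> emeasure lborel {A<..<B}"
    unfolding m_def by (rule INF_lower)
  also have "emeasure lborel {A<..<B} < \<infinity>"
    by (cases "A \<le> B") auto
  finally have "m < \<infinity>" .
  then obtain \<mu> where \<mu>: "m = ennreal \<mu>" "0 \<le> \<mu>"
    by (cases m) auto
  have "\<mu> = 0"
  proof (rule ccontr)
    assume "\<mu> \<noteq> 0"
    then have "p * \<mu> < q * \<mu>"
      using \<mu>(2) assms(4) by simp
    \<comment> \<open>The denominator uses \<open>p + 1\<close> because \<open>p\<close> may be 0.
      The product \<open>p * e\<close> is then at most half of the gap
      \<open>(q - p) * \<mu>\<close>.\<close>
    define e where "e = (q - p) * \<mu> / (2 * (p + 1))"
    have e: "e > 0" "p * (\<mu> + e) < q * \<mu>"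
    proof -
      have "\<mu> > 0" using \<mu>(2) \<open>\<mu> \<noteq> 0\<close> by simp
      then show "e > 0" using assms(3,4) by (simp add: e_def)
      have "p * e \<le> (p + 1) * e" using \<open>e > 0\<close> by simp
      also have "\<dots> = (q - p) * \<mu> / 2" using assms(3) by (simp add: e_def field_simps)
      also have "\<dots> < (q - p) * \<mu>" using assms(4) \<open>\<mu> > 0\<close> by simp
      finally show "p * (\<mu> + e) < q * \<mu>" by (simp add: algebra_simps)
    qed
    have "m < ennreal (\<mu> + e)"
      using \<mu> e(1) by (simp add: ennreal_less_iff)
    then obtain U where U: "U \<in> Us" "emeasure lborel U < ennreal (\<mu> + e)"
      unfolding m_def INF_less_iff by blast
    have "ennreal (q * \<mu>) = ennreal q * m"
      using \<mu> assms(3,4) by (simp add: ennreal_mult)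
    also have "\<dots> \<le> ennreal p * emeasure lborel U"
      using \<open>\<And>U. U \<in> Us \<Longrightarrow> ennreal q * m \<le> ennreal p * emeasure lborel U\<close>[OF U(1)] .
    also have "\<dots> \<le> ennreal p * ennreal (\<mu> + e)"
      using U(2) by (intro mult_left_mono) auto
    also have "\<dots> = ennreal (p * (\<mu> + e))"
      using \<mu> e(1) assms(3) by (simp add: ennreal_mult)
    finally have "q * \<mu> \<le> p * (\<mu> + e)"
      using \<mu> e(1) assms(3) by (simp add: ennreal_le_iff)
    with e(2) show False by simp
  qed
  show ?thesis
    unfolding negligible_outer_le
  proof (intro allI impI)
    fix e :: real assume "e > 0"
    then have "m < ennreal e"
      using \<mu> \<open>\<mu> = 0\<close> by (simp add: ennreal_less_zero_iff)
    then obtain U where U: "U \<in> Us" "emeasure lborel U < ennreal e"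
      unfolding m_def INF_less_iff by blast
    have "open U" "E \<subseteq> U" "U \<subseteq> {A<..<B}"
      using U(1) by (auto simp: Us_def)
    moreover from this have "U \<in> lmeasurable"
      by (intro lmeasurable_open bounded_subset[OF bounded_Ioo_real, of U A B]) 
    moreover have "measure lebesgue U \<le> e"
    proof -
      have "ennreal (measure lebesgue U) = emeasure lebesgue U"
        using \<open>U \<in> lmeasurable\<close> by (simp add: emeasure_eq_measure2)
      also have "\<dots> = emeasure lborel U"
        using \<open>open U\<close> by simp
      finally show ?thesis
        using U(2) \<open>e > 0\<close> by (metis ennreal_le_iff less_imp_le)
    qed
    ultimately show "\<exists>T. E \<subseteq> T \<and> T \<in> lmeasurable \<and> measure lebesgue T \<le> e"
      by blast
  qed
qed

section \<open>Differentiability of monotone and of Lipschitz functions\<close>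

text \<open>If the bounded difference quotients at \<open>t\<close> do not converge, they oscillate
  across some pair of rationals \<open>p < q\<close>. For a fixed pair and a bounded range of
  \<open>t\<close> this is a set with two distinct slopes, and countably many such sets cover all
  cases.\<close>

lemma negligible_nondifferentiable_mono:
  fixes g :: "real \<Rightarrow> real"
  assumes mono: "\<And>x y. x \<le> y \<Longrightarrow> g x \<le> g y" and lip: "\<And>x y. \<bar>g x - g y\<bar> \<le> K * \<bar>x - y\<bar>"
  shows "negligible {t. \<not> (\<exists>D. (g has_real_derivative D) (at t))}"
proof -
  define Q where "Q t h = (g (t + h) - g t) / h" for t h
  have Q0: "0 \<le> Q t h" for t h
    using mono[of t "t + h"] mono[of "t + h" t] by (cases "h \<ge> 0") (auto simp: Q_def intro: divide_nonpos_nonpos)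
  have K: "K \<ge> 0"
    using lip[of 0 1] by simp
  have QK: "Q t h \<le> K" for t h
    using lip[of "t + h" t] K by (cases "h = 0") (auto simp: Q_def divide_le_eq abs_if split: if_splits)
  have "continuous_on UNIV g"
    using lip K by (intro lipschitz_on_continuous_on[of K] lipschitz_onI) (auto simp: dist_real_def)
  define E where "E p q n = {t \<in> {-n<..<n}. (\<exists>\<^sub>F h in at 0. Q t h \<le> p) \<and> (\<exists>\<^sub>F h in at 0. q \<le> Q t h)}" for p q n :: real
  have slope: "\<exists>c r. 0 < r \<and> r < \<delta> \<and> t \<in> cball c r \<and> P ((g (c + r) - g (c - r)) / (2 * r))"
    if "\<exists>\<^sub>F h in at 0. P (Q t h)" "\<delta> > 0" for P t \<delta>
  proof -
    have "\<forall>\<^sub>F h in at (0::real). h \<noteq> 0 \<and> \<bar>h\<bar> < \<delta>"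
      using \<open>\<delta> > 0\<close> by (auto simp: eventually_at intro!: exI[of _ \<delta>])
    from frequently_ex[OF frequently_eventually_conj[OF that(1) this]]
    obtain h where h: "h \<noteq> 0" "\<bar>h\<bar> < \<delta>" "P (Q t h)" by blast
    have Qh: "Q t h = (g (t + h / 2 + \<bar>h\<bar> / 2) - g (t + h / 2 - \<bar>h\<bar> / 2)) / (2 * (\<bar>h\<bar> / 2))"
    proof (cases "h > 0")
      case True
      then have "t + h / 2 + \<bar>h\<bar> / 2 = t + h" "t + h / 2 - \<bar>h\<bar> / 2 = t"
        by (simp_all add: field_simps)
      then show ?thesis
        using True by (simp add: Q_def add.commute)
    next
      case False
      then have "t + h / 2 + \<bar>h\<bar> / 2 = t" "t + h / 2 - \<bar>h\<bar> / 2 = t + h" "2 * (\<bar>h\<bar> / 2) = - h"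
        using h(1) by (simp_all add: field_simps)
      then show ?thesis
        unfolding Q_def by (simp only:) (simp add: divide_simps)
    qed
    have "P ((g (t + h / 2 + \<bar>h\<bar> / 2) - g (t + h / 2 - \<bar>h\<bar> / 2)) / (2 * (\<bar>h\<bar> / 2)))"
      using h(3) by (simp only: Qh)
    moreover have "0 < \<bar>h\<bar> / 2" "\<bar>h\<bar> / 2 < \<delta>" "t \<in> cball (t + h / 2) (\<bar>h\<bar> / 2)"
      using h(1,2) by (auto simp: dist_real_def)
    ultimately show ?thesis
      by blast
  qed
  have "negligible (E p q n)" if "0 \<le> p" "p < q" for p q n
  proof (rule negligible_distinct_slopes[OF mono \<open>continuous_on UNIV g\<close> that])
    show "E p q n \<subseteq> {-n<..<n}"
      by (auto simp: E_def)
    fix t \<delta> :: real assume t: "t \<in> E p q n" and "\<delta> > 0"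
    show "\<exists>c r. 0 < r \<and> r < \<delta> \<and> t \<in> cball c r \<and> g (c + r) - g (c - r) \<le> p * (2 * r)"
    proof -
      obtain c r where "0 < r" "r < \<delta>" "t \<in> cball c r" "(g (c + r) - g (c - r)) / (2 * r) \<le> p"
        using slope[of "\<lambda>s. s \<le> p" t \<delta>] t \<open>\<delta> > 0\<close> unfolding E_def by blast
      then show ?thesis
        by (intro exI[of _ c] exI[of _ r]) (simp add: pos_divide_le_eq)
    qed
    show "\<exists>c r. 0 < r \<and> r < \<delta> \<and> t \<in> cball c r \<and> q * (2 * r) \<le> g (c + r) - g (c - r)"
    proof -
      obtain c r where "0 < r" "r < \<delta>" "t \<in> cball c r" "q \<le> (g (c + r) - g (c - r)) / (2 * r)"
        using slope[of "\<lambda>s. q \<le> s" t \<delta>] t \<open>\<delta> > 0\<close> unfolding E_def by blast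
      then show ?thesis
        by (intro exI[of _ c] exI[of _ r]) (simp add: pos_le_divide_eq)
    qed
  qed
  note neg = this
  define I :: "(real \<times> real \<times> real) set" where
    "I = {i \<in> \<rat> \<times> \<rat> \<times> \<rat>. 0 \<le> fst i \<and> fst i < fst (snd i)}"
  have "countable (\<rat> \<times> \<rat> \<times> \<rat> :: (real \<times> real \<times> real) set)"
    by (intro countable_SIGMA countable_rat)
  then have "countable I"
    by (rule countable_subset[rotated]) (auto simp: I_def)
  have "negligible (\<Union>i\<in>I. E (fst i) (fst (snd i)) (snd (snd i)))"
  proof (rule negligible_countable_Union)
    show "countable ((\<lambda>i. E (fst i) (fst (snd i)) (snd (snd i))) ` I)"
      using \<open>countable I\<close> by (rule countable_image)
    fix X assume "X \<in> (\<lambda>i. E (fst i) (fst (snd i)) (snd (snd i))) ` I"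
    then show "negligible X"
      using neg by (auto simp: I_def)
  qed
  moreover have "{t. \<not> (\<exists>D. (g has_real_derivative D) (at t))} \<subseteq> (\<Union>i\<in>I. E (fst i) (fst (snd i)) (snd (snd i)))"
  proof (intro subsetI, rule ccontr)
    fix t assume nd: "t \<in> {t. \<not> (\<exists>D. (g has_real_derivative D) (at t))}"
      and nE: "t \<notin> (\<Union>i\<in>I. E (fst i) (fst (snd i)) (snd (snd i)))"
    have notE: "t \<notin> E p q n" if "p \<in> \<rat>" "q \<in> \<rat>" "n \<in> \<rat>" "0 \<le> p" "p < q" for p q n
    proof -
      have "(p, q, n) \<in> I"
        using that by (simp add: I_def)
      with nE show ?thesis
        by force
    qed
    obtain n where "n \<in> \<rat>" "\<bar>t\<bar> < n"
      using Rats_dense_in_real[of "\<bar>t\<bar>" "\<bar>t\<bar> + 1"] by auto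
    then have n: "n \<in> \<rat>" "t \<in> {-n<..<n}"
      by auto
    \<comment> \<open>The supremum \<open>l\<close> of the eventual lower bounds is the lower limit
      of the quotients; absence of oscillation makes it their limit.\<close>
    define A where "A = {p. \<forall>\<^sub>F h in at 0. p \<le> Q t h}"
    define l where "l = Sup A"
    have A0: "0 \<in> A"
      using Q0 by (simp add: A_def)
    have "p \<le> K" if "p \<in> A" for p
    proof -
      have "\<forall>\<^sub>F h in at (0::real). p \<le> Q t h"
        using that by (simp add: A_def)
      then obtain h where "p \<le> Q t h"
        using eventually_happens'[of "at (0::real)"] by auto
      with QK[of t h] show ?thesis by simp
    qed
    then have bdd: "bdd_above A"
      by (rule bdd_aboveI)
    have l0: "l \<ge> 0"
      unfolding l_def using A0 bdd by (rule cSup_upper)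
    have "(Q t \<longlongrightarrow> l) (at 0)"
    proof (rule order_tendstoI)
      fix a assume "a < l"
      then obtain p where p: "p \<in> A" "a < p"
        using less_cSupD[of A a] A0 unfolding l_def by blast
      then have "\<forall>\<^sub>F h in at 0. p \<le> Q t h"
        by (simp add: A_def)
      then show "\<forall>\<^sub>F h in at 0. a < Q t h"
        by eventually_elim (use p(2) in simp)
    next
      fix a assume "l < a"
      then obtain p where p: "p \<in> \<rat>" "l < p" "p < a"
        using Rats_dense_in_real by blast
      then obtain q where q: "q \<in> \<rat>" "p < q" "q < a"
        using Rats_dense_in_real by blast
      have "p \<notin> A"
        using cSup_upper[OF _ bdd, of p] p(2) by (auto simp: l_def)
      then have "\<exists>\<^sub>F h in at 0. Q t h < p"
        by (simp add: A_def frequently_def not_less)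
      then have "\<exists>\<^sub>F h in at 0. Q t h \<le> p"
        by (rule frequently_elim1) simp
      then have "\<not> (\<exists>\<^sub>F h in at 0. q \<le> Q t h)"
        using notE[OF p(1) q(1) n(1)] l0 p(2) q(2) n(2) by (auto simp: E_def)
      then have "\<forall>\<^sub>F h in at 0. Q t h < q"
        by (simp add: frequently_def not_le)
      then show "\<forall>\<^sub>F h in at 0. Q t h < a"
        by eventually_elim (use q(3) in simp)
    qed
    then have "(g has_real_derivative l) (at t)"
      unfolding DERIV_def Q_def .
    with nd show False by blast
  qed
  ultimately show ?thesis
    by (rule negligible_subset)
qed

text \<open>Adding \<open>K * t\<close> to a coordinate makes it monotone and at most doubles its
  Lipschitz constant.\<close>

lemma negligible_nondifferentiable_lipschitz:
  fixes f :: "real \<Rightarrow> 'a::euclidean_space"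
  assumes lip: "\<And>x y. norm (f x - f y) \<le> K * \<bar>x - y\<bar>"
  shows "negligible {t. \<not> (\<exists>v. (f has_vector_derivative v) (at t))}"
proof -
  have K: "K \<ge> 0"
    using order_trans[OF norm_ge_zero lip[of 0 1]] by simp
  define g where "g b t = f t \<bullet> b + K * t" for b t
  have comp: "\<bar>f x \<bullet> b - f y \<bullet> b\<bar> \<le> K * \<bar>x - y\<bar>" if "b \<in> Basis" for b x y
    using Basis_le_norm[OF that, of "f x - f y"] lip[of x y] by (simp add: inner_diff_left)
  have "negligible {t. \<not> (\<exists>D. (g b has_real_derivative D) (at t))}" if b: "b \<in> Basis" for b
  proof (rule negligible_nondifferentiable_mono)
    show "g b x \<le> g b y" if "x \<le> y" for x y
      using comp[OF b, of x y] that by (simp add: g_def algebra_simps abs_le_iff)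
    show "\<bar>g b x - g b y\<bar> \<le> 2 * K * \<bar>x - y\<bar>" for x y
    proof -
      have "g b x - g b y = (f x \<bullet> b - f y \<bullet> b) + K * (x - y)"
        by (simp add: g_def algebra_simps)
      also have "\<bar>\<dots>\<bar> \<le> \<bar>f x \<bullet> b - f y \<bullet> b\<bar> + \<bar>K * (x - y)\<bar>"
        by (rule abs_triangle_ineq)
      also have "\<dots> \<le> 2 * K * \<bar>x - y\<bar>"
        using comp[OF b, of x y] K by (simp add: abs_mult)
      finally show ?thesis .
    qed
  qed
  then have "negligible (\<Union>b\<in>Basis. {t. \<not> (\<exists>D. (g b has_real_derivative D) (at t))})"
    by (intro negligible_Union) auto
  moreover have "{t. \<not> (\<exists>v. (f has_vector_derivative v) (at t))} \<subseteq>
    (\<Union>b\<in>Basis. {t. \<not> (\<exists>D. (g b has_real_derivative D) (at t))})"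
  proof (intro subsetI, rule ccontr)
    fix t assume t: "t \<in> {t. \<not> (\<exists>v. (f has_vector_derivative v) (at t))}"
      and "t \<notin> (\<Union>b\<in>Basis. {t. \<not> (\<exists>D. (g b has_real_derivative D) (at t))})"
    then have "\<forall>b\<in>Basis. \<exists>D. (g b has_real_derivative D) (at t)"
      by simp
    from bchoice[OF this] obtain D where D: "\<forall>b\<in>Basis. (g b has_real_derivative D b) (at t)" ..
    have "((\<lambda>t. \<Sum>b\<in>Basis. (f t \<bullet> b) *\<^sub>R b) has_vector_derivative (\<Sum>b\<in>Basis. (D b - K) *\<^sub>R b)) (at t)"
    proof (intro has_vector_derivative_sum)
      fix b :: 'a assume b: "b \<in> Basis"
      have "((\<lambda>t. g b t - K * t) has_real_derivative D b - K) (at t)"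
        using D b by (auto intro!: derivative_eq_intros)
      then have "((\<lambda>t. f t \<bullet> b) has_real_derivative D b - K) (at t)"
        by (simp add: g_def)
      then show "((\<lambda>t. (f t \<bullet> b) *\<^sub>R b) has_vector_derivative (D b - K) *\<^sub>R b) (at t)"
        by (auto intro!: derivative_eq_intros)
    qed
    then have "(f has_vector_derivative (\<Sum>b\<in>Basis. (D b - K) *\<^sub>R b)) (at t)"
      by (simp add: euclidean_representation)
    with t show False by blast
  qed
  ultimately show ?thesis
    by (rule negligible_subset)
qed

section \<open>Tangency of trajectories to definable moving sets\<close>

text \<open>Serves as definable choice: being a lexicographic minimum is a first-order condition,
  and it determines the point as soon as the finitely many functions \<open>c i\<close> separate
  points. Existence follows by minimizing \<open>c 0\<close> first and continuing on the compact set
  of its minimizers.\<close>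

lemma compact_lex_min_exists:
  fixes c :: "nat \<Rightarrow> 'a::topological_space \<Rightarrow> real"
  assumes "compact K" "K \<noteq> {}" "\<And>i. i < n \<Longrightarrow> continuous_on UNIV (c i)"
  shows "\<exists>q\<in>K. \<forall>q'\<in>K. \<forall>i\<in>{..<n}. (\<forall>j\<in>{..<i}. c j q' = c j q) \<longrightarrow> c i q \<le> c i q'"
  using assms
proof (induction n arbitrary: K c)
  case 0
  then show ?case by auto
next
  case (Suc n)
  have cont: "continuous_on UNIV (c 0)"
    using Suc.prems(3) by simp
  obtain p where p: "p \<in> K" "\<And>q. q \<in> K \<Longrightarrow> c 0 p \<le> c 0 q"
    using continuous_attains_inf[OF Suc.prems(1,2) continuous_on_subset[OF cont subset_UNIV]] by blast
  define K0 where "K0 = K \<inter> {q. c 0 q = c 0 p}"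
  have "closed {q. c 0 q = c 0 p}"
    by (intro closed_Collect_eq cont continuous_intros)
  then have "compact K0"
    unfolding K0_def using Suc.prems(1) by (intro compact_Int_closed)
  moreover have "K0 \<noteq> {}"
    using p(1) by (auto simp: K0_def)
  ultimately have "\<exists>q\<in>K0. \<forall>q'\<in>K0. \<forall>i\<in>{..<n}.
      (\<forall>j\<in>{..<i}. c (Suc j) q' = c (Suc j) q) \<longrightarrow> c (Suc i) q \<le> c (Suc i) q'"
    by (rule Suc.IH) (use Suc.prems(3) in auto)
  then obtain q where q: "q \<in> K0" "\<forall>q'\<in>K0. \<forall>i\<in>{..<n}.
      (\<forall>j\<in>{..<i}. c (Suc j) q' = c (Suc j) q) \<longrightarrow> c (Suc i) q \<le> c (Suc i) q'"
    by (rule bexE)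
  have q0: "q \<in> K" "c 0 q = c 0 p"
    using q(1) by (auto simp: K0_def)
  show ?case
  proof (intro bexI[of _ q] ballI impI)
    fix q' i assume q': "q' \<in> K" and i: "i \<in> {..<Suc n}" and eq: "\<forall>j\<in>{..<i}. c j q' = c j q"
    show "c i q \<le> c i q'"
    proof (cases i)
      case 0
      then show ?thesis using p(2)[OF q'] q0 by simp
    next
      case (Suc k)
      then have "q' \<in> K0"
        using q' eq q0 by (simp add: K0_def)
      moreover have "\<forall>j\<in>{..<k}. c (Suc j) q' = c (Suc j) q"
        using eq Suc by auto
      ultimately show ?thesis
        using q(2)[rule_format, of q' k] i Suc by simp
    qed
  qed (rule q0)
qed

lemma lex_min_unique:
  fixes c :: "nat \<Rightarrow> 'a \<Rightarrow> real"
  assumes p: "p \<in> K" "\<forall>q'\<in>K. \<forall>i\<in>{..<n}. (\<forall>j\<in>{..<i}. c j q' = c j p) \<longrightarrow> c i p \<le> c i q'"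
    and q: "q \<in> K" "\<forall>q'\<in>K. \<forall>i\<in>{..<n}. (\<forall>j\<in>{..<i}. c j q' = c j q) \<longrightarrow> c i q \<le> c i q'"
  shows "i < n \<Longrightarrow> c i p = c i q"
proof (induction i rule: less_induct)
  case (less i)
  then have "\<forall>j\<in>{..<i}. c j p = c j q"
    by auto
  then have "c i p \<le> c i q" "c i q \<le> c i p"
    using p(2)[rule_format, OF q(1), of i] q(2)[rule_format, OF p(1), of i] less.prems by auto
  then show ?case by simp
qed

text \<open>Each jump gains slope \<open>\<kappa>\<close>. The set of points reached from
  \<open>t1\<close> with that slope contains its supremum, because \<open>f\<close> is monotone, and
  one more jump goes beyond it. The set is bounded since a gain of slope \<open>\<kappa>\<close>
  soon exceeds what the bound by \<open>\<kappa> / 4 * (t - a)\<close> allows.\<close>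

lemma no_sublinear_function_with_linear_jumps:
  fixes f h :: "real \<Rightarrow> real"
  assumes "a < c" "\<kappa> > 0" and mono: "mono_on {a<..<c} f"
    and small: "\<And>t. a < t \<Longrightarrow> t < c \<Longrightarrow> \<bar>f t\<bar> \<le> \<kappa> / 4 * (t - a)"
    and h: "\<And>t. a < t \<Longrightarrow> t < c \<Longrightarrow> 0 < h t \<and> h t \<le> t - a"
    and jump: "\<And>t. a < t \<Longrightarrow> t + h t < c \<Longrightarrow> t < c \<Longrightarrow> \<kappa> * h t \<le> f (t + h t) - f t"
  shows False
proof -
  \<comment> \<open>Points reached from \<open>a + r\<close> stay at or below
    \<open>a + 2 * r\<close>, and a jump from there has length at most \<open>2 * r\<close>. It ends
    by \<open>a + 4 * r\<close>, hence before \<open>c\<close>.\<close>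
  define r where "r = (c - a) / 6"
  have r: "r > 0" "c = a + 6 * r"
    using assms(1) by (simp_all add: r_def field_simps)
  define t1 where "t1 = a + r"
  define A where "A = {s. t1 \<le> s \<and> s < c \<and> \<kappa> * (s - t1) \<le> f s - f t1}"
  have t1: "t1 \<in> A"
    using r by (simp add: A_def t1_def)
  have A_le: "s \<le> t1 + r" if "s \<in> A" for s
  proof -
    have s: "a < s" "s < c" "\<kappa> * (s - t1) \<le> f s - f t1"
      using that r by (auto simp: A_def t1_def)
    have "f s - f t1 \<le> \<kappa> / 4 * (s - a) + \<kappa> / 4 * (t1 - a)"
      using small[of s] small[of t1] s r by (auto simp: t1_def)
    with s(3) have "\<kappa> * (s - t1) \<le> \<kappa> * ((s - t1 + 2 * r) / 4)"
      by (simp add: t1_def field_simps)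
    then have "s - t1 \<le> (s - t1 + 2 * r) / 4"
      using assms(2) by simp
    then show ?thesis
      using r(1) by (simp add: field_simps)
  qed
  define u where "u = Sup A"
  have bdd: "bdd_above A"
    by (rule bdd_aboveI) (rule A_le)
  have u: "t1 \<le> u" "u \<le> t1 + r"
    unfolding u_def using t1 bdd A_le by (auto intro: cSup_upper cSup_least)
  have "\<kappa> * (u - t1) \<le> f u - f t1"
  proof (rule field_le_epsilon)
    fix e :: real assume "e > 0"
    then have "u - e / \<kappa> < u"
      using assms(2) by simp
    then obtain s where s: "s \<in> A" "u - e / \<kappa> < s"
      using less_cSupD[of A "u - e / \<kappa>"] t1 unfolding u_def by blast
    then have su: "s \<le> u"
      unfolding u_def using bdd by (intro cSup_upper)
    then have "f s \<le> f u"
      using s(1) u r by (intro mono_onD[OF mono]) (auto simp: A_def t1_def)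
    moreover have "\<kappa> * (u - s) \<le> e"
      using s(2) assms(2) by (simp add: field_simps)
    ultimately show "\<kappa> * (u - t1) \<le> f u - f t1 + e"
      using s(1) by (auto simp: A_def algebra_simps)
  qed
  moreover have hu: "0 < h u" "h u \<le> u - a"
    using h[of u] u r by (auto simp: t1_def)
  moreover have "\<kappa> * h u \<le> f (u + h u) - f u"
    using jump[of u] hu u r by (auto simp: t1_def)
  ultimately have "u + h u \<in> A"
    using u r by (auto simp: A_def t1_def algebra_simps)
  then have "u + h u \<le> u"
    unfolding u_def[symmetric] using cSup_upper[OF _ bdd] u_def by metis
  with hu show False by simp
qed

section \<open>Definable Lipschitz set-valued maps and escaping pairs\<close>

text \<open>The Lipschitz condition is stated through attained distances. Exchanging
  \<open>s\<close> and \<open>t\<close> gives the other half of the Hausdorff estimate.\<close>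

locale definable_lipschitz_map = o_minimal_structure S
  for S :: "nat \<Rightarrow> real list set set" +
  fixes T L :: real and C :: "real \<Rightarrow> 'a::euclidean_space set"
  assumes T_pos: "0 < T"
    and definable_graph: "definable (\<lambda>z. fst z \<in> {0..T} \<and> snd z \<in> C (fst z))"
    and compact_values: "\<And>t. t \<in> {0..T} \<Longrightarrow> compact (C t)"
    and nonempty_values: "\<And>t. t \<in> {0..T} \<Longrightarrow> C t \<noteq> {}"
    and L_nonneg: "0 \<le> L"
    and lipschitz_values: "\<And>s t y. s \<in> {0..T} \<Longrightarrow> t \<in> {0..T} \<Longrightarrow> y \<in> C s \<Longrightarrow>
      \<exists>z\<in>C t. dist y z \<le> L * \<bar>s - t\<bar>"
begin

definition Gr :: "real \<Rightarrow> 'a \<Rightarrow> bool" where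
  "Gr t y \<longleftrightarrow> t \<in> {0..T} \<and> y \<in> C t"

lemma definable_Gr:
  assumes "polynomial_function f" "polynomial_function g"
  shows "definable (\<lambda>x. Gr (f x) (g x))"
  using definable_compose[OF definable_graph polynomial_function_Pair[OF assms]] by (simp add: Gr_def)

lemma closed_Gr:
  assumes "\<And>k. Gr (s k) (y k)" "s \<longlonglongrightarrow> s0" "y \<longlonglongrightarrow> y0"
  shows "Gr s0 y0"
proof -
  have s: "s k \<in> {0..T}" "y k \<in> C (s k)" for k
    using assms(1)[of k] by (auto simp: Gr_def)
  have s0: "s0 \<in> {0..T}"
    using closed_sequentially[of "{0..T}" s s0] s(1) assms(2) by blast
  have "\<exists>z\<in>C s0. dist (y k) z \<le> L * \<bar>s k - s0\<bar>" for k
    using lipschitz_values[OF s(1) s0 s(2)] .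
  then obtain z where z: "\<And>k. z k \<in> C s0" "\<And>k. dist (y k) (z k) \<le> L * \<bar>s k - s0\<bar>"
    by metis
  have "(\<lambda>k. L * \<bar>s k - s0\<bar>) \<longlonglongrightarrow> L * \<bar>s0 - s0\<bar>"
    by (intro tendsto_intros assms(2))
  then have lim: "(\<lambda>k. L * \<bar>s k - s0\<bar>) \<longlonglongrightarrow> 0"
    by simp
  have "(\<lambda>k. y k - z k) \<longlonglongrightarrow> 0"
    by (rule Lim_null_comparison[OF _ lim]) (use z(2) in \<open>simp add: dist_norm\<close>)
  from tendsto_diff[OF assms(3) this] have "z \<longlonglongrightarrow> y0"
    by simp
  then have "y0 \<in> C s0"
    using closed_sequentially[OF compact_imp_closed[OF compact_values[OF s0]]] z(1) by blast
  with s0 show ?thesis by (simp add: Gr_def)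
qed

definition escaping :: "real \<Rightarrow> 'a \<Rightarrow> real \<Rightarrow> 'a \<times> real \<Rightarrow> bool" where
  "escaping \<epsilon> w t q \<longleftrightarrow> Gr t (fst q) \<and> 0 \<le> snd q \<and> t + snd q \<le> T \<and>
     (\<forall>z. Gr (t + snd q) z \<longrightarrow> \<epsilon> * snd q \<le> norm (z - fst q - snd q *\<^sub>R w))"

lemma definable_escaping:
  assumes "polynomial_function f" "polynomial_function g"
  shows "definable (\<lambda>x. escaping \<epsilon> w (f x) (g x))"
proof -
  have "definable (\<lambda>x. Gr (fst x) (fst (snd x)) \<and> 0 \<le> snd (snd x) \<and> fst x + snd (snd x) \<le> T \<and>
     (\<forall>z. Gr (fst x + snd (snd x)) z \<longrightarrow>
        \<not> norm (z - fst (snd x) - snd (snd x) *\<^sub>R w) < \<epsilon> * snd (snd x)))"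
    by (intro definable_logic definable_Gr polynomial_function_intros)
  from definable_compose[OF this polynomial_function_Pair[OF assms]] show ?thesis
    by (simp add: escaping_def not_less)
qed

text \<open>Closedness rests on lower semicontinuity of \<open>C\<close>, a consequence of the
  Lipschitz condition: a point of the limiting value is a limit of points of the approximating
  values, for which the inequality is known.\<close>

lemma compact_escaping: "compact {q. escaping \<epsilon> w t q}"
proof (cases "t \<in> {0..T}")
  case False
  then have eq: "{q. escaping \<epsilon> w t q} = {}"
    by (auto simp: escaping_def Gr_def)
  show ?thesis unfolding eq by simp
next
  case True
  have "closed {q. escaping \<epsilon> w t q}"
    unfolding closed_sequential_limits
  proof (intro allI impI, elim conjE)
    fix q l assume q: "\<forall>k::nat. q k \<in> {q. escaping \<epsilon> w t q}" and lim: "q \<longlonglongrightarrow> l"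
    have q': "Gr t (fst (q k))" "0 \<le> snd (q k)" "t + snd (q k) \<le> T"
      "\<And>z. Gr (t + snd (q k)) z \<Longrightarrow> \<epsilon> * snd (q k) \<le> norm (z - fst (q k) - snd (q k) *\<^sub>R w)" for k
      using q by (auto simp: escaping_def)
    have lims: "(\<lambda>k. fst (q k)) \<longlonglongrightarrow> fst l" "(\<lambda>k. snd (q k)) \<longlonglongrightarrow> snd l"
      using lim by (auto intro: tendsto_intros)
    have 1: "Gr t (fst l)"
      using closed_Gr[OF q'(1) tendsto_const lims(1)] .
    have 2: "0 \<le> snd l"
      using LIMSEQ_le_const[OF lims(2)] q'(2) by blast
    have 3: "t + snd l \<le> T"
      using LIMSEQ_le_const2[OF tendsto_add[OF tendsto_const lims(2)]] q'(3) by blast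
    have "\<epsilon> * snd l \<le> norm (z - fst l - snd l *\<^sub>R w)" if z: "Gr (t + snd l) z" for z
    proof -
      have mem: "t + snd (q k) \<in> {0..T}" "t + snd l \<in> {0..T}" "z \<in> C (t + snd l)" for k
        using True q'(2,3)[of k] z by (auto simp: Gr_def)
      have "\<exists>y\<in>C (t + snd (q k)). dist z y \<le> L * \<bar>t + snd l - (t + snd (q k))\<bar>" for k
        using lipschitz_values[OF mem(2) mem(1) mem(3)] .
      then obtain y where y: "\<And>k. y k \<in> C (t + snd (q k))"
        "\<And>k. dist z (y k) \<le> L * \<bar>t + snd l - (t + snd (q k))\<bar>"
        by metis
      have "(\<lambda>k. L * \<bar>t + snd l - (t + snd (q k))\<bar>) \<longlonglongrightarrow> L * \<bar>t + snd l - (t + snd l)\<bar>"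
        by (intro tendsto_intros lims)
      then have 0: "(\<lambda>k. L * \<bar>t + snd l - (t + snd (q k))\<bar>) \<longlonglongrightarrow> 0"
        by simp
      have "(\<lambda>k. z - y k) \<longlonglongrightarrow> 0"
        by (rule Lim_null_comparison[OF _ 0]) (use y(2) in \<open>simp add: dist_norm\<close>)
      from tendsto_diff[OF tendsto_const[of z] this] have y_lim: "y \<longlonglongrightarrow> z"
        by simp
      show ?thesis
      proof (rule LIMSEQ_le)
        show "(\<lambda>k. \<epsilon> * snd (q k)) \<longlonglongrightarrow> \<epsilon> * snd l"
          by (intro tendsto_intros lims)
        show "(\<lambda>k. norm (y k - fst (q k) - snd (q k) *\<^sub>R w)) \<longlonglongrightarrow> norm (z - fst l - snd l *\<^sub>R w)"
          by (intro tendsto_intros lims y_lim)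
        show "\<exists>N. \<forall>n\<ge>N. \<epsilon> * snd (q n) \<le> norm (y n - fst (q n) - snd (q n) *\<^sub>R w)"
          using q'(4) y(1) mem(1) by (auto simp: Gr_def)
      qed
    qed
    with 1 2 3 show "l \<in> {q. escaping \<epsilon> w t q}"
      by (simp add: escaping_def)
  qed
  moreover have "{q. escaping \<epsilon> w t q} \<subseteq> C t \<times> {0..T}"
    using True by (auto simp: escaping_def Gr_def)
  moreover have "bounded (C t \<times> {0..T})"
    using compact_values[OF True] by (intro bounded_Times compact_imp_bounded) auto
  ultimately show ?thesis
    using bounded_subset compact_eq_bounded_closed by blast
qed

text \<open>
  At an accumulation point \<open>t0\<close> of exceptional times, escaping pairs can be selected definably in
  \<open>t\<close> (as the lexicographic minimum of a compact set) within \<open>o(t - t0)\<close> of the tangent line of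
  \<open>x\<close>. The coordinates of the selection relative to this line are monotone near \<open>t0\<close>; since the
  selection itself must jump over the gap \<open>\<epsilon> * h\<close>, their total variation grows linearly, which
  contradicts \<open>o(t - t0)\<close>.
\<close>

lemma countable_escaping_times:
  assumes "\<epsilon> > 0"
  shows "countable {t. 0 < t \<and> t < T \<and>
    (\<exists>v. (x has_vector_derivative v) (at t) \<and> norm (v - w) \<le> \<epsilon> / 2) \<and>
    (t, x t, 0) \<in> closure {z. escaping \<epsilon> w (fst z) (snd z) \<and> 0 < snd (snd z)}}" (is "countable ?E")
proof (rule ccontr)
  assume unc: "uncountable ?E"
  define bad where "bad t q \<longleftrightarrow> escaping \<epsilon> w t q \<and> 0 < snd q" for t q
  have def_bad: "definable (\<lambda>x. bad (f x) (g x))" if "polynomial_function f" "polynomial_function g"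
    for f :: "'c::euclidean_space \<Rightarrow> real" and g
    unfolding bad_def by (intro definable_logic definable_escaping polynomial_function_intros that)
  \<comment> \<open>Outside \<open>N\<close>, escaping pairs that approach \<open>(x t, 0)\<close>
    at nearby times can be replaced by escaping pairs at the time \<open>t\<close> itself.\<close>
  define N where "N = {t. \<exists>p. (t, p) \<in> closure {z. bad (fst z) (snd z)} \<and> p \<notin> closure {q. bad t q}}"
  have "countable N"
    using countable_closure_fiber_defect[OF def_bad[OF polynomial_function_fst polynomial_function_snd,
      OF polynomial_function_id polynomial_function_id]]
    by (simp add: N_def)
  define X where "X = ?E - N"
  have "uncountable X"
    unfolding X_def using unc \<open>countable N\<close> by (rule uncountable_minus_countable)
  have "\<exists>t0\<in>X. \<forall>e>0. X \<inter> {t0<..<t0 + e} \<noteq> {}"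
  proof (rule ccontr)
    assume "\<not> ?thesis"
    then have "X = {t \<in> X. \<exists>e>0. X \<inter> {t<..<t + e} = {}}"
      by (intro set_eqI iffI CollectI conjI) simp_all
    with countable_right_isolated[of X] have "countable X"
      by simp
    with \<open>uncountable X\<close> show False ..
  qed
  then obtain t0 where t0: "t0 \<in> X" and acc: "\<And>e. e > 0 \<Longrightarrow> X \<inter> {t0<..<t0 + e} \<noteq> {}"
    by (elim bexE) simp
  have X: "0 < t" "t < T" "\<exists>v. (x has_vector_derivative v) (at t) \<and> norm (v - w) \<le> \<epsilon> / 2"
    "(x t, 0) \<in> closure {q. bad t q}" if "t \<in> X" for t
  proof -
    have E: "t \<in> ?E" "t \<notin> N"
      using that by (simp_all add: X_def)
    show "0 < t" "t < T" "\<exists>v. (x has_vector_derivative v) (at t) \<and> norm (v - w) \<le> \<epsilon> / 2"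
      using E(1) by simp_all
    show "(x t, 0) \<in> closure {q. bad t q}"
      using E unfolding N_def bad_def by simp
  qed
  obtain v where v: "(x has_vector_derivative v) (at t0)" "norm (v - w) \<le> \<epsilon> / 2"
    using X(3)[OF t0] by blast
  \<comment> \<open>The tangent line of \<open>x\<close> at \<open>t0\<close>, paired with step 0.
    It is polynomial in \<open>t\<close> and stands in for \<open>x\<close> in the formulas
    below.\<close>
  define l where "l t = (x t0 + (t - t0) *\<^sub>R v, 0::real)" for t
  have poly_l: "polynomial_function (\<lambda>x. l (f x))" if "polynomial_function f"
    for f :: "'c::euclidean_space \<Rightarrow> real"
    unfolding l_def by (intro polynomial_function_intros that)
  \<comment> \<open>At times of \<open>X\<close> such pairs exist, but these times merely accumulate
    at \<open>t0\<close>. Since the condition is definable in \<open>t\<close>, the dichotomy of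
    germs extends it to all times shortly after \<open>t0\<close>.\<close>
  have near: "\<forall>\<^sub>F t in at_right t0. \<exists>q. bad t q \<and> norm (q - l t) < \<rho> * (t - t0)" if "\<rho> > 0" for \<rho>
  proof (rule ccontr)
    assume "\<not> ?thesis"
    moreover have "definable (\<lambda>t. \<exists>q. bad t q \<and> norm (q - l t) < \<rho> * (t - t0))"
      by (intro definable_logic def_bad polynomial_function_intros poly_l)
    ultimately have "\<forall>\<^sub>F t in at_right t0. \<not> (\<exists>q. bad t q \<and> norm (q - l t) < \<rho> * (t - t0))"
      using definable_at_right by blast
    then obtain b where b: "t0 < b" "\<And>t q. t0 < t \<Longrightarrow> t < b \<Longrightarrow> bad t q \<Longrightarrow> \<rho> * (t - t0) \<le> norm (q - l t)"
      unfolding eventually_at_right_field by (auto simp: not_less)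
    obtain d where d: "d > 0" "\<And>t. \<bar>t - t0\<bar> < d \<Longrightarrow> norm (x t - x t0 - (t - t0) *\<^sub>R v) \<le> \<rho> / 2 * \<bar>t - t0\<bar>"
    proof -
      have *: "\<forall>e>0. \<exists>d>0. \<forall>y. norm (y - t0) < d \<longrightarrow> norm (x y - x t0 - (y - t0) *\<^sub>R v) \<le> e * norm (y - t0)"
        using v(1) unfolding has_vector_derivative_def has_derivative_within_alt by simp
      have "\<rho> / 2 > 0"
        using \<open>\<rho> > 0\<close> by simp
      from *[rule_format, OF this] that show ?thesis
        by (elim exE conjE) simp
    qed
    define m where "m = min (b - t0) d"
    have m: "m > 0" "m \<le> b - t0" "m \<le> d"
      using b(1) d(1) by (auto simp: m_def)
    then obtain t where t': "t \<in> X" "t0 < t" "t < t0 + m"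
      using acc[OF m(1)] by auto
    have t: "t \<in> X" "t0 < t" "t < b" "t < t0 + d"
      using t' m by simp_all
    note X(4)[OF t(1)]
    moreover have "\<rho> / 2 * (t - t0) > 0"
      using \<open>\<rho> > 0\<close> t(2) by simp
    ultimately obtain q where q: "bad t q" "dist q (x t, 0) < \<rho> / 2 * (t - t0)"
      unfolding closure_approachable by blast
    have "norm (q - l t) \<le> dist q (x t, 0) + dist (x t, 0) (l t)"
      using dist_triangle[of q "l t" "(x t, 0)"] by (simp add: dist_norm)
    also have "dist (x t, 0) (l t) = norm (x t - x t0 - (t - t0) *\<^sub>R v)"
      by (simp add: l_def dist_norm diff_diff_eq)
    also have "\<dots> \<le> \<rho> / 2 * (t - t0)"
      using d(2)[of t] t by simp
    finally show False
      using b(2)[OF t(2,3) q(1)] q(2) by simp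
  qed
  define size where "size t q = (q - l t) \<bullet> (q - l t)" for t q
  have size: "size t q = (norm (q - l t))\<^sup>2" for t q
    by (simp add: size_def power2_norm_eq_inner)
  \<comment> \<open>The pairs in \<open>bad\<close> do not form a closed set, so the pair nearest to
    the line may not exist. The tolerance leaves some bad pair in the compact set
    \<open>K t\<close>; compared with the squared distance \<open>size\<close>, a fourth power is
    negligible near \<open>t0\<close>.\<close>
  define K where "K t = {q. escaping \<epsilon> w t q \<and> (\<forall>q'. bad t q' \<longrightarrow> size t q \<le> size t q' + (t - t0) ^ 4)}" for t
  obtain bs :: "'a list" where bs: "distinct bs" "set bs = Basis"
    using finite_distinct_list[OF finite_Basis] by blast
  define n where "n = Suc (length bs)"
  \<comment> \<open>Maximizing the step comes first: \<open>K t\<close> contains a pair with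
    positive step, so the selected pair has one as well. The coordinates of the point then make the
    selection unique.\<close>
  define c where "c i q = (case i of 0 \<Rightarrow> - snd q | Suc j \<Rightarrow> fst q \<bullet> bs ! j)" for i and q :: "'a \<times> real"
  define sel where "sel t q \<longleftrightarrow> q \<in> K t \<and>
    (\<forall>q'. q' \<in> K t \<longrightarrow> (\<forall>i\<in>{..<n}. (\<forall>j\<in>{..<i}. c j q' = c j q) \<longrightarrow> c i q \<le> c i q'))" for t q
  have sel_iff: "sel t q \<longleftrightarrow> q \<in> K t \<and>
    (\<forall>q'\<in>K t. \<forall>i\<in>{..<n}. (\<forall>j\<in>{..<i}. c j q' = c j q) \<longrightarrow> c i q \<le> c i q')" for t q
    unfolding sel_def by (simp only: Ball_def)
  have poly_c: "polynomial_function (\<lambda>x. c i (f x))" if "polynomial_function f"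
    for i and f :: "'c::euclidean_space \<Rightarrow> 'a \<times> real"
    unfolding c_def by (cases i) (auto intro!: polynomial_function_intros that)
  have def_K: "definable (\<lambda>x. g x \<in> K (f x))" if "polynomial_function f" "polynomial_function g"
    for f :: "'c::euclidean_space \<Rightarrow> real" and g
  proof -
    have "definable (\<lambda>z. snd z \<in> K (fst z))"
      unfolding K_def size_def mem_Collect_eq
      by (intro definable_logic def_bad definable_escaping polynomial_function_intros poly_l)
    from definable_compose[OF this polynomial_function_Pair[OF that]] show ?thesis
      by simp
  qed
  have def_sel: "definable (\<lambda>x. sel (f x) (g x))" if "polynomial_function f" "polynomial_function g"
    for f :: "'c::euclidean_space \<Rightarrow> real" and g
  proof -
    have "definable (\<lambda>z. sel (fst z) (snd z))"
      unfolding sel_def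
      by (intro definable_logic definable_ball finite_lessThan def_K polynomial_function_intros poly_c)
    from definable_compose[OF this polynomial_function_Pair[OF that]] show ?thesis
      by simp
  qed
  have "\<forall>\<^sub>F t in at_right t0. \<exists>q. bad t q"
    using near[of 1] by (rule eventually_mono) auto
  then obtain b where b: "t0 < b" "\<And>t. t0 < t \<Longrightarrow> t < b \<Longrightarrow> \<exists>q. bad t q"
    unfolding eventually_at_right_field by blast
  have "\<exists>q. sel t q \<and> 0 < snd q" if t: "t0 < t" "t < b" for t
  proof -
    have "compact (K t)"
    proof -
      have "closed (\<Inter>q'\<in>{q'. bad t q'}. {q. size t q \<le> size t q' + (t - t0) ^ 4})"
        unfolding size_def by (intro closed_INT ballI closed_Collect_le continuous_intros)
      then have "compact ({q. escaping \<epsilon> w t q} \<inter> (\<Inter>q'\<in>{q'. bad t q'}. {q. size t q \<le> size t q' + (t - t0) ^ 4}))"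
        by (intro compact_Int_closed compact_escaping)
      moreover have "K t = {q. escaping \<epsilon> w t q} \<inter> (\<Inter>q'\<in>{q'. bad t q'}. {q. size t q \<le> size t q' + (t - t0) ^ 4})"
        by (auto simp: K_def)
      ultimately show ?thesis by simp
    qed
    moreover obtain q where q: "q \<in> K t" "0 < snd q"
    proof -
      define m where "m = Inf (size t ` {q. bad t q})"
      have bdd: "bdd_below (size t ` {q. bad t q})"
        by (auto simp: size intro!: bdd_belowI[of _ 0])
      have "m < m + (t - t0) ^ 4"
        using t(1) by simp
      moreover have "size t ` {q. bad t q} \<noteq> {}"
        using b(2)[OF t] by auto
      ultimately obtain q where q: "bad t q" "size t q < m + (t - t0) ^ 4"
        using cInf_lessD[of "size t ` {q. bad t q}"] unfolding m_def by blast
      have "m \<le> size t q'" if "bad t q'" for q'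
        unfolding m_def using bdd that by (auto intro: cInf_lower)
      then have "q \<in> K t"
        using q unfolding K_def bad_def by fastforce
      with q(1) show ?thesis
        by (intro that) (auto simp: bad_def)
    qed
    moreover have "continuous_on UNIV (c i)" for i
      unfolding c_def by (cases i) (auto intro!: continuous_intros)
    ultimately obtain p where p: "p \<in> K t"
      "\<forall>q'\<in>K t. \<forall>i\<in>{..<n}. (\<forall>j\<in>{..<i}. c j q' = c j p) \<longrightarrow> c i p \<le> c i q'"
      using compact_lex_min_exists[of "K t" n c] by blast
    have "c 0 p \<le> c 0 q"
      using p(2)[rule_format, OF q(1), of 0] by (simp add: n_def)
    then have "0 < snd p"
      using q(2) by (simp add: c_def)
    with p show ?thesis
      by (intro exI[of _ p] conjI iffD2[OF sel_iff])
  qed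
  then have "\<forall>t\<in>{t0<..<b}. \<exists>q. sel t q \<and> 0 < snd q"
    by auto
  from bchoice[OF this] obtain p where p_sel: "\<forall>t\<in>{t0<..<b}. sel t (p t) \<and> 0 < snd (p t)" ..
  have p: "sel t (p t) \<and> 0 < snd (p t)" if "t0 < t" "t < b" for t
    using p_sel that by simp
  have sel_eq: "q = p t" if "sel t q" "t0 < t" "t < b" for t q
  proof -
    have "c i q = c i (p t)" if "i < n" for i
    proof -
      have q: "sel t q" and pt: "sel t (p t)"
        using \<open>sel t q\<close> p[OF \<open>t0 < t\<close> \<open>t < b\<close>] by simp_all
      show ?thesis
        by (rule lex_min_unique[OF conjunct1[OF iffD1[OF sel_iff q]] conjunct2[OF iffD1[OF sel_iff q]]
          conjunct1[OF iffD1[OF sel_iff pt]] conjunct2[OF iffD1[OF sel_iff pt]] that])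
    qed
    from this[of 0] this[of "Suc j" for j]
    have 1: "snd q = snd (p t)" and 2: "\<And>j. j < length bs \<Longrightarrow> fst q \<bullet> bs ! j = fst (p t) \<bullet> bs ! j"
      by (auto simp: n_def c_def)
    have "fst q = fst (p t)"
    proof (rule euclidean_eqI)
      fix \<beta> :: 'a assume "\<beta> \<in> Basis"
      then show "fst q \<bullet> \<beta> = fst (p t) \<bullet> \<beta>"
        using 2 bs(2) by (metis in_set_conv_nth)
    qed
    with 1 show ?thesis
      by (simp add: prod_eq_iff)
  qed
  define Y where "Y t = fst (p t - l t)" for t
  have "\<forall>\<beta>\<in>Basis. \<exists>d>t0. d \<le> b \<and> (\<exists>s\<in>{1, -1}. mono_on {t0<..<d} (\<lambda>t. s * (Y t \<bullet> \<beta>)))"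
  proof
    fix \<beta> :: 'a assume "\<beta> \<in> Basis"
    have "definable (\<lambda>z. t0 < fst z \<and> fst z < b \<and> (\<exists>q. sel (fst z) q \<and> snd z = fst (q - l (fst z)) \<bullet> \<beta>))"
      by (intro definable_logic def_sel polynomial_function_intros poly_l)
    moreover have "(\<exists>q. sel t q \<and> y = fst (q - l t) \<bullet> \<beta>) \<longleftrightarrow> y = Y t \<bullet> \<beta>" if "t0 < t" "t < b" for t y
      unfolding Y_def using p[OF that] sel_eq[OF _ that] by blast
    ultimately have "definable (\<lambda>z. t0 < fst z \<and> fst z < b \<and> snd z = Y (fst z) \<bullet> \<beta>)"
      by (simp cong: conj_cong)
    then show "\<exists>d>t0. d \<le> b \<and> (\<exists>s\<in>{1, -1}. mono_on {t0<..<d} (\<lambda>t. s * (Y t \<bullet> \<beta>)))"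
      using b(1) by (intro definable_function_monotone_at_right)
  qed
  from bchoice[OF this] obtain d where "\<forall>\<beta>\<in>Basis. t0 < d \<beta> \<and> d \<beta> \<le> b \<and>
      (\<exists>s\<in>{1, -1}. mono_on {t0<..<d \<beta>} (\<lambda>t. s * (Y t \<bullet> \<beta>)))" ..
  note d = bspec[OF this]
  then have "\<forall>\<beta>\<in>Basis. \<exists>s. s \<in> {1, -1} \<and> mono_on {t0<..<d \<beta>} (\<lambda>t. s * (Y t \<bullet> \<beta>))"
    by blast
  from bchoice[OF this] obtain s where "\<forall>\<beta>\<in>Basis. s \<beta> \<in> {1, -1} \<and>
      mono_on {t0<..<d \<beta>} (\<lambda>t. s \<beta> * (Y t \<bullet> \<beta>))" ..
  note s = bspec[OF this]
  define f where "f t = (\<Sum>\<beta>\<in>Basis. s \<beta> * (Y t \<bullet> \<beta>))" for t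
  define e where "e = Min (d ` Basis)"
  have e: "t0 < e" "e \<le> b" "\<And>\<beta>. \<beta> \<in> Basis \<Longrightarrow> e \<le> d \<beta>"
  proof -
    show "e \<le> d \<beta>" if "\<beta> \<in> Basis" for \<beta>
      unfolding e_def using that by simp
    show "t0 < e"
      unfolding e_def using d by (subst Min_gr_iff) auto
    obtain \<beta> :: 'a where "\<beta> \<in> Basis"
      using nonempty_Basis by blast
    with d[of \<beta>] show "e \<le> b"
      unfolding e_def by (meson Min_le finite_Basis finite_imageI imageI order_trans)
  qed
  have mono_Y: "s \<beta> * (Y t \<bullet> \<beta>) \<le> s \<beta> * (Y t' \<bullet> \<beta>)"
    if "\<beta> \<in> Basis" "t0 < t" "t \<le> t'" "t' < e" for \<beta> t t'
    using s[OF that(1)] e(3)[OF that(1)] that by (auto intro!: mono_onD[of _ "\<lambda>t. s \<beta> * (Y t \<bullet> \<beta>)"])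
  have mono_f: "mono_on {t0<..<e} f"
    unfolding f_def by (intro mono_onI sum_mono mono_Y) auto
  \<comment> \<open>The sum \<open>f\<close> has \<open>DIM('a)\<close> terms, each at most
    \<open>\<rho> * (t - t0)\<close> in absolute value, while the growth lemma with slope
    \<open>\<epsilon> / 2\<close> tolerates \<open>\<epsilon> / 8\<close> in total. The bound
    \<open>\<rho> \<le> 1\<close> keeps the selected step below \<open>t - t0\<close>.\<close>
  define \<rho> where "\<rho> = min 1 (\<epsilon> / (16 * DIM('a)))"
  have \<rho>: "\<rho> > 0" "\<rho> \<le> 1"
    using assms by (auto simp: \<rho>_def)
  have \<rho>': "DIM('a) * \<rho> \<le> \<epsilon> / 16"
  proof -
    have "DIM('a) * \<rho> \<le> DIM('a) * (\<epsilon> / (16 * DIM('a)))"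
      unfolding \<rho>_def by (intro mult_left_mono) auto
    then show ?thesis by simp
  qed
  have "\<forall>\<^sub>F t in at_right t0. t < t0 + \<rho> / 2 \<and> t < e"
    using e(1) \<rho>(1) by (auto simp: eventually_at_right_field intro!: exI[of _ "min e (t0 + \<rho> / 2)"])
  moreover have "\<forall>\<^sub>F t in at_right t0. \<exists>q. bad t q \<and> norm (q - l t) < \<rho> / 2 * (t - t0)"
    using near[of "\<rho> / 2"] \<rho>(1) by simp
  ultimately have "\<forall>\<^sub>F t in at_right t0. t < t0 + \<rho> / 2 \<and> t < e \<and>
      (\<exists>q. bad t q \<and> norm (q - l t) < \<rho> / 2 * (t - t0))"
    by eventually_elim auto
  then obtain a where a: "t0 < a" "\<And>t. t0 < t \<Longrightarrow> t < a \<Longrightarrow> t < t0 + \<rho> / 2 \<and> t < e \<and>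
      (\<exists>q. bad t q \<and> norm (q - l t) < \<rho> / 2 * (t - t0))"
    unfolding eventually_at_right_field by blast
  have small: "norm (p t - l t) \<le> \<rho> * (t - t0)" if t: "t0 < t" "t < a" for t
  proof -
    define \<tau> where "\<tau> = t - t0"
    have \<tau>: "0 < \<tau>" "\<tau> < \<rho> / 2"
      using a(2)[OF t] t by (auto simp: \<tau>_def)
    obtain q where q: "bad t q" "norm (q - l t) < \<rho> / 2 * \<tau>"
      using a(2)[OF t] by (auto simp: \<tau>_def)
    have "p t \<in> K t"
      using p[of t] a(2)[OF t] t e(2) by (auto simp: sel_def)
    then have "size t (p t) \<le> size t q + \<tau> ^ 4"
      using q(1) unfolding K_def \<tau>_def by blast
    also have "size t q \<le> (\<rho> / 2 * \<tau>)\<^sup>2"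
      unfolding size using q(2) by (intro power_mono) auto
    also have "\<tau> ^ 4 \<le> (\<rho> / 2 * \<tau>)\<^sup>2"
    proof -
      have "\<tau> * \<tau> \<le> \<rho> / 2 * \<tau>"
        using \<tau> by (intro mult_right_mono) auto
      then have "(\<tau> * \<tau>)\<^sup>2 \<le> (\<rho> / 2 * \<tau>)\<^sup>2"
        using \<tau> by (intro power_mono) auto
      then show ?thesis
        by (simp add: power2_eq_square power4_eq_xxxx mult.assoc)
    qed
    also have "(\<rho> / 2 * \<tau>)\<^sup>2 + (\<rho> / 2 * \<tau>)\<^sup>2 \<le> (\<rho> * \<tau>)\<^sup>2"
      by (simp add: power_mult_distrib power_divide)
    finally have "(norm (p t - l t))\<^sup>2 \<le> (\<rho> * \<tau>)\<^sup>2"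
      by (simp add: size)
    then show ?thesis
      using \<tau> \<rho>(1) by (auto simp: \<tau>_def intro: power2_le_imp_le)
  qed
  have ae: "a \<le> e"
    using a(2) by (meson dense leD leI less_trans a(1) e(1) not_less_iff_gr_or_eq)
  show False
  proof (rule no_sublinear_function_with_linear_jumps[of t0 a "\<epsilon> / 2" f "\<lambda>t. snd (p t)"])
    show "mono_on {t0<..<a} f"
      using mono_f by (rule mono_on_subset) (use ae in auto)
    show "\<bar>f t\<bar> \<le> \<epsilon> / 2 / 4 * (t - t0)" if t: "t0 < t" "t < a" for t
    proof -
      have "\<bar>f t\<bar> \<le> (\<Sum>\<beta>\<in>Basis. \<bar>s \<beta> * (Y t \<bullet> \<beta>)\<bar>)"
        unfolding f_def by (rule sum_abs)
      also have "\<dots> \<le> (\<Sum>\<beta>\<in>(Basis::'a set). \<rho> * (t - t0))"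
      proof (rule sum_mono)
        fix \<beta> :: 'a assume \<beta>: "\<beta> \<in> Basis"
        have "\<bar>s \<beta> * (Y t \<bullet> \<beta>)\<bar> = \<bar>Y t \<bullet> \<beta>\<bar>"
          using s[OF \<beta>] by (auto simp: abs_mult)
        also have "\<dots> \<le> norm (Y t)"
          using \<beta> by (rule Basis_le_norm)
        also have "\<dots> \<le> norm (p t - l t)"
          unfolding Y_def using norm_fst_le[of "fst (p t - l t)" "snd (p t - l t)"] by (simp only: prod.collapse)
        also have "\<dots> \<le> \<rho> * (t - t0)"
          using small[OF t] .
        finally show "\<bar>s \<beta> * (Y t \<bullet> \<beta>)\<bar> \<le> \<rho> * (t - t0)" .
      qed
      also have "\<dots> = (DIM('a) * \<rho>) * (t - t0)"
        by simp
      also have "\<dots> \<le> (\<epsilon> / 2 / 4) * (t - t0)"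
        using \<rho>' t assms by (intro mult_right_mono) auto
      finally show ?thesis .
    qed
    show "0 < snd (p t) \<and> snd (p t) \<le> t - t0" if t: "t0 < t" "t < a" for t
    proof
      show "0 < snd (p t)"
        using p[of t] t ae e(2) by auto
      have "snd (p t) \<le> norm (snd (p t - l t))"
        by (simp add: l_def)
      also have "\<dots> \<le> norm (p t - l t)"
        using norm_snd_le[of "snd (p t - l t)" "fst (p t - l t)"] by (simp only: prod.collapse)
      also have "\<dots> \<le> \<rho> * (t - t0)"
        using small[OF t] .
      also have "\<dots> \<le> t - t0"
        using \<rho> t by (simp add: mult_left_le_one_le)
      finally show "snd (p t) \<le> t - t0" .
    qed
    show "\<epsilon> / 2 * snd (p t) \<le> f (t + snd (p t)) - f t"
      if t: "t0 < t" "t + snd (p t) < a" "t < a" for t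
    proof -
      define h where "h = snd (p t)"
      have h: "h > 0"
        unfolding h_def using p[of t] t ae e(2) by auto
      have tb: "t < b" "t + h < b" "t0 < t + h"
        using t ae e(2) h by (auto simp: h_def)
      have esc: "escaping \<epsilon> w t (p t)"
        using p[OF t(1) tb(1)] by (auto simp: sel_def K_def)
      \<comment> \<open>The point selected at time \<open>t + h\<close> lies in
        \<open>C (t + h)\<close>, which the pair selected at \<open>t\<close> escapes: the selection
        itself must cross the gap. Passing from \<open>w\<close> to the slope \<open>v\<close> of
        the line costs at most half of it.\<close>
      have "Gr (t + h) (fst (p (t + h)))"
        using p[OF tb(3,2)] by (auto simp: sel_def K_def escaping_def)
      then have "\<epsilon> * h \<le> norm (fst (p (t + h)) - fst (p t) - h *\<^sub>R w)"
        using esc by (auto simp: escaping_def h_def)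
      also have "fst (p (t + h)) - fst (p t) - h *\<^sub>R w = (Y (t + h) - Y t) + h *\<^sub>R (v - w)"
        by (simp add: Y_def l_def algebra_simps)
      also have "norm \<dots> \<le> norm (Y (t + h) - Y t) + h * (\<epsilon> / 2)"
      proof -
        have "norm (h *\<^sub>R (v - w)) \<le> h * (\<epsilon> / 2)"
          using h v(2) by (simp add: mult_left_mono)
        then show ?thesis
          by (meson add_left_mono norm_triangle_ineq order_trans)
      qed
      finally have "\<epsilon> / 2 * h \<le> norm (Y (t + h) - Y t)"
        by (simp add: algebra_simps)
      also have "\<dots> \<le> (\<Sum>\<beta>\<in>Basis. \<bar>(Y (t + h) - Y t) \<bullet> \<beta>\<bar>)"
        by (rule norm_le_l1)
      \<comment> \<open>Every signed coordinate increases, so the absolute increments add up to an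
        increment of \<open>f\<close> without cancellation.\<close>
      also have "\<dots> = (\<Sum>\<beta>\<in>Basis. s \<beta> * (Y (t + h) \<bullet> \<beta>) - s \<beta> * (Y t \<bullet> \<beta>))"
      proof (rule sum.cong)
        fix \<beta> :: 'a assume \<beta>: "\<beta> \<in> Basis"
        have "s \<beta> * (Y t \<bullet> \<beta>) \<le> s \<beta> * (Y (t + h) \<bullet> \<beta>)"
          using h t ae by (intro mono_Y[OF \<beta>]) (auto simp: h_def)
        with s[OF \<beta>] show "\<bar>(Y (t + h) - Y t) \<bullet> \<beta>\<bar> = s \<beta> * (Y (t + h) \<bullet> \<beta>) - s \<beta> * (Y t \<bullet> \<beta>)"
          by (auto simp: inner_diff_left)
      qed simp
      also have "\<dots> = f (t + h) - f t"
        by (simp add: f_def sum_subtractf)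
      finally show ?thesis
        by (simp add: h_def)
    qed
  qed (use a(1) assms in auto)
qed

end

section \<open>The catching-up scheme\<close>

text \<open>Expand the squares and sum. Per index, the norm bound contributes
  \<open>2 * a * norm z + a * a\<close> and the average another \<open>2 * a * norm z\<close>; some
  term is at most the mean.\<close>

lemma average_close_imp_some_close:
  fixes \<zeta> :: "'i \<Rightarrow> 'a::real_inner"
  assumes "finite J" "J \<noteq> {}" "0 \<le> a"
    and bound: "\<And>j. j \<in> J \<Longrightarrow> norm (\<zeta> j) \<le> norm z + a"
    and average: "norm (of_nat (card J) *\<^sub>R z - (\<Sum>j\<in>J. \<zeta> j)) \<le> a * card J"
  shows "\<exists>j\<in>J. (norm (\<zeta> j - z))\<^sup>2 \<le> a * (4 * norm z + a)"
proof (rule ccontr)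
  assume "\<not> ?thesis"
  then have "(\<Sum>j\<in>J. a * (4 * norm z + a)) < (\<Sum>j\<in>J. (norm (\<zeta> j - z))\<^sup>2)"
    using assms(1,2) by (intro sum_strict_mono) (auto simp: not_le)
  also have "(\<Sum>j\<in>J. (norm (\<zeta> j - z))\<^sup>2) = (\<Sum>j\<in>J. (norm (\<zeta> j))\<^sup>2) - 2 * (z \<bullet> (\<Sum>j\<in>J. \<zeta> j)) + card J * (norm z)\<^sup>2"
    by (simp add: power2_norm_eq_inner inner_diff_left inner_diff_right sum.distrib sum_subtractf
        inner_sum_right sum_distrib_left inner_commute algebra_simps)
  also have "(\<Sum>j\<in>J. (norm (\<zeta> j))\<^sup>2) \<le> (\<Sum>j\<in>J. (norm z + a)\<^sup>2)"
    using bound by (intro sum_mono power_mono) auto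
  finally have 1: "card J * (a * (4 * norm z + a)) <
      card J * (norm z + a)\<^sup>2 - 2 * (z \<bullet> (\<Sum>j\<in>J. \<zeta> j)) + card J * (norm z)\<^sup>2"
    by simp
  have "z \<bullet> (of_nat (card J) *\<^sub>R z - (\<Sum>j\<in>J. \<zeta> j)) \<le> norm z * (a * card J)"
    using norm_cauchy_schwarz[of z] average by (meson mult_left_mono norm_ge_zero order_trans)
  then have "card J * (norm z)\<^sup>2 - norm z * (a * card J) \<le> z \<bullet> (\<Sum>j\<in>J. \<zeta> j)"
    by (simp add: inner_diff_right power2_norm_eq_inner)
  with 1 show False
    by (simp add: power2_eq_square algebra_simps)
qed

text \<open>By Tychonoff's theorem the sequence has a cluster point in the product topology. This
  suits discontinuous step functions: no subsequence is claimed to converge, but any finitely many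
  values can be matched at once by a late member.\<close>

lemma cluster_function_exists:
  fixes F :: "nat \<Rightarrow> 'b \<Rightarrow> 'a::euclidean_space"
  assumes "compact K" "\<And>n t. F n t \<in> K"
  shows "\<exists>x. \<forall>A e m. finite A \<longrightarrow> 0 < e \<longrightarrow> (\<exists>n\<ge>m. \<forall>t\<in>A. dist (F n t) (x t) < e)"
proof -
  have "compactin (product_topology (\<lambda>_::'b. euclidean) UNIV) (PiE UNIV (\<lambda>_::'b. K))"
    using assms(1) by (simp add: compactin_PiE)
  then have "compact (PiE UNIV (\<lambda>_::'b. K))"
    by (simp add: euclidean_product_topology)
  moreover have "eventually (\<lambda>f. f \<in> PiE UNIV (\<lambda>_. K)) (filtermap F sequentially)"
    using assms(2) by (simp add: eventually_filtermap PiE_UNIV_domain)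
  moreover have "filtermap F sequentially \<noteq> bot"
    by (simp add: filtermap_bot_iff)
  ultimately obtain x where x: "inf (nhds x) (filtermap F sequentially) \<noteq> bot"
    unfolding compact_filter by blast
  have "\<exists>n\<ge>m. \<forall>t\<in>A. dist (F n t) (x t) < e" if A: "finite A" and "0 < e" for A e m
  proof (rule ccontr)
    assume "\<not> ?thesis"
    then have "\<forall>\<^sub>F f in filtermap F sequentially. \<not> (\<forall>t\<in>A. dist (f t) (x t) < e)"
      unfolding eventually_filtermap eventually_sequentially by blast
    moreover have "\<forall>\<^sub>F f in nhds x. \<forall>t\<in>A. dist (f t) (x t) < e"
    proof -
      have "open (\<Inter>t\<in>A. (\<lambda>f. f t) -` ball (x t) e)"
        using A by (intro open_INT ballI open_vimage open_ball continuous_on_product_coordinates)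
      moreover have "x \<in> (\<Inter>t\<in>A. (\<lambda>f. f t) -` ball (x t) e)"
        using \<open>0 < e\<close> by simp
      ultimately have "\<forall>\<^sub>F f in nhds x. f \<in> (\<Inter>t\<in>A. (\<lambda>f. f t) -` ball (x t) e)"
        by (rule eventually_nhds_in_open)
      then show ?thesis
        by eventually_elim (auto simp: dist_commute)
    qed
    ultimately have "\<forall>\<^sub>F f in inf (nhds x) (filtermap F sequentially). False"
      unfolding eventually_inf by blast
    with x show False
      by (simp add: trivial_limit_def)
  qed
  then show ?thesis by blast
qed

text \<open>The set \<open>A\<close> need not be convex, so \<open>x\<close> may be one of several
  nearest points of \<open>y\<close>. Seen from the midpoint of the segment from \<open>x\<close> to
  \<open>y\<close> it is the only one, which explains the factor \<open>h / 2\<close>.\<close>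

lemma scaled_residual_proximal_normal:
  fixes A :: "'a::euclidean_space set"
  assumes x: "x \<in> metric_projection A y" and "h > 0"
  shows "(1 / h) *\<^sub>R (y - x) \<in> proximal_normals A x"
proof -
  have xA: "x \<in> A" and min: "\<And>b. b \<in> A \<Longrightarrow> dist y x \<le> dist y b"
    using x by (auto simp: metric_projection_def)
  define u where "u = y - x"
  have p: "x + (h / 2) *\<^sub>R ((1 / h) *\<^sub>R (y - x)) = x + (1 / 2) *\<^sub>R u"
    using assms(2) by (simp add: u_def)
  have less: "dist (x + (1 / 2) *\<^sub>R u) x < dist (x + (1 / 2) *\<^sub>R u) b" if "b \<in> A" "b \<noteq> x" for b
  proof -
    define w where "w = b - x"
    have w: "w \<noteq> 0" using that(2) by (simp add: w_def)
    have "norm u \<le> norm (u - w)"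
      using min[OF that(1)] by (simp add: u_def w_def dist_norm)
    then have "u \<bullet> u \<le> (u - w) \<bullet> (u - w)"
      by (simp add: norm_le)
    then have "2 * (u \<bullet> w) \<le> w \<bullet> w"
      by (simp add: inner_diff_left inner_diff_right inner_commute algebra_simps)
    moreover have "0 < w \<bullet> w" using w by simp
    ultimately have "u \<bullet> w < w \<bullet> w" by linarith
    then have "((1 / 2) *\<^sub>R u) \<bullet> ((1 / 2) *\<^sub>R u) < ((1 / 2) *\<^sub>R u - w) \<bullet> ((1 / 2) *\<^sub>R u - w)"
      by (simp add: inner_diff_left inner_diff_right inner_commute algebra_simps)
    then have "norm ((1 / 2) *\<^sub>R u) < norm ((1 / 2) *\<^sub>R u - w)"
      by (rule iffD2[OF norm_lt])
    then show ?thesis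
      by (simp add: dist_norm w_def algebra_simps)
  qed
  have "metric_projection A (x + (1 / 2) *\<^sub>R u) = {x}"
  proof (intro equalityI subsetI)
    fix a assume "a \<in> metric_projection A (x + (1 / 2) *\<^sub>R u)"
    then have "a \<in> A" "dist (x + (1 / 2) *\<^sub>R u) a \<le> dist (x + (1 / 2) *\<^sub>R u) x"
      using xA by (auto simp: metric_projection_def)
    with less[of a] show "a \<in> {x}" by force
  next
    fix a assume "a \<in> {x}"
    with xA less show "a \<in> metric_projection A (x + (1 / 2) *\<^sub>R u)"
      by (force simp: metric_projection_def)
  qed
  with p show ?thesis
    unfolding proximal_normals_def using assms(2)
    by (intro CollectI exI[of _ "h / 2"] conjI) (simp, simp only: p)
qed

context definable_lipschitz_map
begin

section \<open>Discrete trajectories and their limit\<close>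

lemma values_bounded: "\<exists>R>0. \<forall>t\<in>{0..T}. C t \<subseteq> cball 0 R"
proof -
  have T0: "(0::real) \<in> {0..T}" using T_pos by simp
  obtain R where R: "R > 0" "\<And>y. y \<in> C 0 \<Longrightarrow> norm y \<le> R"
    using compact_imp_bounded[OF compact_values[OF T0]] unfolding bounded_pos by blast
  have "norm y \<le> R + L * T" if t: "t \<in> {0..T}" and y: "y \<in> C t" for t y
  proof -
    obtain z where z: "z \<in> C 0" "dist y z \<le> L * \<bar>t - 0\<bar>"
      using lipschitz_values[OF t T0 y] by blast
    have "L * \<bar>t - 0\<bar> \<le> L * T"
      using t L_nonneg by (intro mult_left_mono) auto
    moreover have "norm y \<le> norm z + dist y z"
      using norm_triangle_sub[of y z] by (simp add: dist_norm)
    ultimately show ?thesis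
      using z R(2)[OF z(1)] by simp
  qed
  moreover have "0 < R + L * T"
    using R(1) L_nonneg T_pos by (simp add: add_pos_nonneg)
  ultimately show ?thesis
    by (intro exI[of _ "R + L * T"]) auto
qed

lemma metric_projection_nonempty:
  assumes "t \<in> {0..T}"
  shows "metric_projection (C t) y \<noteq> {}"
proof -
  obtain z where "z \<in> C t" "\<And>b. b \<in> C t \<Longrightarrow> dist y z \<le> dist y b"
    using distance_attains_inf[OF compact_imp_closed[OF compact_values[OF assms]] nonempty_values[OF assms]]
    by metis
  then show ?thesis
    by (auto simp: metric_projection_def)
qed

text \<open>An explicit Euler step along \<open>d\<close>, followed by projection on the set at the
  next node. Projections on nonconvex sets are multivalued, so this is a property of the
  sequence.\<close>

definition catching_up :: "('a \<times> real \<Rightarrow> 'a) \<Rightarrow> nat \<Rightarrow> (nat \<Rightarrow> 'a) \<Rightarrow> bool" where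
  "catching_up d N X \<longleftrightarrow> (\<forall>j<N. X (Suc j) \<in>
     metric_projection (C (T / N * Suc j)) (X j + (T / N) *\<^sub>R d (X j, T / N * j)))"

lemma grid_mem:
  fixes j N :: nat
  shows "j \<le> N \<Longrightarrow> 0 < N \<Longrightarrow> T / N * j \<in> {0..T}"
  using T_pos by (auto simp: pos_divide_le_eq mult_left_mono intro!: divide_nonneg_nonneg mult_nonneg_nonneg)

lemma catching_up_exists:
  assumes "0 < N"
  shows "\<exists>X. X 0 = x0 \<and> catching_up d N X"
proof -
  define X where "X = rec_nat x0 (\<lambda>j y. SOME z. z \<in>
     metric_projection (C (T / N * Suc j)) (y + (T / N) *\<^sub>R d (y, T / N * j)))"
  have "X 0 = x0"
    by (simp add: X_def)
  moreover have "catching_up d N X"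
    unfolding catching_up_def
  proof (intro allI impI)
    fix j assume "j < N"
    then have "T / N * Suc j \<in> {0..T}"
      using assms by (intro grid_mem) auto
    then have "metric_projection (C (T / N * Suc j)) (X j + (T / N) *\<^sub>R d (X j, T / N * j)) \<noteq> {}"
      by (rule metric_projection_nonempty)
    then have "(SOME z. z \<in> metric_projection (C (T / N * Suc j)) (X j + (T / N) *\<^sub>R d (X j, T / N * j)))
        \<in> metric_projection (C (T / N * Suc j)) (X j + (T / N) *\<^sub>R d (X j, T / N * j))"
      by (simp add: some_in_eq)
    then show "X (Suc j) \<in> metric_projection (C (T / N * Suc j)) (X j + (T / N) *\<^sub>R d (X j, T / N * j))"
      by (simp add: X_def)
  qed
  ultimately show ?thesis by blast
qed

text \<open>The next value of \<open>C\<close> has a point within \<open>L * h\<close> of the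
  current node, where \<open>h = T / N\<close>. The predicted point is therefore within
  \<open>(L + M) * h\<close> of that value, and hence of its projection; undoing the drift costs
  another \<open>M * h\<close>.\<close>

lemma catching_up_step:
  assumes X: "catching_up d N X" "X 0 \<in> C 0" and M: "\<And>t y. t \<in> {0..T} \<Longrightarrow> y \<in> C t \<Longrightarrow> norm (d (y, t)) \<le> M"
    and N: "0 < N"
  shows "j \<le> N \<Longrightarrow> X j \<in> C (T / N * j)"
    and "j < N \<Longrightarrow> norm (X (Suc j) - X j) \<le> (L + 2 * M) * (T / N)"
proof -
  show mem: "X j \<in> C (T / N * j)" if "j \<le> N" for j
  proof (cases j)
    case 0
    then show ?thesis using X(2) by simp
  next
    case (Suc i)
    then show ?thesis
      using X(1) that unfolding catching_up_def metric_projection_def by auto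
  qed
  show "norm (X (Suc j) - X j) \<le> (L + 2 * M) * (T / N)" if j: "j < N" for j
  proof -
    define h where "h = T / N"
    have h: "h > 0" using T_pos N by (simp add: h_def)
    define dj where "dj = d (X j, h * j)"
    have "norm dj \<le> M"
      unfolding dj_def h_def using M[OF grid_mem[of j N] mem[of j]] j N by simp
    then have dj: "norm (h *\<^sub>R dj) \<le> h * M"
      using h by simp
    obtain z where z: "z \<in> C (h * Suc j)" "dist (X j) z \<le> L * \<bar>h * j - h * Suc j\<bar>"
      using lipschitz_values[OF grid_mem[of j N] grid_mem[of "Suc j" N] mem[of j]] j N
      unfolding h_def by auto
    have "\<bar>h * j - h * Suc j\<bar> = h"
      using h by (simp add: algebra_simps)
    then have zj: "norm (X j - z) \<le> L * h"
      using z(2) by (simp add: dist_norm)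
    have "norm (X j + h *\<^sub>R dj - X (Suc j)) \<le> norm (X j + h *\<^sub>R dj - z)"
      using X(1) j z(1) unfolding catching_up_def metric_projection_def dist_norm dj_def h_def by simp
    also have "\<dots> \<le> norm (X j - z) + norm (h *\<^sub>R dj)"
      using norm_triangle_ineq[of "X j - z" "h *\<^sub>R dj"] by (simp add: algebra_simps)
    finally have "norm (X j + h *\<^sub>R dj - X (Suc j)) \<le> L * h + h * M"
      using zj dj by simp
    moreover have "norm (X (Suc j) - X j) \<le> norm (X j + h *\<^sub>R dj - X (Suc j)) + norm (h *\<^sub>R dj)"
      using norm_triangle_ineq4[of "h *\<^sub>R dj" "X j + h *\<^sub>R dj - X (Suc j)"] by (simp add: algebra_simps)
    ultimately have "norm (X (Suc j) - X j) \<le> L * h + h * M + h * M"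
      using dj by linarith
    also have "\<dots> = (L + 2 * M) * (T / N)"
      unfolding h_def[symmetric] by (simp add: algebra_simps)
    finally show ?thesis .
  qed
qed

lemma catching_up_lipschitz:
  assumes X: "catching_up d N X" "X 0 \<in> C 0" and M: "\<And>t y. t \<in> {0..T} \<Longrightarrow> y \<in> C t \<Longrightarrow> norm (d (y, t)) \<le> M"
    and N: "0 < N" and ij: "i \<le> N" "j \<le> N"
  shows "norm (X i - X j) \<le> (L + 2 * M) * \<bar>T / N * i - T / N * j\<bar>"
proof -
  have "norm (X (i + k) - X i) \<le> (L + 2 * M) * (T / N * k)" if "i + k \<le> N" for i k
    using that
  proof (induction k)
    case (Suc k)
    have "norm (X (i + Suc k) - X i) \<le> norm (X (Suc (i + k)) - X (i + k)) + norm (X (i + k) - X i)"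
      using norm_triangle_ineq[of "X (Suc (i + k)) - X (i + k)" "X (i + k) - X i"] by simp
    also have "\<dots> \<le> (L + 2 * M) * (T / N) + (L + 2 * M) * (T / N * k)"
      using Suc catching_up_step(2)[OF X M N, of "i + k"] by simp
    also have "\<dots> = (L + 2 * M) * (T / N * Suc k)"
      by (simp add: algebra_simps add_divide_distrib)
    finally show ?case .
  qed simp
  note * = this
  have sym: "norm (X i - X j) \<le> (L + 2 * M) * \<bar>T / N * i - T / N * j\<bar>" if "i \<le> j" "j \<le> N" for i j
  proof -
    have "norm (X j - X i) \<le> (L + 2 * M) * (T / N * (j - i))"
      using *[of i "j - i"] that by simp
    also have "T / N * (j - i) = \<bar>T / N * i - T / N * j\<bar>"
    proof -
      have "T / N * i \<le> T / N * j"
        using that T_pos by (intro mult_left_mono) auto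
      then show ?thesis
        using that by (simp add: of_nat_diff abs_if right_diff_distrib)
    qed
    finally show ?thesis
      by (simp add: norm_minus_commute)
  qed
  show ?thesis
  proof (cases "i \<le> j")
    case True
    then show ?thesis using sym ij by blast
  next
    case False
    then show ?thesis
      using sym[of j i] ij by (simp add: norm_minus_commute abs_minus_commute)
  qed
qed

definition grid_index :: "nat \<Rightarrow> real \<Rightarrow> nat" where
  "grid_index N t = nat \<lfloor>t / (T / N)\<rfloor>"

lemma grid_index:
  assumes "0 < N" "t \<in> {0..T}"
  shows "T / N * grid_index N t \<le> t" "t < T / N * grid_index N t + T / N" "grid_index N t \<le> N"
proof -
  define h where "h = T / N"
  have h: "h > 0" "h * N = T"
    using assms(1) T_pos by (auto simp: h_def)
  have 0: "0 \<le> t / h"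
    using assms(2) h by simp
  then have g: "real (grid_index N t) = of_int \<lfloor>t / h\<rfloor>"
    by (simp add: grid_index_def h_def)
  have 1: "real (grid_index N t) \<le> t / h" "t / h < real (grid_index N t) + 1"
    unfolding g by linarith+
  show le: "T / N * grid_index N t \<le> t" and "t < T / N * grid_index N t + T / N"
    using 1 h(1) unfolding h_def[symmetric] by (simp_all add: field_simps)
  have "h * grid_index N t \<le> h * N"
    using le assms(2) h(2) unfolding h_def[symmetric] by simp
  then show "grid_index N t \<le> N"
    using h(1) by simp
qed

lemma catching_up_limit:
  assumes d: "continuous_on UNIV d" and x0: "x0 \<in> C 0"
  obtains x \<Lambda> X where "\<And>s t. norm (x s - x t) \<le> \<Lambda> * \<bar>s - t\<bar>" "x 0 = x0" "\<And>t. t \<in> {0..T} \<Longrightarrow> x t \<in> C t"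
    "0 \<le> \<Lambda>" "\<And>N. 0 < N \<Longrightarrow> catching_up d N (X N)"
    "\<And>N i j. 0 < N \<Longrightarrow> i \<le> N \<Longrightarrow> j \<le> N \<Longrightarrow> norm (X N i - X N j) \<le> \<Lambda> * \<bar>T / N * i - T / N * j\<bar>"
    "\<And>N j. 0 < N \<Longrightarrow> j \<le> N \<Longrightarrow> X N j \<in> C (T / N * j)"
    "\<And>A e m. finite A \<Longrightarrow> A \<subseteq> {0..T} \<Longrightarrow> 0 < e \<Longrightarrow>
      \<exists>N\<ge>m. 0 < N \<and> (\<forall>t\<in>A. norm (X N (grid_index N t) - x t) < e)"
proof -
  obtain R where R: "R > 0" "\<And>t. t \<in> {0..T} \<Longrightarrow> C t \<subseteq> cball 0 R"
    using values_bounded by blast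
  have "compact (d ` (cball 0 R \<times> {0..T}))"
    by (intro compact_continuous_image continuous_on_subset[OF d] compact_Times) auto
  from compact_imp_bounded[OF this]
  obtain M where M: "M > 0" "\<forall>u\<in>d ` (cball 0 R \<times> {0..T}). norm u \<le> M"
    unfolding bounded_pos by blast
  have M': "norm (d (y, t)) \<le> M" if "t \<in> {0..T}" "y \<in> C t" for t y
  proof -
    have "(y, t) \<in> cball 0 R \<times> {0..T}"
      using R(2)[OF that(1)] that by blast
    then show ?thesis
      using M(2) by blast
  qed
  have "\<forall>N\<in>{0<..}. \<exists>X. X 0 = x0 \<and> catching_up d N X"
    using catching_up_exists by simp
  from bchoice[OF this] obtain X where "\<forall>N\<in>{0<..}. X N 0 = x0 \<and> catching_up d N (X N)" ..
  then have X: "X N 0 = x0 \<and> catching_up d N (X N)" if "0 < N" for N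
    using that by simp
  have X0: "X N 0 \<in> C 0" if "0 < N" for N
    using X[OF that] x0 by simp
  define \<Lambda> where "\<Lambda> = L + 2 * M"
  have \<Lambda>: "0 \<le> \<Lambda>"
    using L_nonneg M(1) by (simp add: \<Lambda>_def)
  have X_lip: "norm (X N i - X N j) \<le> \<Lambda> * \<bar>T / N * i - T / N * j\<bar>" if "0 < N" "i \<le> N" "j \<le> N" for N i j
    unfolding \<Lambda>_def using X[OF that(1)] X0[OF that(1)] M' that by (intro catching_up_lipschitz) auto
  have X_mem: "X N j \<in> C (T / N * j)" if "0 < N" "j \<le> N" for N j
    using catching_up_step(1)[of d N "X N" M j] X[OF that(1)] X0[OF that(1)] M' that by auto
  \<comment> \<open>Clamping times to \<open>{0..T}\<close> makes the limit Lipschitz on the whole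
    line, the form in which almost everywhere differentiability is available.\<close>
  define clamp where "clamp t = max 0 (min T t)" for t
  have clamp: "clamp t \<in> {0..T}" "t \<in> {0..T} \<Longrightarrow> clamp t = t" for t
    using T_pos by (auto simp: clamp_def)
  have clamp_lip: "\<bar>clamp s - clamp t\<bar> \<le> \<bar>s - t\<bar>" for s t
    by (auto simp: clamp_def)
  \<comment> \<open>\<open>Suc n\<close> keeps the number of grid cells positive. Each
    \<open>F n\<close> is a step function, Lipschitz only up to an error of one mesh width, which
    vanishes in the limit.\<close>
  define F where "F n t = X (Suc n) (grid_index (Suc n) (clamp t))" for n t
  have "F n t \<in> cball 0 R" for n t
    using X_mem[of "Suc n" "grid_index (Suc n) (clamp t)"] grid_index(3)[of "Suc n" "clamp t"] clamp(1)[of t]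
      R(2)[OF grid_mem[of "grid_index (Suc n) (clamp t)" "Suc n"]] by (auto simp: F_def)
  then obtain x where x: "\<And>A e m. finite A \<Longrightarrow> 0 < e \<Longrightarrow> \<exists>n\<ge>m. \<forall>t\<in>A. dist (F n t) (x t) < e"
    using cluster_function_exists[OF compact_cball, of F 0 R] by blast
  have small_step: "\<exists>m. \<forall>n\<ge>m. T / Suc n < e" if "e > 0" for e
  proof -
    have "(\<lambda>n. T * (1 / real (Suc n))) \<longlonglongrightarrow> T * 0"
      by (intro tendsto_mult tendsto_const) (use LIMSEQ_inverse_real_of_nat in \<open>simp add: inverse_eq_divide\<close>)
    then have "\<forall>\<^sub>F n in sequentially. T * (1 / real (Suc n)) < e"
      using that by (intro order_tendstoD(2)) auto
    then show ?thesis
      by (simp add: eventually_sequentially)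
  qed
  have x_lip: "norm (x s - x t) \<le> \<Lambda> * \<bar>s - t\<bar>" for s t
  proof (rule field_le_epsilon)
    fix e :: real assume "e > 0"
    then have e: "e / (4 * (\<Lambda> + 1)) > 0" "e / 4 > 0"
      using \<Lambda> by auto
    obtain m where m: "\<And>n. n \<ge> m \<Longrightarrow> T / Suc n < e / (4 * (\<Lambda> + 1))"
      using small_step[OF e(1)] by blast
    obtain n where n: "n \<ge> m" "dist (F n s) (x s) < e / 4" "dist (F n t) (x t) < e / 4"
      using x[of "{s, t}" "e / 4" m] e(2) by auto
    define h where "h = T / Suc n"
    have h: "h > 0" "\<Lambda> * h \<le> e / 4"
    proof -
      show "h > 0" using T_pos by (simp add: h_def)
      then have "\<Lambda> * h \<le> (\<Lambda> + 1) * h" by simp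
      also have "\<dots> \<le> (\<Lambda> + 1) * (e / (4 * (\<Lambda> + 1)))"
        using m[OF n(1)] \<Lambda> unfolding h_def by (intro mult_left_mono) auto
      also have "\<dots> = e / 4" using \<Lambda> by (simp add: field_simps)
      finally show "\<Lambda> * h \<le> e / 4" .
    qed
    have "norm (F n s - F n t) \<le> \<Lambda> * \<bar>h * grid_index (Suc n) (clamp s) - h * grid_index (Suc n) (clamp t)\<bar>"
      unfolding F_def h_def using grid_index(3) clamp(1) by (intro X_lip) auto
    also have "\<dots> \<le> \<Lambda> * (\<bar>s - t\<bar> + h)"
    proof (rule mult_left_mono[OF _ \<Lambda>])
      show "\<bar>h * grid_index (Suc n) (clamp s) - h * grid_index (Suc n) (clamp t)\<bar> \<le> \<bar>s - t\<bar> + h"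
        using grid_index(1,2)[of "Suc n" "clamp s"] grid_index(1,2)[of "Suc n" "clamp t"]
          clamp(1)[of s] clamp(1)[of t] clamp_lip[of s t] unfolding h_def by linarith
    qed
    finally have "norm (F n s - F n t) \<le> \<Lambda> * \<bar>s - t\<bar> + e / 4"
      using h(2) by (simp add: distrib_left)
    moreover have "norm (x s - x t) \<le> dist (F n s) (x s) + norm (F n s - F n t) + dist (F n t) (x t)"
    proof -
      have "dist (x s) (x t) \<le> dist (x s) (F n s) + (dist (F n s) (F n t) + dist (F n t) (x t))"
        using dist_triangle[of "x s" "x t" "F n s"] dist_triangle[of "F n s" "x t" "F n t"] by linarith
      then show ?thesis
        by (simp add: dist_norm norm_minus_commute)
    qed
    ultimately show "norm (x s - x t) \<le> \<Lambda> * \<bar>s - t\<bar> + e"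
      using n(2,3) \<open>e > 0\<close> by linarith
  qed
  have x_init: "x 0 = x0"
  proof -
    have "dist x0 (x 0) < e" if "e > 0" for e
    proof -
      obtain n where "dist (F n 0) (x 0) < e"
        using x[of "{0}" e 0] \<open>e > 0\<close> by auto
      moreover have "F n 0 = x0"
        using X[of "Suc n"] clamp(2)[of 0] T_pos by (simp add: F_def grid_index_def)
      ultimately show ?thesis by simp
    qed
    from this[of "dist x0 (x 0)"] show ?thesis by force
  qed
  have x_mem: "x t \<in> C t" if t: "t \<in> {0..T}" for t
  proof -
    have "x t \<in> closure (C t)"
      unfolding closure_approachable
    proof (intro allI impI)
      fix e :: real assume "e > 0"
      then have e: "e / (2 * (L + 1)) > 0" "e / 2 > 0"
        using L_nonneg by auto
      obtain m where m: "\<And>n. n \<ge> m \<Longrightarrow> T / Suc n < e / (2 * (L + 1))"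
        using small_step[OF e(1)] by blast
      obtain n where n: "n \<ge> m" "dist (F n t) (x t) < e / 2"
        using x[of "{t}" "e / 2" m] e(2) by auto
      define h where "h = T / Suc n"
      define s where "s = h * grid_index (Suc n) t"
      have s: "s \<le> t" "t < s + h" "s \<in> {0..T}" "F n t \<in> C s"
        using grid_index[of "Suc n" t] t grid_mem[of "grid_index (Suc n) t" "Suc n"]
          X_mem[of "Suc n" "grid_index (Suc n) t"] clamp(2)[OF t] by (auto simp: s_def h_def F_def)
      obtain z where z: "z \<in> C t" "dist (F n t) z \<le> L * \<bar>s - t\<bar>"
        using lipschitz_values[OF s(3) t s(4)] by blast
      have "L * \<bar>s - t\<bar> \<le> (L + 1) * h"
        using s L_nonneg by (intro mult_mono) auto
      also have "\<dots> < (L + 1) * (e / (2 * (L + 1)))"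
        using m[OF n(1)] L_nonneg unfolding h_def by (intro mult_strict_left_mono) auto
      also have "\<dots> = e / 2" using L_nonneg by (simp add: field_simps)
      finally have "dist (F n t) z < e / 2"
        using z(2) by simp
      then have "dist z (x t) < e"
        using n(2) dist_triangle_half_r[of "F n t" z e "x t"] by simp
      with z(1) show "\<exists>y\<in>C t. dist y (x t) < e" by blast
    qed
    then show ?thesis
      using compact_imp_closed[OF compact_values[OF t]] by simp
  qed
  have x_cluster: "\<exists>N\<ge>m. 0 < N \<and> (\<forall>t\<in>A. norm (X N (grid_index N t) - x t) < e)"
    if A: "finite A" "A \<subseteq> {0..T}" "0 < e" for A e m
  proof -
    obtain n where n: "n \<ge> m" "\<And>t. t \<in> A \<Longrightarrow> dist (F n t) (x t) < e"
      using x[OF A(1,3), of m] by blast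
    have "norm (X (Suc n) (grid_index (Suc n) t) - x t) < e" if "t \<in> A" for t
      using n(2)[OF that] clamp(2)[of t] A(2) that by (auto simp: F_def dist_norm)
    then show ?thesis
      using n(1) by (intro exI[of _ "Suc n"]) auto
  qed
  show ?thesis
    by (rule that[OF x_lip x_init x_mem \<Lambda> X[THEN conjunct2] X_lip X_mem x_cluster])
qed

end

section \<open>Existence of solutions\<close>

lemma dist_Pair_le: "dist (a, b) (c, d) \<le> dist a c + dist b d"
  unfolding dist_Pair_Pair by (rule sqrt_sum_squares_le_sum) simp_all

context definable_lipschitz_map
begin

text \<open>
  The velocity defects of the scheme near \<open>t\<close> have norm at most \<open>norm \<zeta> + a\<close> because of the
  tangency hypothesis, while their average is close to \<open>\<zeta> = d (x t, t) - x' t\<close>. In an inner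
  product space this forces one of them to be close to \<open>\<zeta>\<close>: no convexity of the normal cone
  is needed.
\<close>

lemma proximal_normals_approximate_defect:
  assumes d: "continuous_on UNIV d" and \<Lambda>: "0 \<le> \<Lambda>"
    and scheme: "\<And>N. 0 < N \<Longrightarrow> catching_up d N (X N)"
    and X_lip: "\<And>N i j. 0 < N \<Longrightarrow> i \<le> N \<Longrightarrow> j \<le> N \<Longrightarrow> norm (X N i - X N j) \<le> \<Lambda> * \<bar>T / N * i - T / N * j\<bar>"
    and X_mem: "\<And>N j. 0 < N \<Longrightarrow> j \<le> N \<Longrightarrow> X N j \<in> C (T / N * j)"
    and cluster: "\<And>A e m. finite A \<Longrightarrow> A \<subseteq> {0..T} \<Longrightarrow> 0 < e \<Longrightarrow>
      \<exists>N\<ge>m. 0 < N \<and> (\<forall>t\<in>A. norm (X N (grid_index N t) - x t) < e)"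
    and t: "0 < t" "t < T" and v: "(x has_vector_derivative v) (at t)"
    and tangent: "\<And>\<epsilon>. 0 < \<epsilon> \<Longrightarrow> \<exists>\<eta>>0. \<forall>s y h. Gr s y \<longrightarrow> \<bar>s - t\<bar> < \<eta> \<longrightarrow> norm (y - x t) < \<eta> \<longrightarrow>
      0 < h \<longrightarrow> h < \<eta> \<longrightarrow> s + h \<le> T \<longrightarrow> (\<exists>z. Gr (s + h) z \<and> norm (z - y - h *\<^sub>R v) \<le> \<epsilon> * h)"
    and "0 < \<kappa>"
  shows "\<exists>s y \<zeta>. \<bar>s - t\<bar> < \<kappa> \<and> norm (y - x t) < \<kappa> \<and> norm (\<zeta> - (d (x t, t) - v)) < \<kappa> \<and>
    Gr s y \<and> \<zeta> \<in> proximal_normals (C s) y"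
proof -
  define z where "z = d (x t, t) - v"
  \<comment> \<open>Chosen so that the mean bound \<open>a * (4 * norm z + a)\<close> lies below the
    square of \<open>\<kappa>\<close>; the 2 in the denominator exceeds \<open>a\<close> and is
    positive even for \<open>z = 0\<close>.\<close>
  define a where "a = min 1 (\<kappa>\<^sup>2 / (4 * norm z + 2))"
  have c: "0 < 4 * norm z + 2"
    using norm_ge_zero[of z] by linarith
  have a: "0 < a" "a \<le> 1"
    using c \<open>0 < \<kappa>\<close> by (auto simp: a_def)
  have a_small: "a * (4 * norm z + a) < \<kappa>\<^sup>2"
  proof -
    have "a * (4 * norm z + a) < a * (4 * norm z + 2)"
      using a by (intro mult_strict_left_mono) auto
    also have "\<dots> \<le> \<kappa>\<^sup>2 / (4 * norm z + 2) * (4 * norm z + 2)"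
      using c by (intro mult_right_mono) (auto simp: a_def)
    also have "\<dots> = \<kappa>\<^sup>2"
      using c by simp
    finally show ?thesis .
  qed
  \<comment> \<open>The average has error \<open>\<epsilon>\<close> from the variation of
    \<open>d\<close> and \<open>8 * \<epsilon>\<close> from the displacement: four errors of
    \<open>\<epsilon> * \<theta>\<close>, over a duration of at least
    \<open>\<theta> / 2\<close>.\<close>
  define \<epsilon> where "\<epsilon> = a / 9"
  have \<epsilon>: "0 < \<epsilon>" "\<epsilon> \<le> 1" "9 * \<epsilon> = a"
    using a by (auto simp: \<epsilon>_def)
  obtain \<eta>1 where \<eta>1: "0 < \<eta>1" "\<And>s y h. Gr s y \<Longrightarrow> \<bar>s - t\<bar> < \<eta>1 \<Longrightarrow> norm (y - x t) < \<eta>1 \<Longrightarrow>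
      0 < h \<Longrightarrow> h < \<eta>1 \<Longrightarrow> s + h \<le> T \<Longrightarrow> \<exists>z. Gr (s + h) z \<and> norm (z - y - h *\<^sub>R v) \<le> \<epsilon> * h"
    using tangent[OF \<epsilon>(1)] by blast
  obtain \<eta>2 where \<eta>2: "0 < \<eta>2" "\<And>p. dist p (x t, t) < \<eta>2 \<Longrightarrow> dist (d p) (d (x t, t)) < \<epsilon>"
    using d \<epsilon>(1) unfolding continuous_on_iff by (metis UNIV_I)
  have "\<forall>e>0. \<exists>r>0. \<forall>s. norm (s - t) < r \<longrightarrow> norm (x s - x t - (s - t) *\<^sub>R v) \<le> e * norm (s - t)"
    using v unfolding has_vector_derivative_def has_derivative_within_alt by simp
  then obtain \<eta>3 where \<eta>3: "0 < \<eta>3"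
    "\<And>s. norm (s - t) < \<eta>3 \<Longrightarrow> norm (x s - x t - (s - t) *\<^sub>R v) \<le> \<epsilon> * norm (s - t)"
    using \<epsilon>(1) by blast
  define m where "m = Min {\<eta>1, \<eta>2 / 2, \<eta>3, T - t, \<kappa>}"
  have m: "0 < m" "m \<le> \<eta>1" "m \<le> \<eta>2 / 2" "m \<le> \<eta>3" "m \<le> T - t" "m \<le> \<kappa>"
  proof -
    show "0 < m"
      using \<eta>1(1) \<eta>2(1) \<eta>3(1) t \<open>0 < \<kappa>\<close> by (simp add: m_def)
  qed (unfold m_def, (rule Min_le; simp)+)
  \<comment> \<open>The nodes used span at most \<open>2 * \<theta>\<close> in time, so the scheme
    moves by at most \<open>2 * (\<Lambda> * \<theta>)\<close> on them. The remaining
    \<open>4 * \<theta>\<close> absorb the distance to \<open>x t\<close> and the mesh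
    width.\<close>
  define \<theta> where "\<theta> = m / (2 * (\<Lambda> + 2))"
  have \<theta>: "0 < \<theta>" "2 * (\<Lambda> * \<theta>) + 4 * \<theta> = m" "0 \<le> \<Lambda> * \<theta>"
  proof -
    show "0 < \<theta>"
      using m(1) \<Lambda> by (simp add: \<theta>_def)
    then show "0 \<le> \<Lambda> * \<theta>"
      using \<Lambda> by simp
    have "2 * (\<Lambda> + 2) * \<theta> = m"
      unfolding \<theta>_def using \<Lambda> by (subst times_divide_eq_right, subst nonzero_mult_div_cancel_left) auto
    then show "2 * (\<Lambda> * \<theta>) + 4 * \<theta> = m"
      by (simp add: algebra_simps)
  qed
  \<comment> \<open>Rounding to nodes changes the duration by at most one mesh width; the resulting
    displacement along \<open>v\<close> must stay below \<open>\<epsilon> * \<theta>\<close>, also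
    when \<open>v\<close> is 0.\<close>
  define h0 where "h0 = min (\<theta> / 2) (\<epsilon> * \<theta> / (norm v + 1))"
  have nv: "0 < norm v + 1"
    using norm_ge_zero[of v] by linarith
  have h0: "0 < h0"
    using \<theta>(1) \<epsilon>(1) nv by (simp add: h0_def)
  obtain n0 :: nat where n0: "T / h0 < n0"
    using reals_Archimedean2 by blast
  have "{t, t + \<theta>} \<subseteq> {0..T}" "0 < \<epsilon> * \<theta>"
    using t \<theta> m \<epsilon> by auto
  then obtain N where N: "n0 \<le> N" "0 < N"
    and near: "norm (X N (grid_index N t) - x t) < \<epsilon> * \<theta>"
      "norm (X N (grid_index N (t + \<theta>)) - x (t + \<theta>)) < \<epsilon> * \<theta>"
    using cluster[of "{t, t + \<theta>}" "\<epsilon> * \<theta>" n0] by auto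
  define h where "h = T / N"
  have h: "0 < h" "h < h0"
  proof -
    show "0 < h" using T_pos N by (simp add: h_def)
    have "T / h0 < N" using n0 N(1) by linarith
    then show "h < h0" using h0 N(2) by (simp add: h_def field_simps)
  qed
  have h\<theta>: "h < \<theta> / 2" using h by (simp add: h0_def)
  have hv: "h * norm v \<le> \<epsilon> * \<theta>"
  proof -
    have "h * norm v \<le> h * (norm v + 1)" using h by simp
    also have "\<dots> \<le> \<epsilon> * \<theta> / (norm v + 1) * (norm v + 1)"
      using h nv by (intro mult_right_mono) (auto simp: h0_def)
    also have "\<dots> = \<epsilon> * \<theta>" using nv by simp
    finally show ?thesis .
  qed
  define p where "p = grid_index N t"
  define q where "q = grid_index N (t + \<theta>)"
  have p: "h * p \<le> t" "t < h * p + h" "p \<le> N"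
    using grid_index[OF N(2), of t] t by (auto simp: p_def h_def)
  have q: "h * q \<le> t + \<theta>" "t + \<theta> < h * q + h" "q \<le> N"
    using grid_index[OF N(2), of "t + \<theta>"] t \<theta> m by (auto simp: q_def h_def)
  have "h * p < h * q"
    using p q h\<theta> \<theta>(1) by linarith
  then have pq: "p < q"
    using h(1) by simp
  define J where "J = {p..<q}"
  have J: "finite J" "J \<noteq> {}" "card J = q - p"
    using pq by (auto simp: J_def)
  define k where "k = real (q - p)"
  have k: "h * k = h * q - h * p"
    using pq by (simp add: k_def of_nat_diff right_diff_distrib)
  have k\<theta>: "\<bar>\<theta> - h * k\<bar> \<le> h" "\<theta> \<le> 2 * (h * k)"
    using k p q h\<theta> by linarith+
  define Y where "Y = X N"
  have pos: "\<bar>h * i - t\<bar> < m" "norm (Y i - x t) < m" "Gr (h * i) (Y i)" if "p \<le> i" "i \<le> q" for i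
  proof -
    have i: "h * p \<le> h * i" "h * i \<le> h * q" "i \<le> N"
      using that h(1) q(3) by auto
    then show "\<bar>h * i - t\<bar> < m"
      using p q h\<theta> \<theta> by linarith
    have "norm (Y i - Y p) \<le> \<Lambda> * \<bar>h * i - h * p\<bar>"
      unfolding Y_def h_def using i(3) p(3) N(2) by (intro X_lip) auto
    also have "\<dots> \<le> \<Lambda> * (2 * \<theta>)"
      using i p q h\<theta> \<Lambda> by (intro mult_left_mono) linarith+
    finally have "norm (Y i - Y p) \<le> 2 * (\<Lambda> * \<theta>)"
      by simp
    moreover have "\<epsilon> * \<theta> \<le> \<theta>"
      using \<epsilon> \<theta>(1) by (simp add: mult_left_le_one_le)
    moreover have "norm (Y i - x t) \<le> norm (Y i - Y p) + norm (Y p - x t)"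
      using norm_triangle_ineq[of "Y i - Y p" "Y p - x t"] by simp
    ultimately show "norm (Y i - x t) < m"
      using near(1) \<theta> unfolding Y_def p_def[symmetric] by linarith
    show "Gr (h * i) (Y i)"
      using X_mem[OF N(2) i(3)] grid_mem[OF i(3) N(2)] by (simp add: Gr_def Y_def h_def)
  qed
  define D where "D j = d (Y j, h * j)" for j :: nat
  define \<zeta> where "\<zeta> j = (1 / h) *\<^sub>R (Y j + h *\<^sub>R D j - Y (Suc j))" for j
  have proj: "Y (Suc j) \<in> metric_projection (C (h * Suc j)) (Y j + h *\<^sub>R D j)" if "j \<in> J" for j
    using scheme[OF N(2)] that q(3) unfolding catching_up_def Y_def D_def h_def J_def by auto
  have D: "norm (D j - d (x t, t)) \<le> \<epsilon>" if "j \<in> J" for j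
  proof -
    have "\<bar>h * j - t\<bar> < \<eta>2 / 2" "norm (Y j - x t) < \<eta>2 / 2"
      using pos[of j] that m(3) by (auto simp: J_def)
    then have "dist (Y j, h * j) (x t, t) < \<eta>2"
      using dist_Pair_le[of "Y j" "h * j" "x t" t] unfolding dist_norm[of "Y j"] dist_real_def by simp
    then show ?thesis
      using \<eta>2(2) unfolding D_def dist_norm by (meson less_imp_le)
  qed
  have bound: "norm (\<zeta> j) \<le> norm z + a" if j: "j \<in> J" for j
  proof -
    have pj: "p \<le> j" "j \<le> q" "Suc j \<le> N"
      using j q(3) by (auto simp: J_def)
    have hj: "h * j + h = h * Suc j"
      by (simp add: algebra_simps)
    have "h * Suc j \<in> {0..T}"
      unfolding h_def using pj(3) N(2) by (rule grid_mem)
    then have "h * j + h \<le> T"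
      using hj by simp
    moreover have "h < \<eta>1" "\<bar>h * j - t\<bar> < \<eta>1" "norm (Y j - x t) < \<eta>1"
      using pos[OF pj(1,2)] m(2) h\<theta> \<theta> by linarith+
    ultimately obtain b where b: "Gr (h * Suc j) b" "norm (b - Y j - h *\<^sub>R v) \<le> \<epsilon> * h"
      using \<eta>1(2)[of "h * j" "Y j" h] pos(3)[OF pj(1,2)] h(1) hj by auto
    \<comment> \<open>The next node is a nearest point of the predicted one, and the almost tangent
      point \<open>b\<close> is a competitor.\<close>
    have "norm (Y j + h *\<^sub>R D j - Y (Suc j)) \<le> norm (Y j + h *\<^sub>R D j - b)"
      using proj[OF j] b(1) unfolding metric_projection_def Gr_def dist_norm by blast
    also have "Y j + h *\<^sub>R D j - b = h *\<^sub>R (D j - v) - (b - Y j - h *\<^sub>R v)"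
      by (simp add: algebra_simps)
    also have "norm \<dots> \<le> norm (h *\<^sub>R (D j - v)) + norm (b - Y j - h *\<^sub>R v)"
      by (rule norm_triangle_ineq4)
    also have "\<dots> \<le> h * norm (D j - v) + \<epsilon> * h"
      using b(2) h(1) by simp
    also have "norm (D j - v) \<le> \<epsilon> + norm z"
      using D[OF j] norm_triangle_ineq[of "D j - d (x t, t)" z] by (simp add: z_def)
    also have "h * (\<epsilon> + norm z) + \<epsilon> * h = h * (norm z + 2 * \<epsilon>)"
      by (simp add: algebra_simps)
    finally have "norm (Y j + h *\<^sub>R D j - Y (Suc j)) \<le> h * (norm z + 2 * \<epsilon>)"
      using h(1) by simp
    moreover have "norm (\<zeta> j) = norm (Y j + h *\<^sub>R D j - Y (Suc j)) / h"
      unfolding \<zeta>_def norm_scaleR using h(1) by simp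
    ultimately have "norm (\<zeta> j) \<le> norm z + 2 * \<epsilon>"
      using h(1) by (simp add: pos_divide_le_eq mult.commute)
    then show ?thesis
      using \<epsilon> by linarith
  qed
  have average: "norm (of_nat (card J) *\<^sub>R z - (\<Sum>j\<in>J. \<zeta> j)) \<le> a * card J"
  proof -
    have \<zeta>: "z - \<zeta> j = (d (x t, t) - D j) - v + (1 / h) *\<^sub>R (Y (Suc j) - Y j)" for j
      using h(1) by (simp add: z_def \<zeta>_def algebra_simps)
    have "of_nat (card J) *\<^sub>R z - (\<Sum>j\<in>J. \<zeta> j) = (\<Sum>j\<in>J. z - \<zeta> j)"
      by (simp add: sum_subtractf scaleR_conv_of_real sum_constant_scaleR)
    also have "\<dots> = (\<Sum>j\<in>J. d (x t, t) - D j) - k *\<^sub>R v + (1 / h) *\<^sub>R (\<Sum>j\<in>J. Y (Suc j) - Y j)"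
    proof -
      have "(\<Sum>j\<in>J. z - \<zeta> j) = (\<Sum>j\<in>J. (d (x t, t) - D j) - v) + (\<Sum>j\<in>J. (1 / h) *\<^sub>R (Y (Suc j) - Y j))"
        unfolding \<zeta> by (rule sum.distrib)
      also have "(\<Sum>j\<in>J. (d (x t, t) - D j) - v) = (\<Sum>j\<in>J. d (x t, t) - D j) - (\<Sum>j\<in>J. v)"
        by (rule sum_subtractf)
      also have "(\<Sum>j\<in>J. v) = k *\<^sub>R v"
        using J(3) by (simp add: sum_constant_scaleR k_def)
      also have "(\<Sum>j\<in>J. (1 / h) *\<^sub>R (Y (Suc j) - Y j)) = (1 / h) *\<^sub>R (\<Sum>j\<in>J. Y (Suc j) - Y j)"
        by (rule scaleR_sum_right[symmetric])
      finally show ?thesis .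
    qed
    \<comment> \<open>After telescoping only the two end nodes remain, and these are close to
      \<open>x t\<close> and \<open>x (t + \<theta>)\<close>.\<close>
    also have "(\<Sum>j\<in>J. Y (Suc j) - Y j) = Y q - Y p"
      unfolding J_def using pq by (intro sum_Suc_diff') auto
    also have "(\<Sum>j\<in>J. d (x t, t) - D j) - k *\<^sub>R v + (1 / h) *\<^sub>R (Y q - Y p) =
        (\<Sum>j\<in>J. d (x t, t) - D j) + (1 / h) *\<^sub>R (Y q - Y p - (h * k) *\<^sub>R v)"
      using h(1) by (simp add: algebra_simps)
    finally have eq: "of_nat (card J) *\<^sub>R z - (\<Sum>j\<in>J. \<zeta> j) =
        (\<Sum>j\<in>J. d (x t, t) - D j) + (1 / h) *\<^sub>R (Y q - Y p - (h * k) *\<^sub>R v)" .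
    have 1: "norm (\<Sum>j\<in>J. d (x t, t) - D j) \<le> k * \<epsilon>"
    proof -
      have "norm (\<Sum>j\<in>J. d (x t, t) - D j) \<le> (\<Sum>j\<in>J. \<epsilon>)"
        using D by (intro sum_norm_le) (simp add: norm_minus_commute)
      then show ?thesis
        using J(3) by (simp add: k_def)
    qed
    have "norm (x (t + \<theta>) - x t - \<theta> *\<^sub>R v) \<le> \<epsilon> * \<theta>"
      using \<eta>3(2)[of "t + \<theta>"] \<theta> m(4) by simp
    moreover have "norm ((\<theta> - h * k) *\<^sub>R v) \<le> \<epsilon> * \<theta>"
      using mult_right_mono[OF k\<theta>(1) norm_ge_zero[of v]] hv by simp
    moreover have "Y q - Y p - (h * k) *\<^sub>R v = (x (t + \<theta>) - x t - \<theta> *\<^sub>R v) + (\<theta> - h * k) *\<^sub>R v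
        + (Y q - x (t + \<theta>)) - (Y p - x t)"
      by (simp add: algebra_simps)
    then have "norm (Y q - Y p - (h * k) *\<^sub>R v) \<le> norm (x (t + \<theta>) - x t - \<theta> *\<^sub>R v) + norm ((\<theta> - h * k) *\<^sub>R v)
        + norm (Y q - x (t + \<theta>)) + norm (Y p - x t)"
    proof -
      have "norm (a + b + c - e) \<le> norm a + norm b + norm c + norm e" for a b c e :: 'a
        using norm_triangle_ineq4[of "a + b + c" e] norm_triangle_ineq[of "a + b" c]
          norm_triangle_ineq[of a b] by linarith
      then show ?thesis
        unfolding \<open>Y q - Y p - (h * k) *\<^sub>R v = _\<close> .
    qed
    ultimately have "norm (Y q - Y p - (h * k) *\<^sub>R v) \<le> 4 * (\<epsilon> * \<theta>)"
      using near unfolding Y_def p_def[symmetric] q_def[symmetric] by linarith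
    also have "\<dots> \<le> 4 * (\<epsilon> * (2 * (h * k)))"
      using k\<theta>(2) \<epsilon>(1) by (intro mult_left_mono) auto
    also have "\<dots> = 8 * \<epsilon> * k * h"
      by simp
    finally have 2: "norm ((1 / h) *\<^sub>R (Y q - Y p - (h * k) *\<^sub>R v)) \<le> 8 * \<epsilon> * k"
      unfolding norm_scaleR using h(1) by (simp add: pos_divide_le_eq)
    have "norm (of_nat (card J) *\<^sub>R z - (\<Sum>j\<in>J. \<zeta> j)) \<le> k * \<epsilon> + 8 * \<epsilon> * k"
      unfolding eq using 1 2 by (meson add_mono norm_triangle_ineq order_trans)
    also have "\<dots> = a * card J"
      using \<epsilon>(3) J(3) by (simp add: k_def algebra_simps flip: \<epsilon>(3))
    finally show ?thesis .
  qed
  obtain j where j: "j \<in> J" "(norm (\<zeta> j - z))\<^sup>2 \<le> a * (4 * norm z + a)"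
    using average_close_imp_some_close[OF J(1,2) less_imp_le[OF a(1)] bound average] by blast
  have "norm (\<zeta> j - z) < \<kappa>"
    using order_le_less_trans[OF j(2) a_small] less_imp_le[OF \<open>0 < \<kappa>\<close>] by (rule power2_less_imp_less)
  moreover have "p \<le> Suc j" "Suc j \<le> q"
    using j(1) by (auto simp: J_def)
  then have "\<bar>h * Suc j - t\<bar> < \<kappa>" "norm (Y (Suc j) - x t) < \<kappa>" "Gr (h * Suc j) (Y (Suc j))"
    using pos[of "Suc j"] m(6) by auto
  moreover have "\<zeta> j \<in> proximal_normals (C (h * Suc j)) (Y (Suc j))"
    unfolding \<zeta>_def using proj[OF j(1)] h(1) by (rule scaled_residual_proximal_normal)
  ultimately show ?thesis
    unfolding z_def by blast
qed

section \<open>Definability of proximal normals and conclusion\<close>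

text \<open>Rewrites the metric projection as polynomial inequalities quantified over the graph of
  \<open>C\<close>, so that the graph of the proximal normal cones is visibly definable.\<close>

lemma proximal_normals_iff:
  assumes "Gr t y"
  shows "\<zeta> \<in> proximal_normals (C t) y \<longleftrightarrow>
    (\<exists>s>0. \<forall>b. Gr t b \<longrightarrow> b = y \<or> (s *\<^sub>R \<zeta>) \<bullet> (s *\<^sub>R \<zeta>) < (y + s *\<^sub>R \<zeta> - b) \<bullet> (y + s *\<^sub>R \<zeta> - b))"
proof -
  have y: "y \<in> C t" and b: "Gr t b \<longleftrightarrow> b \<in> C t" for b
    using assms by (auto simp: Gr_def)
  have "metric_projection (C t) (y + s *\<^sub>R \<zeta>) = {y} \<longleftrightarrow>
      (\<forall>b\<in>C t. b = y \<or> norm (s *\<^sub>R \<zeta>) < norm (y + s *\<^sub>R \<zeta> - b))" (is "?l \<longleftrightarrow> ?r") for s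
  proof
    assume l: ?l
    have min: "dist (y + s *\<^sub>R \<zeta>) y \<le> dist (y + s *\<^sub>R \<zeta>) b" if "b \<in> C t" for b
      using l that by (auto simp: metric_projection_def)
    show ?r
    proof (intro ballI, rule ccontr)
      fix b assume b: "b \<in> C t" "\<not> (b = y \<or> norm (s *\<^sub>R \<zeta>) < norm (y + s *\<^sub>R \<zeta> - b))"
      then have "dist (y + s *\<^sub>R \<zeta>) b \<le> dist (y + s *\<^sub>R \<zeta>) y"
        by (simp add: dist_norm not_less)
      then have "b \<in> metric_projection (C t) (y + s *\<^sub>R \<zeta>)"
        using b(1) min by (force simp: metric_projection_def)
      with l b(2) show False by simp
    qed
  next
    assume r: ?r
    have "dist (y + s *\<^sub>R \<zeta>) y < dist (y + s *\<^sub>R \<zeta>) b" if "b \<in> C t" "b \<noteq> y" for b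
      using r that by (auto simp: dist_norm)
    with y show ?l
      by (force simp: metric_projection_def)
  qed
  then show ?thesis
    unfolding proximal_normals_def by (simp only: mem_Collect_eq norm_lt b Ball_def)
qed

theorem sweeping_solution_exists:
  assumes d: "continuous_on UNIV d" and x0: "x0 \<in> C 0"
  shows "\<exists>x. sweeping_solution T C d x0 x"
proof (rule catching_up_limit[OF d x0])
  fix x \<Lambda> X
  assume x_lip: "\<And>s t. norm (x s - x t) \<le> \<Lambda> * \<bar>s - t\<bar>" and x_init: "x 0 = x0"
    and x_mem: "\<And>t. t \<in> {0..T} \<Longrightarrow> x t \<in> C t"
    and \<Lambda>: "0 \<le> \<Lambda>"
    and scheme: "\<And>N. 0 < N \<Longrightarrow> catching_up d N (X N)"
    and X_lip: "\<And>N i j. 0 < N \<Longrightarrow> i \<le> N \<Longrightarrow> j \<le> N \<Longrightarrow> norm (X N i - X N j) \<le> \<Lambda> * \<bar>T / N * i - T / N * j\<bar>"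
    and X_mem: "\<And>N j. 0 < N \<Longrightarrow> j \<le> N \<Longrightarrow> X N j \<in> C (T / N * j)"
    and cluster: "\<And>A e m. finite A \<Longrightarrow> A \<subseteq> {0..T} \<Longrightarrow> 0 < e \<Longrightarrow>
      \<exists>N\<ge>m. 0 < N \<and> (\<forall>t\<in>A. norm (X N (grid_index N t) - x t) < e)"
  obtain W :: "'a set" where W: "countable W" "\<And>U. open U \<Longrightarrow> U \<noteq> {} \<Longrightarrow> \<exists>w\<in>W. w \<in> U"
    using countable_dense_exists by blast
  \<comment> \<open>One countable set for each \<open>w\<close> and \<epsilon>; their union over a
    dense set of vectors and the positive rationals is still countable and serves all
    derivatives.\<close>
  define E where "E w \<epsilon> = {t. 0 < t \<and> t < T \<and>
    (\<exists>v. (x has_vector_derivative v) (at t) \<and> norm (v - w) \<le> \<epsilon> / 2) \<and>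
    (t, x t, 0) \<in> closure {z. escaping \<epsilon> w (fst z) (snd z) \<and> 0 < snd (snd z)}}" for w \<epsilon>
  have "countable (E w \<epsilon>)" if "0 < \<epsilon>" for w \<epsilon>
    unfolding E_def using that by (rule countable_escaping_times)
  then have E: "countable (\<Union>w\<in>W. \<Union>\<epsilon>\<in>\<rat> \<inter> {0<..}. E w \<epsilon>)" (is "countable ?E")
    using W(1) countable_rat by (intro countable_UN countable_Int1) auto
  define PN where "PN u \<longleftrightarrow> Gr (fst u) (fst (snd u)) \<and>
    (\<exists>s. 0 < s \<and> (\<forall>b. Gr (fst u) b \<longrightarrow> b = fst (snd u) \<or>
      (s *\<^sub>R snd (snd u)) \<bullet> (s *\<^sub>R snd (snd u)) <
      (fst (snd u) + s *\<^sub>R snd (snd u) - b) \<bullet> (fst (snd u) + s *\<^sub>R snd (snd u) - b)))" for u :: "real \<times> 'a \<times> 'a"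
  have PN: "PN (t, y, \<zeta>) \<longleftrightarrow> Gr t y \<and> \<zeta> \<in> proximal_normals (C t) y" for t y \<zeta>
    unfolding PN_def fst_conv snd_conv using proximal_normals_iff[of t y \<zeta>] by blast
  have "definable PN"
    unfolding PN_def by (intro definable_logic definable_Gr polynomial_function_intros)
  define F where "F = {t. \<exists>p. (t, p) \<in> closure {z. PN z} \<and> p \<notin> closure {q. PN (t, q)}}"
  have "countable F"
    unfolding F_def using \<open>definable PN\<close> by (rule countable_closure_fiber_defect)
  define nondiff where "nondiff = {t. \<not> (\<exists>v. (x has_vector_derivative v) (at t))}"
  have "negligible nondiff"
    unfolding nondiff_def using x_lip by (rule negligible_nondifferentiable_lipschitz)
  \<comment> \<open>The endpoints are discarded as well, because tangency is obtained at interior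
    times.\<close>
  have "negligible (\<Union>t\<in>?E \<union> F \<union> {0, T}. {t})"
    using E \<open>countable F\<close> by (intro negligible_countable_Union countable_image countable_Un) auto
  with \<open>negligible nondiff\<close> have "negligible (nondiff \<union> (?E \<union> F \<union> {0, T}))"
    by (simp only: UN_singleton) (rule negligible_Un)
  then have ae: "AE t in lebesgue. t \<notin> nondiff \<union> (?E \<union> F \<union> {0, T})"
    by (intro AE_not_in) (simp add: negligible_iff_null_sets)
  have good: "\<exists>v. (x has_vector_derivative v) (at t within {0..T}) \<and>
      v \<in> {d (x t, t) - \<zeta> | \<zeta>. \<zeta> \<in> limiting_normals (C t) (x t)}"
    if t: "t \<in> {0..T}" and nB: "t \<notin> nondiff \<union> (?E \<union> F \<union> {0, T})" for t
  proof -
    have "t \<noteq> 0" "t \<noteq> T" and tF: "t \<notin> F" and tE: "t \<notin> ?E" and tD: "t \<notin> nondiff"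
      using nB by simp_all
    then have t0: "0 < t" "t < T"
      using t by simp_all
    obtain v where v: "(x has_vector_derivative v) (at t)"
      using tD unfolding nondiff_def by blast
    have notE: "t \<notin> E w \<epsilon>" if "w \<in> W" "\<epsilon> \<in> \<rat>" "0 < \<epsilon>" for w \<epsilon>
      using tE that by blast
    have tangent: "\<exists>\<eta>>0. \<forall>s y h. Gr s y \<longrightarrow> \<bar>s - t\<bar> < \<eta> \<longrightarrow> norm (y - x t) < \<eta> \<longrightarrow>
      0 < h \<longrightarrow> h < \<eta> \<longrightarrow> s + h \<le> T \<longrightarrow> (\<exists>z. Gr (s + h) z \<and> norm (z - y - h *\<^sub>R v) \<le> \<epsilon> * h)"
      if \<epsilon>: "0 < \<epsilon>" for \<epsilon>
    proof (rule ccontr)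
      assume neg: "\<not> ?thesis"
      \<comment> \<open>A miss of more than \<open>\<epsilon> * h\<close>, hence of
        \<open>2 * r * h\<close>, along \<open>v\<close> is a miss of at least \<open>r * h\<close>
        along any \<open>w\<close> with \<open>norm (v - w) \<le> r / 2\<close>. This trades
        \<open>v\<close> for a member of the countable family.\<close>
      obtain r where r: "r \<in> \<rat>" "0 < r" "r < \<epsilon> / 2"
        using Rats_dense_in_real[of 0 "\<epsilon> / 2"] \<epsilon> by auto
      obtain w where w: "w \<in> W" "w \<in> ball v (r / 2)"
        using W(2)[of "ball v (r / 2)"] r(2) by auto
      have wv: "norm (v - w) \<le> r / 2"
        using w(2) by (simp add: dist_norm)
      have "(t, x t, 0) \<in> closure {z. escaping r w (fst z) (snd z) \<and> 0 < snd (snd z)}"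
        unfolding closure_approachable
      proof (intro allI impI)
        fix e :: real assume "0 < e"
        then have "0 < e / 3" by simp
        then obtain s y h where g: "Gr s y" "\<bar>s - t\<bar> < e / 3" "norm (y - x t) < e / 3" "0 < h" "h < e / 3" "s + h \<le> T"
          and far: "\<And>z. Gr (s + h) z \<Longrightarrow> \<epsilon> * h < norm (z - y - h *\<^sub>R v)"
          using neg by (meson not_le)
        have "r * h \<le> norm (z - y - h *\<^sub>R w)" if "Gr (s + h) z" for z
        proof -
          have "norm (z - y - h *\<^sub>R v) \<le> norm (z - y - h *\<^sub>R w) + norm (h *\<^sub>R (v - w))"
            using norm_triangle_ineq4[of "z - y - h *\<^sub>R w" "h *\<^sub>R (v - w)"] by (simp add: algebra_simps)
          also have "norm (h *\<^sub>R (v - w)) \<le> h * (r / 2)"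
            using g(4) wv by simp
          finally have "\<epsilon> * h < norm (z - y - h *\<^sub>R w) + h * (r / 2)"
            using far[OF that] by simp
          moreover have "2 * r * h \<le> \<epsilon> * h"
            using r(3) g(4) by (intro mult_right_mono) auto
          moreover have "0 \<le> r * h"
            using r(2) g(4) by simp
          ultimately show ?thesis
            by (simp add: algebra_simps)
        qed
        then have "escaping r w s (y, h)"
          using g by (simp add: escaping_def)
        moreover have "dist (s, y, h) (t, x t, 0) < e"
        proof -
          have "dist (s, y, h) (t, x t, 0) \<le> dist s t + (dist y (x t) + dist h 0)"
            using dist_Pair_le[of s "(y, h)" t "(x t, 0)"] dist_Pair_le[of y h "x t" 0] by linarith
          then show ?thesis
            using g by (simp add: dist_norm)
        qed
        ultimately show "\<exists>z\<in>{z. escaping r w (fst z) (snd z) \<and> 0 < snd (snd z)}. dist z (t, x t, 0) < e"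
          using g(4) by (intro bexI[of _ "(s, y, h)"]) auto
      qed
      then have "t \<in> E w r"
        unfolding E_def using t0 v wv by blast
      with notE[OF w(1) r(1,2)] show False ..
    qed
    define \<zeta> where "\<zeta> = d (x t, t) - v"
    have "(t, x t, \<zeta>) \<in> closure {z. PN z}"
      unfolding closure_approachable
    proof (intro allI impI)
      fix e :: real assume "0 < e"
      then have "0 < e / 3" by simp
      from proximal_normals_approximate_defect[OF d \<Lambda> scheme X_lip X_mem cluster t0 v tangent this]
      obtain s y \<xi> where g: "\<bar>s - t\<bar> < e / 3" "norm (y - x t) < e / 3" "norm (\<xi> - \<zeta>) < e / 3" "PN (s, y, \<xi>)"
        unfolding PN \<zeta>_def by blast
      have "dist (s, y, \<xi>) (t, x t, \<zeta>) \<le> dist s t + (dist y (x t) + dist \<xi> \<zeta>)"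
        using dist_Pair_le[of s "(y, \<xi>)" t "(x t, \<zeta>)"] dist_Pair_le[of y \<xi> "x t" \<zeta>] by linarith
      then have "dist (s, y, \<xi>) (t, x t, \<zeta>) < e"
        using g by (simp add: dist_norm)
      with g(4) show "\<exists>z\<in>{z. PN z}. dist z (t, x t, \<zeta>) < e"
        by blast
    qed
    then have "(x t, \<zeta>) \<in> closure {q. PN (t, q)}"
      using tF unfolding F_def by blast
    then obtain q where q: "\<And>k. q k \<in> {q. PN (t, q)}" "q \<longlonglongrightarrow> (x t, \<zeta>)"
      unfolding closure_sequential by blast
    have "PN (t, fst (q k), snd (q k))" for k
      using q(1)[of k] by simp
    then have "fst (q k) \<in> C t \<and> snd (q k) \<in> proximal_normals (C t) (fst (q k))" for k
      unfolding PN by (simp add: Gr_def)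
    moreover have "(\<lambda>k. fst (q k)) \<longlonglongrightarrow> x t" "(\<lambda>k. snd (q k)) \<longlonglongrightarrow> \<zeta>"
      using tendsto_fst[OF q(2)] tendsto_snd[OF q(2)] by simp_all
    ultimately have "\<zeta> \<in> limiting_normals (C t) (x t)"
      unfolding limiting_normals_def
      by (intro CollectI exI[of _ "\<lambda>k. fst (q k)"] exI[of _ "\<lambda>k. snd (q k)"] conjI allI) simp_all
    then show ?thesis
      using has_vector_derivative_at_within[OF v] by (intro exI[of _ v]) (auto simp: \<zeta>_def intro!: exI[of _ "d (x t, t) - v"])
  qed
  have "sweeping_solution T C d x0 x"
    unfolding sweeping_solution_def
  proof (intro conjI ballI)
    show "abs_continuous_on 0 T x"
      unfolding abs_continuous_on_def
    proof (intro allI impI)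
      fix \<epsilon> :: real assume "0 < \<epsilon>"
      show "\<exists>\<delta>>0. \<forall>m a b. (\<forall>k<m. 0 \<le> a k \<and> a k \<le> b k \<and> b k \<le> T) \<longrightarrow>
        disjoint_family_on (\<lambda>k. {a k<..<b k}) {..<m} \<longrightarrow>
        (\<Sum>k<m. b k - a k) < \<delta> \<longrightarrow> (\<Sum>k<(m::nat). dist (x (a k)) (x (b k))) < \<epsilon>"
      proof (intro exI[of _ "\<epsilon> / (\<Lambda> + 1)"] conjI allI impI)
        show "0 < \<epsilon> / (\<Lambda> + 1)"
          using \<open>0 < \<epsilon>\<close> \<Lambda> by simp
        fix m :: nat and a b :: "nat \<Rightarrow> real"
        assume ab: "\<forall>k<m. 0 \<le> a k \<and> a k \<le> b k \<and> b k \<le> T" and less: "(\<Sum>k<m. b k - a k) < \<epsilon> / (\<Lambda> + 1)"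
        have nonneg: "0 \<le> (\<Sum>k<m. b k - a k)"
          using ab by (intro sum_nonneg) auto
        have "(\<Sum>k<m. dist (x (a k)) (x (b k))) \<le> (\<Sum>k<m. \<Lambda> * (b k - a k))"
        proof (rule sum_mono)
          fix k assume "k \<in> {..<m}"
          then show "dist (x (a k)) (x (b k)) \<le> \<Lambda> * (b k - a k)"
            using ab x_lip[of "a k" "b k"] by (auto simp: dist_norm)
        qed
        also have "\<dots> = \<Lambda> * (\<Sum>k<m. b k - a k)"
          by (simp add: sum_distrib_left)
        also have "\<dots> \<le> (\<Lambda> + 1) * (\<Sum>k<m. b k - a k)"
          using nonneg by (intro mult_right_mono) auto
        also have "\<dots> < \<epsilon>"
          using less \<Lambda> by (simp add: field_simps)
        finally show "(\<Sum>k<m. dist (x (a k)) (x (b k))) < \<epsilon>" .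
      qed
    qed
    show "AE t in lebesgue_on {0..T}. \<exists>v. (x has_vector_derivative v) (at t within {0..T}) \<and>
        v \<in> {d (x t, t) - \<zeta> | \<zeta>. \<zeta> \<in> limiting_normals (C t) (x t)}"
    proof (subst AE_restrict_space_iff)
      show "AE t in lebesgue. t \<in> {0..T} \<longrightarrow> (\<exists>v. (x has_vector_derivative v) (at t within {0..T}) \<and>
        v \<in> {d (x t, t) - \<zeta> | \<zeta>. \<zeta> \<in> limiting_normals (C t) (x t)})"
        using ae by eventually_elim (use good in blast)
    qed simp
  qed (use x_init x_mem in auto)
  then show ?thesis by blast
qed

end

section \<open>From Hausdorff distance and coordinate lists to the abstract setting\<close>

lemma infdist_le_hausdorff_dist:
  assumes "compact A" "B \<noteq> {}" "a \<in> A"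
  shows "infdist a B \<le> hausdorff_dist A B"
proof -
  have "compact ((\<lambda>a. infdist a B) ` A)"
    using assms(1) by (intro compact_continuous_image continuous_intros)
  then have "bdd_above ((\<lambda>a. infdist a B) ` A)"
    by (intro bounded_imp_bdd_above compact_imp_bounded)
  then have "infdist a B \<le> (SUP a\<in>A. infdist a B)"
    using assms(3) by (intro cSUP_upper)
  then show ?thesis
    by (simp add: hausdorff_dist_def)
qed

text \<open>The coordinate functionals taken in the order given by \<open>e\<close> witness
  definability directly, so no permutation of coordinates has to be carried out inside the
  structure.\<close>

lemma (in o_minimal_structure) definable_multimap_imp_definable:
  fixes F :: "real \<Rightarrow> (real ^ 'n) set"
  assumes "definable_multimap S D F"
  shows "definable (\<lambda>z. fst z \<in> D \<and> snd z \<in> F (fst z))"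
proof -
  obtain e :: "nat \<Rightarrow> 'n" where e: "bij_betw e {..<CARD('n)} UNIV"
    and G: "{t # coords e y | t y. t \<in> D \<and> y \<in> F t} \<in> S (1 + CARD('n))"
    using assms unfolding definable_multimap_def by blast
  define fs :: "(real \<times> (real ^ 'n) \<Rightarrow> real) list" where
    "fs = fst # map (\<lambda>i z. snd z $ e i) [0..<CARD('n)]"
  have map_fs: "map (\<lambda>f. f z) fs = fst z # coords e (snd z)" for z
    by (simp add: fs_def coords_def o_def)
  have inj: "y = y'" if "coords e y = coords e y'" for y y' :: "real ^ 'n"
  proof -
    have "y $ e i = y' $ e i" if "i < CARD('n)" for i
      using arg_cong[OF \<open>coords e y = coords e y'\<close>, of "\<lambda>xs. xs ! i"] that by (simp add: coords_def)
    moreover have "\<exists>i<CARD('n). j = e i" for j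
      using e unfolding bij_betw_def by (metis UNIV_I imageE lessThan_iff)
    ultimately show ?thesis
      unfolding vec_eq_iff by metis
  qed
  show ?thesis
  proof (rule definableI[of fs])
    fix f assume "f \<in> set fs"
    then consider "f = fst" | i where "f = (\<lambda>z. snd z $ e i)"
      by (auto simp: fs_def)
    then have "bounded_linear f"
    proof cases
      case 2
      then show ?thesis
        using bounded_linear_compose[OF bounded_linear_vec_nth bounded_linear_snd, of "e i"] by simp
    qed (simp add: bounded_linear_fst)
    then show "real_polynomial_function f" ..
  next
    show "{t # coords e y | t y. t \<in> D \<and> y \<in> F t} \<in> S (length fs)"
      using G by (simp add: fs_def)
    show "fst z \<in> D \<and> snd z \<in> F (fst z) \<longleftrightarrow>
        map (\<lambda>f. f z) fs \<in> {t # coords e y | t y. t \<in> D \<and> y \<in> F t}" for z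
      unfolding map_fs using inj by auto
  qed
qed

theorem theorem4p1:
  fixes T :: real
    and C :: "real \<Rightarrow> (real ^ 'n) set"
    and d :: "(real ^ 'n) \<times> real \<Rightarrow> real ^ 'n"
    and x0 :: "real ^ 'n"
    and S :: "nat \<Rightarrow> real list set set"
  assumes "T > 0"
    and "hausdorff_lipschitz_on {0..T} C"
    and "o_minimal_structure S"
    and "definable_multimap S {0..T} C"
    and "\<And>t. t \<in> {0..T} \<Longrightarrow> C t \<noteq> {} \<and> compact (C t)"
    and "continuous_on UNIV d"
    and "x0 \<in> C 0"
  shows "\<exists>x. sweeping_solution T C d x0 x"
proof -
  interpret o_minimal_structure S by fact
  obtain L where L: "0 \<le> L" "\<And>s t. s \<in> {0..T} \<Longrightarrow> t \<in> {0..T} \<Longrightarrow> hausdorff_dist (C s) (C t) \<le> L * \<bar>s - t\<bar>"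
    using assms(2) unfolding hausdorff_lipschitz_on_def by blast
  interpret definable_lipschitz_map S T L C
  proof unfold_locales
    show "definable (\<lambda>z. fst z \<in> {0..T} \<and> snd z \<in> C (fst z))"
      using assms(4) by (rule definable_multimap_imp_definable)
    fix s t y assume st: "s \<in> {0..T}" "t \<in> {0..T}" and y: "y \<in> C s"
    have "infdist y (C t) \<le> L * \<bar>s - t\<bar>"
      using infdist_le_hausdorff_dist[of "C s" "C t" y] L(2)[OF st] assms(5)[OF st(1)] assms(5)[OF st(2)] y
      by linarith
    moreover obtain z where "z \<in> C t" "infdist y (C t) = dist y z"
      using infdist_attains_inf[of "C t" y] assms(5)[OF st(2)] compact_imp_closed by metis
    ultimately show "\<exists>z\<in>C t. dist y z \<le> L * \<bar>s - t\<bar>"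
      by auto
  qed (use assms(1,5) L(1) in auto)
  show ?thesis
    using assms(6,7) by (rule sweeping_solution_exists)
qed

end
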